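(* Let $\rho>1$ and let $F$ be a $\mathbb{C}^N$-valued function that is analytic in $E$ and meromorphic in $E_\rho=\mathrm{int}\,\Gamma_\rho$, with exactly $\mu$ poles $z_1,\dots,z_\mu$ in $E_\rho$, all simple, so that $F(z)=\sum_{s=1}^\mu\frac{v_s}{z-z_s}+\Theta(z)$ with $v_s\in\mathbb{C}^N$ nonzero and $\Theta$ analytic in $E_\rho$. Order the poles so that $\Phi(z_1)\le\Phi(z_2)\le\cdots\le\Phi(z_\mu)\le\rho$. Let $k\ge1$ be fixed, assume $\prod_{i=1}^k(q,v_i)\ne0$, and let $S(z)=\prod_{i=1}^k(z-z_i)$. (i) When $k<\mu$, assume that $$\Phi(z_k)<\Phi(z_{k+1})=\cdots=\Phi(z_{k+r})<\begin{cases}\Phi(z_{k+r+1})&\text{if }k+r<\mu,\\ \rho&\text{if }k+r=\mu.\end{cases}$$ Then $T_{1,\dots,k}\ne0$, and $$Q(z)=(-1)^kT_{1,\dots,k}\,V(z,z_1,\dots,z_k)\Big[\prod_{i=1}^k\Psi_p(z_i)\Big]^{-1}\Big[1+O\Big(\frac{\Psi_p(z_k)}{\widetilde\Psi_{p,k}}\Big)\Big]\quad\text{as }p\to\infty,$$ uniformly in every compact subset of $\mathbb{C}\setminus\{z_1,\dots,z_k\}$, where $|\widetilde\Psi_{p,k}|=\min_{1\le j\le r}|\Psi_p(z_{k+j})|$. Thus, with the normalization $c_k=1$, $$V_{p,k}(z)-S(z)=O\Big(\frac{\Psi_p(z_k)}{\widetilde\Psi_{p,k}}\Big)\quad\text{as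 }p\to\infty,$$ and consequently $$\limsup_{p\to\infty}|V_{p,k}(z)-S(z)|^{1/p}\le\frac{\Phi(z_k)}{\Phi(z_{k+1})}.$$ (ii) When $k=\mu$, $$\limsup_{p\to\infty}|V_{p,k}(z)-S(z)|^{1/p}\le\frac{\Phi(z_k)}{\rho},$$ uniformly on every compact subset of $\mathbb{C}\setminus\{z_1,\dots,z_\mu\}$.
   Context: Sets and interpolation points. $E$ is a closed and bounded set in the complex plane whose complement $K$ (which includes the point at infinity) has a classical Green's function $g(z)$ with pole at infinity, continuous on $\partial E$ and zero on $\partial E$. Put $\Phi(z)=\exp[g(z)]$ and $\kappa=\mathrm{cap}(E)$, the logarithmic capacity of $E$. For $\sigma>1$, $\Gamma_\sigma$ is the locus $\Phi(z)=\sigma$ and $E_\sigma=\mathrm{int}\,\Gamma_\sigma$ is its interior (so $E\subset E_\sigma$). For each $p\in\{1,2,\dots\}$ there is given a set of interpolation points $\xi^{(p)}_1,\dots,\xi^{(p)}_{p+k}$, not necessarily distinct (equal points being listed consecutively), such that the $\xi_i^{(p)}$ have no limit points in $K$ and $$\lim_{p\to\infty}\Big|\prod_{i=1}^{p+k}(z-\xi_i^{(p)})\Big|^{1/p}=\kappa\,\Phi(z)$$ uniformly in $z$ on every compact subset of $K$. For fixed $p$ write $\xi_i=\xi_i^{(p)}$. The ITEA construction. $(\cdot,\cdot)$ is an inner product on $\mathbb{C}^N$ (linear in its second argument) and $q\in\mathbb{C}^N$ is a fixed nonzero vector. Put $\psi_{m,n}(z)=\prod_{r=m}^n(z-\xi_r)$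 for $n\ge m\ge1$, $\psi_{m,m-1}(z)=1$, and $\Psi_p(z)=\psi_{1,p+k}(z)$. Let $D_{m,n}=F[\xi_m,\dots,\xi_n]$ be the divided difference of $F$ over $\{\xi_m,\dots,\xi_n\}$ (in the generalized Hermite sense if points coincide), and put $u_{i,j}=(q,D_{j+1,p+i})$. The denominator polynomial is $V_{p,k}(z)=\sum_{j=0}^kc_j\psi_{1,j}(z)$, where $c_k=1$ and $c_0,\dots,c_{k-1}$ solve $\sum_{j=0}^{k-1}u_{i,j}c_j=-u_{i,k}$, $i=1,\dots,k$ (uniquely solvable when $\det(u_{i,j})_{1\le i\le k,\,0\le j\le k-1}\ne0$). $Q(z)$ (depending on $p$) is the $(k+1)\times(k+1)$ determinant with first row $\psi_{1,0}(z),\psi_{1,1}(z),\dots,\psi_{1,k}(z)$ and with $(i+1)$-st row $u_{i,0},u_{i,1},\dots,u_{i,k}$ for $i=1,\dots,k$. Determinants. $V(x_0,x_1,\dots,x_n)=\prod_{0\le i<j\le n}(x_j-x_i)$ is the Vandermonde determinant. $T_{s_1,\dots,s_k}=\det(\alpha_{i,s_j})_{1\le i,j\le k}$, where $\alpha_{i,s}=(q,v_s)\,\psi_{p+i+1,p+k}(z_s)$; this determinant does not depend on $p$.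
   Formalization: In (i) the error terms use max |Ψ_p(z_i)| over i ≤ k with Φ(z_i)=Φ(z_k) in place of Ψ_p(z_k); as written the O-bounds fail when z_k shares its level line with another z_i (e.g. poles -2, 2, 3, k=2, unit disc). The limsup bounds are unchanged. *)

theory Defs
  imports "HOL-Complex_Analysis.Complex_Analysis" "Jordan_Normal_Form.Determinant"
begin

no_notation Matrix.vec_index (infixl \<open>$\<close> 100)

text \<open>The witnesses are the first and second partial derivatives of \<open>u\<close>: \<open>u\<close> is twice continuously
  differentiable on \<open>U\<close> in the real sense and satisfies Laplace's equation there.\<close>

definition harmonic_on :: "(complex \<Rightarrow> real) \<Rightarrow> complex set \<Rightarrow> bool" where
  "harmonic_on u U \<longleftrightarrow> open U \<and>
     (\<exists>ux uy uxx uxy uyx uyy.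
        continuous_on U uxx \<and> continuous_on U uxy \<and> continuous_on U uyx \<and> continuous_on U uyy \<and>
        (\<forall>z\<in>U. (u has_derivative (\<lambda>h. ux z * Re h + uy z * Im h)) (at z) \<and>
               (ux has_derivative (\<lambda>h. uxx z * Re h + uxy z * Im h)) (at z) \<and>
               (uy has_derivative (\<lambda>h. uyx z * Re h + uyy z * Im h)) (at z) \<and>
               uxx z + uyy z = 0))"

text \<open>Classical Green's function with pole at infinity of the complement of \<open>E\<close> in the Riemann
  sphere, continuous up to the boundary. A Green's function belongs to a domain; here this need not
  be demanded separately, since positivity on all of \<open>-E\<close> and the boundary values rule out bounded
  components of \<open>-E\<close>. The values of \<open>g\<close> in the interior of \<open>E\<close> are irrelevant.\<close>

definition green_function_infinity :: "complex set \<Rightarrow> (complex \<Rightarrow> real) \<Rightarrow> bool" where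
  "green_function_infinity E g \<longleftrightarrow>
     harmonic_on g (- E) \<and>
     (\<forall>z\<in>- E. g z > 0) \<and>
     (\<exists>\<gamma>. ((\<lambda>z. g z - ln (cmod z)) \<longlongrightarrow> \<gamma>) at_infinity) \<and>
     continuous_on (closure (- E)) g \<and>
     (\<forall>z\<in>frontier E. g z = 0)"

definition green_Phi :: "(complex \<Rightarrow> real) \<Rightarrow> complex \<Rightarrow> real" where
  "green_Phi g z = exp (g z)"

definition level_locus :: "complex set \<Rightarrow> (complex \<Rightarrow> real) \<Rightarrow> real \<Rightarrow> complex set" where
  "level_locus E g \<sigma> = {z \<in> - E. green_Phi g z = \<sigma>}"

definition level_interior :: "complex set \<Rightarrow> (complex \<Rightarrow> real) \<Rightarrow> real \<Rightarrow> complex set" where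
  "level_interior E g \<sigma> = inside (level_locus E g \<sigma>)"

text \<open>Logarithmic capacity of a compact set, as the limit of the \<open>n\<close>-th roots of the least
  sup norms on \<open>E\<close> of the monic polynomials of degree \<open>n\<close>.\<close>

definition log_capacity :: "complex set \<Rightarrow> real" where
  "log_capacity E =
     lim (\<lambda>n. root n (INF r\<in>{r :: complex poly. degree r = n \<and> lead_coeff r = 1}.
                        SUP z\<in>E. cmod (poly r z)))"

text \<open>\<open>\<xi> p i\<close> is the \<open>i\<close>-th of the \<open>p + k\<close> points at stage \<open>p\<close>. A limit point is one every
  neighbourhood of which contains points \<open>\<xi> p i\<close> for infinitely many \<open>p\<close>. The last clause excludes
  the point at infinity, which belongs to the complement of \<open>E\<close>.\<close>

definition no_limit_points_outside :: "complex set \<Rightarrow> nat \<Rightarrow> (nat \<Rightarrow> nat \<Rightarrow> complex) \<Rightarrow> bool" where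
  "no_limit_points_outside E k \<xi> \<longleftrightarrow>
     (\<forall>w\<in>- E. \<exists>\<epsilon>>0. \<forall>\<^sub>F p in sequentially. \<forall>i\<in>{1..p + k}. \<xi> p i \<notin> ball w \<epsilon>) \<and>
     (\<exists>R. \<forall>\<^sub>F p in sequentially. \<forall>i\<in>{1..p + k}. \<xi> p i \<in> cball 0 R)"

definition equal_points_consecutive :: "nat \<Rightarrow> (nat \<Rightarrow> complex) \<Rightarrow> bool" where
  "equal_points_consecutive n x \<longleftrightarrow>
     (\<forall>i j l. 1 \<le> i \<and> i \<le> j \<and> j \<le> l \<and> l \<le> n \<and> x i = x l \<longrightarrow> x j = x i)"

definition node_poly :: "(nat \<Rightarrow> complex) \<Rightarrow> nat \<Rightarrow> nat \<Rightarrow> complex \<Rightarrow> complex" where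
  "node_poly x m n z = (\<Prod>r\<in>{m..n}. z - x r)"

definition Psi :: "nat \<Rightarrow> (nat \<Rightarrow> nat \<Rightarrow> complex) \<Rightarrow> nat \<Rightarrow> complex \<Rightarrow> complex" where
  "Psi k \<xi> p = node_poly (\<xi> p) 1 (p + k)"

text \<open>\<open>divided_diff f x m d\<close> is \<open>f[x m, \<dots>, x (m + d)]\<close>. When equal points are consecutive,
  \<open>x m = x (m + d)\<close> means that all \<open>d + 1\<close> points coincide, so this is the Hermite version.\<close>

fun divided_diff :: "(complex \<Rightarrow> complex) \<Rightarrow> (nat \<Rightarrow> complex) \<Rightarrow> nat \<Rightarrow> nat \<Rightarrow> complex" where
  "divided_diff f x m 0 = f (x m)"
| "divided_diff f x m (Suc d) =
     (if x m = x (m + Suc d) then (deriv ^^ Suc d) f (x m) / fact (Suc d)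
      else (divided_diff f x (Suc m) d - divided_diff f x m d) / (x (m + Suc d) - x m))"

text \<open>\<open>F[x m, \<dots>, x n]\<close>, meaningful for \<open>m \<le> n\<close>.\<close>

definition vec_divided_diff ::
    "(complex \<Rightarrow> complex ^ 'n) \<Rightarrow> (nat \<Rightarrow> complex) \<Rightarrow> nat \<Rightarrow> nat \<Rightarrow> complex ^ 'n" where
  "vec_divided_diff F x m n = (\<chi> l. divided_diff (\<lambda>z. F z $ l) x m (n - m))"

definition is_inner_product :: "(complex ^ 'n \<Rightarrow> complex ^ 'n \<Rightarrow> complex) \<Rightarrow> bool" where
  "is_inner_product ip \<longleftrightarrow>
     (\<forall>x y z. ip x (y + z) = ip x y + ip x z) \<and>
     (\<forall>c x y. ip x (c *s y) = c * ip x y) \<and>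
     (\<forall>x y. ip y x = cnj (ip x y)) \<and>
     (\<forall>x. x \<noteq> 0 \<longrightarrow> Re (ip x x) > 0)"

definition itea_u ::
    "(complex ^ 'n \<Rightarrow> complex ^ 'n \<Rightarrow> complex) \<Rightarrow> complex ^ 'n \<Rightarrow> (complex \<Rightarrow> complex ^ 'n) \<Rightarrow>
     (nat \<Rightarrow> nat \<Rightarrow> complex) \<Rightarrow> nat \<Rightarrow> nat \<Rightarrow> nat \<Rightarrow> complex" where
  "itea_u ip q F \<xi> p i j = ip q (vec_divided_diff F (\<xi> p) (j + 1) (p + i))"

text \<open>Rows and columns of matrices are numbered from 0, whence the shifts below.\<close>

definition itea_det ::
    "(complex ^ 'n \<Rightarrow> complex ^ 'n \<Rightarrow> complex) \<Rightarrow> complex ^ 'n \<Rightarrow> (complex \<Rightarrow> complex ^ 'n) \<Rightarrow>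
     nat \<Rightarrow> (nat \<Rightarrow> nat \<Rightarrow> complex) \<Rightarrow> nat \<Rightarrow> complex" where
  "itea_det ip q F k \<xi> p =
     Determinant.det (Matrix.mat k k (\<lambda>(i, j). itea_u ip q F \<xi> p (i + 1) j))"

definition itea_coeffs ::
    "(complex ^ 'n \<Rightarrow> complex ^ 'n \<Rightarrow> complex) \<Rightarrow> complex ^ 'n \<Rightarrow> (complex \<Rightarrow> complex ^ 'n) \<Rightarrow>
     nat \<Rightarrow> (nat \<Rightarrow> nat \<Rightarrow> complex) \<Rightarrow> nat \<Rightarrow> nat \<Rightarrow> complex" where
  "itea_coeffs ip q F k \<xi> p =
     (THE c. c k = 1 \<and> (\<forall>j>k. c j = 0) \<and>
        (\<forall>i\<in>{1..k}. (\<Sum>j<k. itea_u ip q F \<xi> p i j * c j) = - itea_u ip q F \<xi> p i k))"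

definition itea_V ::
    "(complex ^ 'n \<Rightarrow> complex ^ 'n \<Rightarrow> complex) \<Rightarrow> complex ^ 'n \<Rightarrow> (complex \<Rightarrow> complex ^ 'n) \<Rightarrow>
     nat \<Rightarrow> (nat \<Rightarrow> nat \<Rightarrow> complex) \<Rightarrow> nat \<Rightarrow> complex \<Rightarrow> complex" where
  "itea_V ip q F k \<xi> p z = (\<Sum>j\<le>k. itea_coeffs ip q F k \<xi> p j * node_poly (\<xi> p) 1 j z)"

definition itea_Q ::
    "(complex ^ 'n \<Rightarrow> complex ^ 'n \<Rightarrow> complex) \<Rightarrow> complex ^ 'n \<Rightarrow> (complex \<Rightarrow> complex ^ 'n) \<Rightarrow>
     nat \<Rightarrow> (nat \<Rightarrow> nat \<Rightarrow> complex) \<Rightarrow> nat \<Rightarrow> complex \<Rightarrow> complex" where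
  "itea_Q ip q F k \<xi> p z =
     Determinant.det (Matrix.mat (k + 1) (k + 1)
       (\<lambda>(i, j). if i = 0 then node_poly (\<xi> p) 1 j z else itea_u ip q F \<xi> p i j))"

definition vandermonde :: "nat \<Rightarrow> (nat \<Rightarrow> complex) \<Rightarrow> complex" where
  "vandermonde n x = (\<Prod>j\<le>n. \<Prod>i<j. x j - x i)"

definition itea_alpha ::
    "(complex ^ 'n \<Rightarrow> complex ^ 'n \<Rightarrow> complex) \<Rightarrow> complex ^ 'n \<Rightarrow> nat \<Rightarrow> (nat \<Rightarrow> nat \<Rightarrow> complex) \<Rightarrow>
     (nat \<Rightarrow> complex) \<Rightarrow> (nat \<Rightarrow> complex ^ 'n) \<Rightarrow> nat \<Rightarrow> nat \<Rightarrow> nat \<Rightarrow> complex" where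
  "itea_alpha ip q k \<xi> zs vs p i s = ip q (vs s) * node_poly (\<xi> p) (p + i + 1) (p + k) (zs s)"

text \<open>\<open>T\<close> with indices \<open>s 1, \<dots>, s k\<close>, computed from the points of stage \<open>p\<close>.\<close>

definition itea_T ::
    "(complex ^ 'n \<Rightarrow> complex ^ 'n \<Rightarrow> complex) \<Rightarrow> complex ^ 'n \<Rightarrow> nat \<Rightarrow> (nat \<Rightarrow> nat \<Rightarrow> complex) \<Rightarrow>
     (nat \<Rightarrow> complex) \<Rightarrow> (nat \<Rightarrow> complex ^ 'n) \<Rightarrow> nat \<Rightarrow> (nat \<Rightarrow> nat) \<Rightarrow> complex" where
  "itea_T ip q k \<xi> zs vs p s =
     Determinant.det (Matrix.mat k k
       (\<lambda>(i, j). itea_alpha ip q k \<xi> zs vs p (i + 1) (s (j + 1))))"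

text \<open>If several of \<open>z\<^sub>1, \<dots>, z\<^sub>k\<close> lie on the same level line as \<open>z\<^sub>k\<close>, the corresponding values of
  \<open>\<Psi>\<^sub>p\<close> are comparable only up to subexponential factors, and the error is governed by the largest
  of them, just as the smallest is taken among \<open>z\<^bsub>k+1\<^esub>, \<dots>, z\<^bsub>k+r\<^esub>\<close>. If \<open>z\<^sub>k\<close> is
  the only one on its level line, \<open>Psi_hat\<close> is the modulus of \<open>\<Psi>\<^sub>p(z\<^sub>k)\<close>.\<close>

definition Psi_hat ::
    "(complex \<Rightarrow> real) \<Rightarrow> nat \<Rightarrow> (nat \<Rightarrow> nat \<Rightarrow> complex) \<Rightarrow> (nat \<Rightarrow> complex) \<Rightarrow> nat \<Rightarrow> real" where
  "Psi_hat g k \<xi> zs p =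
     Max ((\<lambda>i. cmod (Psi k \<xi> p (zs i))) ` {i \<in> {1..k}. green_Phi g (zs i) = green_Phi g (zs k)})"

definition Psi_tilde ::
    "nat \<Rightarrow> nat \<Rightarrow> (nat \<Rightarrow> nat \<Rightarrow> complex) \<Rightarrow> (nat \<Rightarrow> complex) \<Rightarrow> nat \<Rightarrow> real" where
  "Psi_tilde r k \<xi> zs p = Min ((\<lambda>j. cmod (Psi k \<xi> p (zs (k + j)))) ` {1..r})"

text \<open>\<open>f p z = O(h p)\<close> as \<open>p\<close> tends to infinity, uniformly for \<open>z \<in> C\<close>.\<close>

definition uniform_bigo ::
    "complex set \<Rightarrow> (nat \<Rightarrow> complex \<Rightarrow> complex) \<Rightarrow> (nat \<Rightarrow> real) \<Rightarrow> bool" where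
  "uniform_bigo C f h \<longleftrightarrow>
     (\<exists>M. \<forall>\<^sub>F p in sequentially. \<forall>z\<in>C. cmod (f p z) \<le> M * h p)"

end

theory Submission
  imports Defs
begin

no_notation fps_nth (infixl \<open>$\<close> 75)

text \<open>A simple pole \<open>a\<close> contributes \<open>-1 / \<psi>\<^bsub>m,n\<^esub>(a)\<close> to the divided difference over
  \<open>\<xi>\<^sub>m, \<dots>, \<xi>\<^sub>n\<close>, and \<open>\<Theta>\<close> contributes a Cauchy integral of \<open>\<Theta> / \<psi>\<^bsub>m,n\<^esub>\<close> over segments on which
  \<open>\<Phi> > \<sigma>\<close>, hence \<open>O((\<kappa>\<sigma>)\<^sup>-\<^sup>p)\<close> for every \<open>\<sigma> < \<rho>\<close>. So the matrix of the \<open>u\<^bsub>i,j\<^esub>\<close> is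
  \<open>-A D P - Y\<close>, where \<open>A = (\<alpha>\<^bsub>i,s\<^esub>)\<close> and \<open>P = (\<psi>\<^bsub>1,j\<^esub>(z\<^sub>s))\<close> with \<open>s \<le> k\<close>, \<open>D\<close> is diagonal with
  entries \<open>1 / \<Psi>\<^sub>p(z\<^sub>s)\<close>, and \<open>Y\<close> collects the remaining poles and \<open>\<Theta>\<close>. The entries of \<open>A\<close> are bounded
  and its determinant \<open>T\<close> is a nonzero constant, so \<open>A\<close> has a bounded inverse and the matrix equals
  \<open>-A D (P + R)\<close> with \<open>R = D\<^sup>-\<^sup>1 A\<^sup>-\<^sup>1 Y\<close> of the order of the claimed error. Both \<open>Q\<close> and the
  determinant of the linear system are thereby reduced to perturbed Newton-Vandermonde determinants,
  and \<open>V\<^bsub>p,k\<^esub>\<close> is their quotient by Cramer's rule.\<close>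

section \<open>Determinants of function-indexed matrices\<close>

text \<open>The factor \<open>D\<close> has to be removed exactly before anything is estimated: its
  entries may differ exponentially among \<open>s \<le> k\<close>, and an additive perturbation
  bound for the determinant of the \<open>u\<close> themselves would measure every product in the
  Leibniz expansion against the largest entries. Once \<open>A D\<close> is split off on the left,
  only the ratio of the largest kept \<open>\<Psi>\<^sub>p\<close> to the smallest competing
  quantity survives.

  The nodes vary with \<open>p\<close> and need not converge, so \<open>A\<close> and
  \<open>P\<close> need not have limits. Their determinants are constant all the same: up to column
  factors both matrices consist of Newton bases evaluated at the poles, and such a determinant is a
  Vandermonde determinant whatever the nodes are. The main terms are therefore exact.

  Cases (i) and (ii) differ only in the scale against which \<open>Y\<close> is measured. In (i) it
  is the least modulus of \<open>\<Psi>\<^sub>p\<close> on the level line of the first discarded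
  poles, and a \<sigma> between that level and \<rho> keeps \<Theta> below this scale. In (ii) only
  \<Theta> remains; the scale is \<open>(\<kappa>\<sigma>)^p\<close>, and \<sigma> tends to \<rho>
  at the end.\<close>

abbreviation fdet :: "nat \<Rightarrow> (nat \<Rightarrow> nat \<Rightarrow> 'a::comm_ring_1) \<Rightarrow> 'a" where
  "fdet n a \<equiv> Determinant.det (Matrix.mat n n (\<lambda>(i, j). a i j))"

lemma fdet_cong:
  assumes "\<And>i j. i < n \<Longrightarrow> j < n \<Longrightarrow> a i j = b i j"
  shows "fdet n a = fdet n b"
  by (rule arg_cong[where f = Determinant.det]) (use assms in \<open>auto intro!: eq_matI\<close>)

lemma fdet_expand:
  "fdet n a = (\<Sum>p | p permutes {0..<n}. of_int (sign p) * (\<Prod>i = 0..<n. a i (p i)))"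
proof -
  have "fdet n a = (\<Sum>p | p permutes {0..<n}.
      of_int (sign p) * (\<Prod>i = 0..<n. Matrix.mat n n (\<lambda>(i, j). a i j) $$ (i, p i)))"
    by (rule det_def') simp
  also have "\<dots> = (\<Sum>p | p permutes {0..<n}. of_int (sign p) * (\<Prod>i = 0..<n. a i (p i)))"
  proof (intro sum.cong refl arg_cong2[where f = "(*)"] prod.cong)
    fix p i assume "p \<in> {p. p permutes {0..<n}}" "i \<in> {0..<n}"
    then have "p i \<in> {0..<n}" by (simp only: mem_Collect_eq permutes_in_image)
    with \<open>i \<in> {0..<n}\<close> show "Matrix.mat n n (\<lambda>(i, j). a i j) $$ (i, p i) = a i (p i)" by simp
  qed
  finally show ?thesis .
qed

lemma fdet_mult:
  "fdet n (\<lambda>i j. \<Sum>l<n. a i l * b l j) = fdet n a * fdet n b"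
proof -
  have "Matrix.mat n n (\<lambda>(i, j). a i j) * Matrix.mat n n (\<lambda>(i, j). b i j)
      = Matrix.mat n n (\<lambda>(i, j). \<Sum>l<n. a i l * b l j)"
    by (auto intro!: eq_matI sum.cong simp: scalar_prod_def lessThan_atLeast0)
  then show ?thesis by (metis det_mult mat_carrier)
qed

lemma fdet_upper_triangular:
  assumes "\<And>i j. j < i \<Longrightarrow> i < n \<Longrightarrow> a i j = 0"
  shows "fdet n a = (\<Prod>i<n. a i i)"
proof -
  have "fdet n a = prod_list (diag_mat (Matrix.mat n n (\<lambda>(i, j). a i j)))"
    using assms by (intro det_upper_triangular[where n = n]) (auto simp: upper_triangular_def)
  also have "\<dots> = (\<Prod>i<n. a i i)"
    by (simp add: prod_list_diag_prod lessThan_atLeast0)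
  finally show ?thesis .
qed

lemma fdet_lower_triangular:
  assumes "\<And>i j. i < j \<Longrightarrow> j < n \<Longrightarrow> a i j = 0"
  shows "fdet n a = (\<Prod>i<n. a i i)"
proof -
  have "fdet n a = prod_list (diag_mat (Matrix.mat n n (\<lambda>(i, j). a i j)))"
    using assms by (intro det_lower_triangular[where n = n]) auto
  also have "\<dots> = (\<Prod>i<n. a i i)"
    by (simp add: prod_list_diag_prod lessThan_atLeast0)
  finally show ?thesis .
qed

lemma fdet_scale_cols:
  "fdet n (\<lambda>i j. a i j * d j) = fdet n a * (\<Prod>j<n. d j)"
proof -
  have "(\<Prod>i = 0..<n. d (p i)) = (\<Prod>j<n. d j)" if "p permutes {0..<n}" for p
    using prod.permute[OF that, of d] by (simp add: o_def lessThan_atLeast0)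
  then show ?thesis
    by (simp add: fdet_expand prod.distrib sum_distrib_right mult.assoc)
qed

lemma fdet_transpose: "fdet n (\<lambda>i j. a j i) = fdet n a"
proof -
  have "(Matrix.mat n n (\<lambda>(i, j). a i j))\<^sup>T = Matrix.mat n n (\<lambda>(i, j). a j i)"
    by (auto intro!: eq_matI)
  then show ?thesis by (metis Determinant.det_transpose mat_carrier)
qed

text \<open>Meant for \<open>itea_T\<close>, whose rows run through a Newton basis from the highest
  degree down. The sign of the reversal stays unevaluated: it only has to be nonzero and independent
  of \<open>p\<close>.\<close>

lemma fdet_reverse_rows:
  "fdet n (\<lambda>i j. a (n - 1 - i) j)
     = of_int (sign (\<lambda>i. if i < n then n - 1 - i else i)) * fdet n a"
proof -
  define p where "p = (\<lambda>i. if i < n then n - 1 - i else i)"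
  have p: "p permutes {0..<n}"
    by (intro bij_imp_permutes bij_betw_byWitness[where f' = p]) (auto simp: p_def)
  have "fdet n (\<lambda>i j. a (n - 1 - i) j)
      = Determinant.det (Matrix.mat n n (\<lambda>(i, j). Matrix.mat n n (\<lambda>(i, j). a i j) $$ (p i, j)))"
    by (rule arg_cong[where f = Determinant.det]) (auto intro!: eq_matI simp: p_def)
  also have "\<dots> = of_int (sign p) * fdet n a"
    by (rule det_permute_rows[OF _ p]) simp
  finally show ?thesis by (simp add: p_def)
qed

text \<open>The block matrix with blocks 1 and \<open>a\<close>. Multiplication by it from the left
  acts on all rows but the first, which is how a left factor is extracted from a determinant with an
  extra first row.\<close>

lemma fdet_border:
  "fdet (Suc n) (\<lambda>i j. case i of 0 \<Rightarrow> (if j = 0 then 1 else 0)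
       | Suc i' \<Rightarrow> (case j of 0 \<Rightarrow> 0 | Suc j' \<Rightarrow> a i' j')) = fdet n a"
  (is "fdet _ ?b = _")
proof -
  let ?B = "Matrix.mat (Suc n) (Suc n) (\<lambda>(i, j). ?b i j)"
  have "Determinant.det ?B = (\<Sum>j<Suc n. ?B $$ (0, j) * cofactor ?B 0 j)"
    by (rule laplace_expansion_row) auto
  also have "\<dots> = ?B $$ (0, 0) * cofactor ?B 0 0"
    by (subst sum.remove[of _ 0]) (auto intro!: sum.neutral)
  also have "mat_delete ?B 0 0 = Matrix.mat n n (\<lambda>(i, j). a i j)"
    by (auto simp: mat_delete_def intro!: eq_matI)
  then have "?B $$ (0, 0) * cofactor ?B 0 0 = fdet n a"
    by (simp add: cofactor_def)
  finally show ?thesis .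
qed

text \<open>Multiplication from the right by the unitriangular matrix with last column
  \<open>c\<close> changes only the last column: there the top entry alone survives, and expansion
  along that column leaves the minor \<open>w\<close> with sign \<open>(- 1) ^ n\<close>.\<close>

lemma fdet_cramer:
  assumes "c n = 1" and "\<And>i. i < n \<Longrightarrow> (\<Sum>j\<le>n. w i j * c j) = 0"
  shows "fdet (Suc n) (\<lambda>i j. case i of 0 \<Rightarrow> v j | Suc i' \<Rightarrow> w i' j)
           = (- 1) ^ n * fdet n w * (\<Sum>j\<le>n. c j * v j)"
proof -
  let ?a = "\<lambda>i j. case i of 0 \<Rightarrow> v j | Suc i' \<Rightarrow> w i' j"
  define b where "b = (\<lambda>l j. if j = n then c l else if l = j then 1 else 0)"
  have "fdet (Suc n) b = (\<Prod>i<Suc n. b i i)"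
    by (rule fdet_upper_triangular) (auto simp: b_def)
  also have "\<dots> = 1" by (intro prod.neutral) (auto simp: b_def assms(1))
  finally have b: "fdet (Suc n) b = 1" .
  define m where "m = (\<lambda>i j. if j = n then (if i = 0 then \<Sum>j\<le>n. c j * v j else 0) else ?a i j)"
  let ?M = "Matrix.mat (Suc n) (Suc n) (\<lambda>(i, j). m i j)"
  have "fdet (Suc n) ?a = fdet (Suc n) ?a * fdet (Suc n) b" by (simp add: b)
  also have "\<dots> = fdet (Suc n) (\<lambda>i j. \<Sum>l<Suc n. ?a i l * b l j)"
    by (rule fdet_mult[symmetric])
  also have "\<dots> = fdet (Suc n) m"
  proof (rule fdet_cong)
    fix i j assume ij: "i < Suc n" "j < Suc n"
    show "(\<Sum>l<Suc n. ?a i l * b l j) = m i j"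
    proof (cases "j = n")
      case True
      then show ?thesis using ij assms(2)[of "i - 1"]
        by (cases i) (simp_all add: b_def m_def lessThan_Suc_atMost mult.commute del: sum.lessThan_Suc)
    next
      case False
      then have "(\<Sum>l<Suc n. ?a i l * b l j) = (\<Sum>l<Suc n. if l = j then ?a i l else 0)"
        by (intro sum.cong) (auto simp: b_def)
      also have "\<dots> = ?a i j" using ij by (simp add: sum.delta del: sum.lessThan_Suc)
      finally show ?thesis using False by (simp add: m_def)
    qed
  qed
  also have "\<dots> = (\<Sum>i<Suc n. ?M $$ (i, n) * cofactor ?M i n)"
    by (rule laplace_expansion_column) auto
  also have "\<dots> = ?M $$ (0, n) * cofactor ?M 0 n"
    by (subst sum.remove[of _ 0]) (auto intro!: sum.neutral simp: m_def)
  also have "mat_delete ?M 0 n = Matrix.mat n n (\<lambda>(i, j). w i j)"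
    by (auto simp: mat_delete_def m_def intro!: eq_matI)
  then have "?M $$ (0, n) * cofactor ?M 0 n = (- 1) ^ n * fdet n w * (\<Sum>j\<le>n. c j * v j)"
    by (simp add: cofactor_def m_def)
  finally show ?thesis .
qed

text \<open>The adjugate over the determinant is an inverse on both sides: as a right inverse it
  produces a solution, as a left inverse it forces every solution to agree with it. Fixing
  \<open>c\<close> at and beyond \<open>n\<close> makes it unique as a function, as a definite
  description requires.\<close>

lemma fdet_unique_solution:
  fixes w :: "nat \<Rightarrow> nat \<Rightarrow> 'a::field"
  assumes "fdet n w \<noteq> 0"
  shows "\<exists>!c. c n = 1 \<and> (\<forall>j>n. c j = 0) \<and> (\<forall>i<n. (\<Sum>j<n. w i j * c j) = r i)"
proof -
  let ?W = "Matrix.mat n n (\<lambda>(i, j). w i j)"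
  define d where "d = fdet n w"
  define b where "b = (\<lambda>i j. adj_mat ?W $$ (i, j) / d)"
  have adj: "adj_mat ?W \<in> carrier_mat n n" "?W * adj_mat ?W = d \<cdot>\<^sub>m 1\<^sub>m n"
    "adj_mat ?W * ?W = d \<cdot>\<^sub>m 1\<^sub>m n"
    using adj_mat[of ?W n] by (auto simp: d_def)
  have d: "d \<noteq> 0" using assms by (simp add: d_def)
  have wb: "(\<Sum>l<n. w i l * b l j) = (if i = j then 1 else 0)" if "i < n" "j < n" for i j
  proof -
    have "(\<Sum>l<n. w i l * adj_mat ?W $$ (l, j)) = (?W * adj_mat ?W) $$ (i, j)"
      using that adj(1) by (auto simp: scalar_prod_def lessThan_atLeast0 intro!: sum.cong)
    also have "\<dots> = (if i = j then d else 0)" using that by (simp add: adj(2))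
    finally show ?thesis using d by (simp add: b_def flip: sum_divide_distrib)
  qed
  have bw: "(\<Sum>l<n. b i l * w l j) = (if i = j then 1 else 0)" if "i < n" "j < n" for i j
  proof -
    have "(\<Sum>l<n. adj_mat ?W $$ (i, l) * w l j) = (adj_mat ?W * ?W) $$ (i, j)"
      using that adj(1) by (auto simp: scalar_prod_def lessThan_atLeast0 intro!: sum.cong)
    also have "\<dots> = (if i = j then d else 0)" using that by (simp add: adj(3))
    finally show ?thesis using d by (simp add: b_def flip: sum_divide_distrib)
  qed
  show ?thesis
  proof (rule ex1I)
    let ?c = "\<lambda>j. if j < n then \<Sum>l<n. b j l * r l else if j = n then 1 else 0"
    show "?c n = 1 \<and> (\<forall>j>n. ?c j = 0) \<and> (\<forall>i<n. (\<Sum>j<n. w i j * ?c j) = r i)"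
    proof (intro conjI allI impI)
      fix i assume i: "i < n"
      have "(\<Sum>j<n. w i j * ?c j) = (\<Sum>j<n. \<Sum>l<n. w i j * b j l * r l)"
        by (intro sum.cong) (auto simp: sum_distrib_left mult.assoc)
      also have "\<dots> = (\<Sum>l<n. (\<Sum>j<n. w i j * b j l) * r l)"
        by (subst sum.swap) (simp add: sum_distrib_right)
      also have "\<dots> = (\<Sum>l<n. if l = i then r l else 0)"
        using i by (intro sum.cong) (auto simp: wb)
      also have "\<dots> = r i" using i by simp
      finally show "(\<Sum>j<n. w i j * ?c j) = r i" .
    qed auto
    fix c assume c: "c n = 1 \<and> (\<forall>j>n. c j = 0) \<and> (\<forall>i<n. (\<Sum>j<n. w i j * c j) = r i)"
    have "c j = (\<Sum>l<n. b j l * r l)" if j: "j < n" for j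
    proof -
      have "(\<Sum>l<n. b j l * r l) = (\<Sum>l<n. \<Sum>m<n. b j l * w l m * c m)"
        using c by (intro sum.cong) (auto simp: mult.assoc simp flip: sum_distrib_left)
      also have "\<dots> = (\<Sum>m<n. (\<Sum>l<n. b j l * w l m) * c m)"
        by (subst sum.swap) (simp add: sum_distrib_right)
      also have "\<dots> = (\<Sum>m<n. if m = j then c m else 0)"
        using j by (intro sum.cong) (auto simp: bw)
      also have "\<dots> = c j" using j by simp
      finally show ?thesis by simp
    qed
    then show "c = ?c" using c by (auto intro!: ext)
  qed
qed

section \<open>Norm bounds and perturbation of complex determinants\<close>

lemma norm_fdet_le:
  fixes a :: "nat \<Rightarrow> nat \<Rightarrow> complex"
  assumes "\<And>i j. i < n \<Longrightarrow> j < n \<Longrightarrow> norm (a i j) \<le> M"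
  shows "norm (fdet n a) \<le> fact n * M ^ n"
proof -
  have "norm (fdet n a) \<le> (\<Sum>p | p permutes {0..<n}. M ^ n)"
    unfolding fdet_expand
  proof (rule sum_norm_le)
    fix p assume "p \<in> {p. p permutes {0..<n}}"
    then have p: "p i < n" if "i < n" for i using that permutes_in_image[of p "{0..<n}" i] by simp
    have "norm (\<Prod>i = 0..<n. a i (p i)) \<le> (\<Prod>i = 0..<n. M)"
      unfolding prod_norm[symmetric] by (intro prod_mono) (use assms p in auto)
    then show "norm (of_int (sign p) * (\<Prod>i = 0..<n. a i (p i))) \<le> M ^ n"
      by (simp add: norm_mult sign_def)
  qed
  also have "\<dots> = fact n * M ^ n"
    by (simp add: card_permutations[of "{0..<n}" n])
  finally show ?thesis .
qed

text \<open>Telescoping: the factors are exchanged one at a time, each exchange costing at most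
  \<open>M ^ (n - 1) * e\<close>.\<close>

lemma norm_prod_diff_le:
  fixes a b :: "nat \<Rightarrow> complex"
  assumes "\<And>i. i < n \<Longrightarrow> norm (a i) \<le> M" "\<And>i. i < n \<Longrightarrow> norm (b i) \<le> M"
    and "\<And>i. i < n \<Longrightarrow> norm (a i - b i) \<le> e"
  shows "norm ((\<Prod>i = 0..<n. a i) - (\<Prod>i = 0..<n. b i)) \<le> real n * M ^ (n - 1) * e"
  using assms
proof (induction n)
  case (Suc n)
  have M: "0 \<le> M" using Suc.prems(1)[of n] norm_ge_zero[of "a n"] by linarith
  have e: "0 \<le> e" using Suc.prems(3)[of n] norm_ge_zero[of "a n - b n"] by linarith
  have B: "norm (\<Prod>i = 0..<n. b i) \<le> M ^ n"
    using prod_mono[of "{0..<n}" "\<lambda>i. norm (b i)" "\<lambda>_. M"] Suc.prems(2)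
    by (simp add: prod_norm)
  have "(\<Prod>i = 0..<Suc n. a i) - (\<Prod>i = 0..<Suc n. b i)
      = ((\<Prod>i = 0..<n. a i) - (\<Prod>i = 0..<n. b i)) * a n + (\<Prod>i = 0..<n. b i) * (a n - b n)"
    by (simp add: algebra_simps)
  also have "norm \<dots> \<le> (real n * M ^ (n - 1) * e) * M + M ^ n * e"
    by (intro norm_triangle_le add_mono) (auto simp: norm_mult intro!: mult_mono Suc.IH[simplified] Suc.prems B M e mult_nonneg_nonneg zero_le_power)
  also have "(real n * M ^ (n - 1) * e) * M + M ^ n * e = real (Suc n) * M ^ (Suc n - 1) * e"
    by (cases n) (auto simp: algebra_simps)
  finally show ?case .
qed simp

lemma norm_fdet_diff_le:
  fixes a b :: "nat \<Rightarrow> nat \<Rightarrow> complex"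
  assumes "\<And>i j. i < n \<Longrightarrow> j < n \<Longrightarrow> norm (a i j) \<le> M"
    and "\<And>i j. i < n \<Longrightarrow> j < n \<Longrightarrow> norm (b i j) \<le> M"
    and "\<And>i j. i < n \<Longrightarrow> j < n \<Longrightarrow> norm (a i j - b i j) \<le> e"
  shows "norm (fdet n a - fdet n b) \<le> fact n * (real n * M ^ (n - 1)) * e"
proof -
  have "norm (fdet n a - fdet n b)
      \<le> (\<Sum>p | p permutes {0..<n}. real n * M ^ (n - 1) * e)"
    unfolding fdet_expand sum_subtractf[symmetric]
  proof (rule sum_norm_le)
    fix p assume "p \<in> {p. p permutes {0..<n}}"
    then have p: "p i < n" if "i < n" for i using that permutes_in_image[of p "{0..<n}" i] by simp
    have "norm ((\<Prod>i = 0..<n. a i (p i)) - (\<Prod>i = 0..<n. b i (p i))) \<le> real n * M ^ (n - 1) * e"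
      by (rule norm_prod_diff_le) (use assms p in auto)
    then show "norm (of_int (sign p) * (\<Prod>i = 0..<n. a i (p i))
        - of_int (sign p) * (\<Prod>i = 0..<n. b i (p i))) \<le> real n * M ^ (n - 1) * e"
      by (simp add: norm_mult sign_def norm_minus_commute)
  qed
  also have "\<dots> = fact n * (real n * M ^ (n - 1)) * e"
    by (simp add: card_permutations[of "{0..<n}" n])
  finally show ?thesis .
qed

text \<open>The inverse consists of cofactors over the determinant, and a cofactor is up to sign a
  minor of order \<open>n - 1\<close>. The bound involves the matrix only through \<open>M\<close>
  and its determinant, so it is uniform in \<open>p\<close> whenever these are.\<close>

lemma bounded_right_inverse:
  fixes a :: "nat \<Rightarrow> nat \<Rightarrow> complex"
  assumes M: "\<And>i j. i < n \<Longrightarrow> j < n \<Longrightarrow> norm (a i j) \<le> M" and "fdet n a \<noteq> 0"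
  obtains b where "\<And>i j. i < n \<Longrightarrow> j < n \<Longrightarrow> norm (b i j) \<le> fact (n - 1) * M ^ (n - 1) / norm (fdet n a)"
    and "\<And>i j. i < n \<Longrightarrow> j < n \<Longrightarrow> (\<Sum>l<n. a i l * b l j) = (if i = j then 1 else 0)"
proof -
  let ?A = "Matrix.mat n n (\<lambda>(i, j). a i j)"
  define d where "d = fdet n a"
  define b where "b = (\<lambda>i j. adj_mat ?A $$ (i, j) / d)"
  have adj: "adj_mat ?A \<in> carrier_mat n n" "?A * adj_mat ?A = d \<cdot>\<^sub>m 1\<^sub>m n"
    using adj_mat[of ?A n] by (auto simp: d_def)
  have d: "d \<noteq> 0" using assms by (simp add: d_def)
  have "(\<Sum>l<n. a i l * b l j) = (if i = j then 1 else 0)" if "i < n" "j < n" for i j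
  proof -
    have "(\<Sum>l<n. a i l * adj_mat ?A $$ (l, j)) = (?A * adj_mat ?A) $$ (i, j)"
      using that adj(1) by (auto simp: scalar_prod_def lessThan_atLeast0 intro!: sum.cong)
    also have "\<dots> = (if i = j then d else 0)" using that by (simp add: adj(2))
    finally show ?thesis using d by (simp add: b_def flip: sum_divide_distrib)
  qed
  moreover have "norm (b i j) \<le> fact (n - 1) * M ^ (n - 1) / norm d" if ij: "i < n" "j < n" for i j
  proof -
    have "mat_delete ?A j i
        = Matrix.mat (n - 1) (n - 1) (\<lambda>(i', j'). a (insert_index j i') (insert_index i j'))"
      using ij by (auto simp: mat_delete_def insert_index_def intro!: eq_matI)
    then have "norm (adj_mat ?A $$ (i, j))
        = norm (fdet (n - 1) (\<lambda>i' j'. a (insert_index j i') (insert_index i j')))"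
      using ij by (simp add: adj_mat_def cofactor_def norm_mult norm_power)
    also have "\<dots> \<le> fact (n - 1) * M ^ (n - 1)"
      by (rule norm_fdet_le, rule M) (auto simp: insert_index_def)
    finally show ?thesis by (simp add: b_def norm_divide divide_right_mono)
  qed
  ultimately show ?thesis using that[of b] by (simp add: d_def)
qed

text \<open>Connection coefficients: the value at \<open>m\<close>, \<open>j\<close> is the
  coefficient of the Newton polynomial of degree \<open>m\<close> for the nodes \<open>x\<close> in
  that of degree \<open>j\<close> for the nodes \<open>y\<close>. The recursion comes from
  \<open>z - y j = (z - x m) + (x m - y j)\<close>.\<close>

fun newton_change :: "(nat \<Rightarrow> 'a::comm_ring_1) \<Rightarrow> (nat \<Rightarrow> 'a) \<Rightarrow> nat \<Rightarrow> nat \<Rightarrow> 'a" where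
  "newton_change x y m 0 = (if m = 0 then 1 else 0)"
| "newton_change x y m (Suc j) =
     (case m of 0 \<Rightarrow> 0 | Suc m' \<Rightarrow> newton_change x y m' j) + (x m - y j) * newton_change x y m j"

lemma newton_change_eq_0: "j < m \<Longrightarrow> newton_change x y m j = 0"
  by (induction j arbitrary: m) (auto split: nat.split)

lemma newton_change_diag: "newton_change x y j j = 1"
  by (induction j) (auto simp: newton_change_eq_0)

lemma newton_change_expansion:
  "(\<Prod>r<j. z - y r) = (\<Sum>m\<le>j. (\<Prod>r<m. z - x r) * newton_change x y m j)"
proof (induction j)
  case (Suc j)
  let ?c = "newton_change x y" and ?p = "\<lambda>m. \<Prod>r<m. z - x r"
  have "(\<Prod>r<Suc j. z - y r) = (\<Sum>m\<le>j. ?p m * ?c m j) * (z - y j)"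
    using Suc by simp
  also have "\<dots> = (\<Sum>m\<le>j. ?p (Suc m) * ?c m j) + (\<Sum>m\<le>j. ?p m * ((x m - y j) * ?c m j))"
    by (simp add: sum_distrib_right flip: sum.distrib) (simp add: algebra_simps)
  also have "(\<Sum>m\<le>j. ?p (Suc m) * ?c m j)
      = (\<Sum>m\<le>Suc j. ?p m * (case m of 0 \<Rightarrow> 0 | Suc m' \<Rightarrow> ?c m' j))"
    by (subst sum.atMost_Suc_shift) simp
  also have "(\<Sum>m\<le>j. ?p m * ((x m - y j) * ?c m j)) = (\<Sum>m\<le>Suc j. ?p m * ((x m - y j) * ?c m j))"
    by (simp add: newton_change_eq_0)
  finally show ?case by (simp add: distrib_left flip: sum.distrib)
qed simp

text \<open>Expanding the Newton basis of the nodes \<open>y\<close> in that of the nodes \<open>x\<close> factors the matrix into a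
  lower triangular one and a unitriangular one.\<close>

lemma fdet_newton:
  fixes x y :: "nat \<Rightarrow> 'a::comm_ring_1"
  shows "fdet n (\<lambda>i j. \<Prod>r<j. x i - y r) = (\<Prod>j<n. \<Prod>i<j. x j - x i)"
proof -
  let ?c = "newton_change x y"
  have "fdet n (\<lambda>i j. \<Prod>r<j. x i - y r) = fdet n (\<lambda>i j. \<Sum>m<n. (\<Prod>r<m. x i - x r) * ?c m j)"
  proof (rule fdet_cong)
    fix i j assume "i < n" "j < n"
    show "(\<Prod>r<j. x i - y r) = (\<Sum>m<n. (\<Prod>r<m. x i - x r) * ?c m j)"
      unfolding newton_change_expansion[of _ _ j x]
      by (rule sum.mono_neutral_left) (use \<open>j < n\<close> in \<open>auto simp: newton_change_eq_0\<close>)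
  qed
  also have "\<dots> = fdet n (\<lambda>i m. \<Prod>r<m. x i - x r) * fdet n ?c"
    by (rule fdet_mult)
  also have "fdet n ?c = 1"
    by (subst fdet_upper_triangular) (auto simp: newton_change_eq_0 newton_change_diag)
  also have "fdet n (\<lambda>i m. \<Prod>r<m. x i - x r) = (\<Prod>j<n. \<Prod>i<j. x j - x i)"
    by (rule fdet_lower_triangular) (auto intro!: prod_zero)
  finally show ?thesis by simp
qed

section \<open>Divided differences of Cauchy transforms\<close>

lemma node_poly_Suc_left:
  "m \<le> n \<Longrightarrow> node_poly x m n z = (z - x m) * node_poly x (Suc m) n z"
  by (simp add: node_poly_def prod.atLeast_Suc_atMost)

lemma node_poly_Suc_right:
  "m \<le> Suc n \<Longrightarrow> node_poly x m (Suc n) z = node_poly x m n z * (z - x (Suc n))"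
  by (simp add: node_poly_def)

lemma continuous_on_node_poly: "continuous_on S (node_poly x m n)"
  unfolding node_poly_def by (intro continuous_intros)

lemma node_poly_split:
  assumes "m \<le> Suc n" "n \<le> l"
  shows "node_poly x m l z = node_poly x m n z * node_poly x (Suc n) l z"
proof -
  have "{m..l} = {m..n} \<union> {Suc n..l}" using assms by auto
  then show ?thesis by (simp add: node_poly_def prod.union_disjoint)
qed

lemma node_poly_nonzero:
  "(\<And>i. i \<in> {m..n} \<Longrightarrow> x i \<noteq> z) \<Longrightarrow> node_poly x m n z \<noteq> 0"
  by (fastforce simp: node_poly_def)

text \<open>Functionals \<open>L\<close> concentrated on \<open>X\<close> for which \<open>w \<mapsto> L (1 / (\<cdot> - w))\<close> may be
  differentiated under \<open>L\<close>. Divided differences of such a Cauchy transform are \<open>L\<close> applied to the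
  reciprocal node polynomial, which covers simple poles and Cauchy integrals at once.\<close>

definition cauchy_functional :: "complex set \<Rightarrow> ((complex \<Rightarrow> complex) \<Rightarrow> complex) \<Rightarrow> bool" where
  "cauchy_functional X L \<longleftrightarrow>
     (\<forall>h1 h2 c. continuous_on X h1 \<longrightarrow> continuous_on X h2 \<longrightarrow>
        L (\<lambda>t. c * (h1 t - h2 t)) = c * (L h1 - L h2)) \<and>
     (\<forall>h1 h2. (\<forall>t\<in>X. h1 t = h2 t) \<longrightarrow> L h1 = L h2) \<and>
     (\<forall>w j. w \<notin> X \<longrightarrow> ((\<lambda>w. L (\<lambda>t. 1 / (t - w) ^ Suc j)) has_field_derivative
        of_nat (Suc j) * L (\<lambda>t. 1 / (t - w) ^ Suc (Suc j))) (at w))"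

lemma cauchy_functionalI:
  assumes "\<And>h1 h2 c. continuous_on X h1 \<Longrightarrow> continuous_on X h2 \<Longrightarrow>
        L (\<lambda>t. c * (h1 t - h2 t)) = c * (L h1 - L h2)"
    and "\<And>h1 h2. (\<And>t. t \<in> X \<Longrightarrow> h1 t = h2 t) \<Longrightarrow> L h1 = L h2"
    and "\<And>w j. w \<notin> X \<Longrightarrow> ((\<lambda>w. L (\<lambda>t. 1 / (t - w) ^ Suc j)) has_field_derivative
        of_nat (Suc j) * L (\<lambda>t. 1 / (t - w) ^ Suc (Suc j))) (at w)"
  shows "cauchy_functional X L"
  using assms unfolding cauchy_functional_def by blast

lemma cauchy_functional_linear:
  "cauchy_functional X L \<Longrightarrow> continuous_on X h1 \<Longrightarrow> continuous_on X h2 \<Longrightarrow>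
     L (\<lambda>t. c * (h1 t - h2 t)) = c * (L h1 - L h2)"
  by (simp add: cauchy_functional_def)

lemma cauchy_functional_cong:
  "cauchy_functional X L \<Longrightarrow> (\<And>t. t \<in> X \<Longrightarrow> h1 t = h2 t) \<Longrightarrow> L h1 = L h2"
  by (simp add: cauchy_functional_def)

lemma cauchy_functional_derivative:
  "cauchy_functional X L \<Longrightarrow> w \<notin> X \<Longrightarrow>
     ((\<lambda>w. L (\<lambda>t. 1 / (t - w) ^ Suc j)) has_field_derivative
        of_nat (Suc j) * L (\<lambda>t. 1 / (t - w) ^ Suc (Suc j))) (at w)"
  by (simp add: cauchy_functional_def)

lemma cauchy_functional_mono:
  "cauchy_functional X L \<Longrightarrow> X \<subseteq> Y \<Longrightarrow> cauchy_functional Y L"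
  unfolding cauchy_functional_def by (meson continuous_on_subset subsetD)

text \<open>The functional belonging to a simple pole: its Cauchy transform is
  \<open>1 / (a - w)\<close>.\<close>

lemma cauchy_functional_eval: "cauchy_functional {a} (\<lambda>h. h a)"
proof (rule cauchy_functionalI)
  fix w j assume "w \<notin> {a}"
  then have u: "a - w \<noteq> 0" by simp
  have "((\<lambda>w. a - w) has_field_derivative - 1) (at w)"
    by (auto intro!: derivative_eq_intros)
  from DERIV_power[OF this, of "Suc j"]
  have "((\<lambda>w. (a - w) ^ Suc j) has_field_derivative of_nat (Suc j) * (- 1 * (a - w) ^ j)) (at w)"
    by (simp only: diff_Suc_Suc diff_zero)
  from DERIV_divide[OF DERIV_const[of 1] this]
  have "((\<lambda>w. 1 / (a - w) ^ Suc j) has_field_derivative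
      (0 * (a - w) ^ Suc j - 1 * (of_nat (Suc j) * (- 1 * (a - w) ^ j)))
        / ((a - w) ^ Suc j * (a - w) ^ Suc j)) (at w)"
    using u by simp
  moreover have "(0 * u ^ Suc j - 1 * (of_nat (Suc j) * (- 1 * u ^ j))) / (u ^ Suc j * u ^ Suc j)
      = of_nat (Suc j) * (1 / u ^ Suc (Suc j))" if "u \<noteq> 0" for u :: complex
    using that by (simp add: divide_simps)
  ultimately show "((\<lambda>w. 1 / (a - w) ^ Suc j) has_field_derivative
      of_nat (Suc j) * (1 / (a - w) ^ Suc (Suc j))) (at w)"
    using u by metis
qed auto

lemma cauchy_functional_cmult:
  assumes L: "cauchy_functional X L"
  shows "cauchy_functional X (\<lambda>h. c * L h)"
proof (rule cauchy_functionalI)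
  fix h1 h2 :: "complex \<Rightarrow> complex" and a assume "continuous_on X h1" "continuous_on X h2"
  then show "c * L (\<lambda>t. a * (h1 t - h2 t)) = a * (c * L h1 - c * L h2)"
    by (simp only: cauchy_functional_linear[OF L]) (simp add: algebra_simps)
next
  fix h1 h2 :: "complex \<Rightarrow> complex" assume "\<And>t. t \<in> X \<Longrightarrow> h1 t = h2 t"
  then have "L h1 = L h2" by (rule cauchy_functional_cong[OF L])
  then show "c * L h1 = c * L h2" by simp
next
  fix w j assume "w \<notin> X"
  from DERIV_cmult[OF cauchy_functional_derivative[OF L this, of j], of c]
  show "((\<lambda>w. c * L (\<lambda>t. 1 / (t - w) ^ Suc j)) has_field_derivative
      of_nat (Suc j) * (c * L (\<lambda>t. 1 / (t - w) ^ Suc (Suc j)))) (at w)"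
    by (simp only: mult.left_commute)
qed

lemma cauchy_functional_add:
  assumes L: "cauchy_functional X L1" "cauchy_functional X L2"
  shows "cauchy_functional X (\<lambda>h. L1 h + L2 h)"
proof (rule cauchy_functionalI)
  fix h1 h2 :: "complex \<Rightarrow> complex" and a assume "continuous_on X h1" "continuous_on X h2"
  then show "L1 (\<lambda>t. a * (h1 t - h2 t)) + L2 (\<lambda>t. a * (h1 t - h2 t))
      = a * (L1 h1 + L2 h1 - (L1 h2 + L2 h2))"
    by (simp only: cauchy_functional_linear[OF L(1)] cauchy_functional_linear[OF L(2)])
      (simp add: algebra_simps)
next
  fix h1 h2 :: "complex \<Rightarrow> complex" assume "\<And>t. t \<in> X \<Longrightarrow> h1 t = h2 t"
  then show "L1 h1 + L2 h1 = L1 h2 + L2 h2"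
    using cauchy_functional_cong[OF L(1)] cauchy_functional_cong[OF L(2)] by metis
next
  fix w j assume "w \<notin> X"
  from DERIV_add[OF L[THEN cauchy_functional_derivative, OF this, of j]]
  show "((\<lambda>w. L1 (\<lambda>t. 1 / (t - w) ^ Suc j) + L2 (\<lambda>t. 1 / (t - w) ^ Suc j)) has_field_derivative
      of_nat (Suc j) * (L1 (\<lambda>t. 1 / (t - w) ^ Suc (Suc j)) + L2 (\<lambda>t. 1 / (t - w) ^ Suc (Suc j)))) (at w)"
    by (simp only: distrib_left)
qed

lemma cauchy_functional_zero: "cauchy_functional X (\<lambda>h. 0)"
  by (auto simp: cauchy_functional_def)

lemma cauchy_functional_sum:
  assumes "\<And>s. s \<in> S \<Longrightarrow> cauchy_functional X (L s)"
  shows "cauchy_functional X (\<lambda>h. \<Sum>s\<in>S. L s h)"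
  using assms
  by (induction S rule: infinite_finite_induct)
    (simp_all add: cauchy_functional_zero cauchy_functional_add)

text \<open>A Cauchy integral can be differentiated in \<open>w\<close> off the segment for any
  continuous density; holomorphy of \<open>f\<close> enters only later, through Cauchy's
  formula.\<close>

lemma cauchy_functional_linepath:
  assumes f: "continuous_on (closed_segment a b) f"
  shows "cauchy_functional (closed_segment a b)
           (\<lambda>h. contour_integral (linepath a b) (\<lambda>t. f t * h t))"
proof -
  let ?X = "closed_segment a b" and ?\<gamma> = "linepath a b"
  have int: "(\<lambda>t. f t * h t) contour_integrable_on ?\<gamma>" if "continuous_on ?X h" for h
    using f that by (intro contour_integrable_continuous_linepath continuous_intros)
  have "contour_integral ?\<gamma> (\<lambda>t. f t * (c * (h1 t - h2 t)))
      = c * (contour_integral ?\<gamma> (\<lambda>t. f t * h1 t) - contour_integral ?\<gamma> (\<lambda>t. f t * h2 t))"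
    if "continuous_on ?X h1" "continuous_on ?X h2" for h1 h2 c
  proof -
    have "(\<lambda>t. f t * (c * (h1 t - h2 t))) = (\<lambda>t. c * (f t * h1 t - f t * h2 t))"
      by (auto simp: algebra_simps)
    then show ?thesis
      using int that
      by (simp add: contour_integral_lmul contour_integral_diff contour_integrable_diff)
  qed
  moreover have "contour_integral ?\<gamma> (\<lambda>t. f t * h1 t) = contour_integral ?\<gamma> (\<lambda>t. f t * h2 t)"
    if "\<forall>t\<in>?X. h1 t = h2 t" for h1 h2
    using that by (intro contour_integral_eq) auto
  moreover have "((\<lambda>w. contour_integral ?\<gamma> (\<lambda>t. f t * (1 / (t - w) ^ Suc j))) has_field_derivative
        of_nat (Suc j) * contour_integral ?\<gamma> (\<lambda>t. f t * (1 / (t - w) ^ Suc (Suc j)))) (at w)"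
    if "w \<notin> ?X" for w j
  proof -
    have "((\<lambda>w. contour_integral ?\<gamma> (\<lambda>t. f t / (t - w) ^ Suc j)) has_field_derivative
        of_nat (Suc j) * contour_integral ?\<gamma> (\<lambda>t. f t / (t - w) ^ Suc (Suc j))) (at w)"
    \<comment> \<open>\<open>B\<close> bounds the speed of the path, whose derivative is constantly
      \<open>b - a\<close>.\<close>
    proof (rule Cauchy_next_derivative(2)[where S = UNIV and B = "norm (b - a)"])
      fix w assume "w \<in> UNIV - path_image ?\<gamma>"
      then show "((\<lambda>t. f t / (t - w) ^ Suc j) has_contour_integral
           contour_integral ?\<gamma> (\<lambda>t. f t / (t - w) ^ Suc j)) ?\<gamma>"
        by (intro has_contour_integral_integral contour_integrable_continuous_linepath
            continuous_intros f) auto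
    qed (use f that in auto)
    then show ?thesis by simp
  qed
  ultimately show ?thesis unfolding cauchy_functional_def by blast
qed

lemma higher_deriv_cauchy_functional:
  assumes "cauchy_functional X L" "open U" "U \<inter> X = {}"
    and "\<And>w. w \<in> U \<Longrightarrow> f w = L (\<lambda>t. 1 / (t - w))" and "w \<in> U"
  shows "(deriv ^^ j) f w = fact j * L (\<lambda>t. 1 / (t - w) ^ Suc j)"
  using \<open>w \<in> U\<close>
proof (induction j arbitrary: w)
  case (Suc j)
  have "\<forall>\<^sub>F v in nhds w. (deriv ^^ j) f v = fact j * L (\<lambda>t. 1 / (t - v) ^ Suc j)"
    using eventually_nhds_in_open[OF \<open>open U\<close> \<open>w \<in> U\<close>] by eventually_elim (rule Suc.IH)
  then have "deriv ((deriv ^^ j) f) w = deriv (\<lambda>v. fact j * L (\<lambda>t. 1 / (t - v) ^ Suc j)) w"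
    by (rule deriv_cong_ev) simp
  also have "\<dots> = fact j * (of_nat (Suc j) * L (\<lambda>t. 1 / (t - w) ^ Suc (Suc j)))"
    using cauchy_functional_derivative[OF assms(1), of w j] Suc.prems assms(3)
    by (intro DERIV_imp_deriv DERIV_cmult) auto
  finally show ?case by (simp add: algebra_simps)
qed (use assms(4) in simp)

text \<open>For \<open>a = t - x m\<close>, \<open>b = t - x (m + Suc d)\<close> and
  \<open>p\<close> the product over the nodes in between, this is the recursion for divided
  differences of a Cauchy kernel.\<close>

lemma dd_step_identity:
  fixes a b p :: complex
  assumes "a \<noteq> 0" "b \<noteq> 0" "p \<noteq> 0" "a \<noteq> b"
  shows "1 / (a * p * b) = 1 / (a - b) * (1 / (p * b) - 1 / (a * p))"
  using assms by (simp add: divide_simps)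

text \<open>Induction on the order. If the end nodes coincide, consecutiveness makes all nodes
  coincide and the derivative formula applies; otherwise linearity of \<open>L\<close> reduces the
  recursion to \<open>dd_step_identity\<close>. Linearity is available for functions continuous on
  \<open>X\<close>, so the nodes have to stay off \<open>X\<close>.\<close>

lemma divided_diff_cauchy_functional:
  assumes L: "cauchy_functional X L" and U: "open U" "U \<inter> X = {}"
    and f: "\<And>w. w \<in> U \<Longrightarrow> f w = L (\<lambda>t. 1 / (t - w))"
    and "\<And>i. i \<in> {m..m + d} \<Longrightarrow> x i \<in> U"
    and "\<And>i j l. m \<le> i \<Longrightarrow> i \<le> j \<Longrightarrow> j \<le> l \<Longrightarrow> l \<le> m + d \<Longrightarrow> x i = x l \<Longrightarrow> x j = x i"
  shows "divided_diff f x m d = L (\<lambda>t. 1 / node_poly x m (m + d) t)"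
  using assms(5,6)
proof (induction d arbitrary: m)
  case 0
  then show ?case by (simp add: f node_poly_def)
next
  case (Suc d)
  show ?case
  proof (cases "x m = x (m + Suc d)")
    case True
    have eq: "x j = x m" if "j \<in> {m..m + Suc d}" for j
      using Suc.prems(2)[of m j "m + Suc d"] that True by auto
    have "node_poly x m (m + Suc d) t = (t - x m) ^ Suc (Suc d)" for t
    proof -
      have "node_poly x m (m + Suc d) t = (\<Prod>r\<in>{m..m + Suc d}. t - x m)"
        unfolding node_poly_def by (rule prod.cong) (simp_all only: eq)
      then show ?thesis by simp
    qed
    moreover have "(deriv ^^ Suc d) f (x m) = fact (Suc d) * L (\<lambda>t. 1 / (t - x m) ^ Suc (Suc d))"
      by (rule higher_deriv_cauchy_functional[OF L U f]) (use Suc.prems(1)[of m] in auto)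
    ultimately have "(deriv ^^ Suc d) f (x m) = fact (Suc d) * L (\<lambda>t. 1 / node_poly x m (m + Suc d) t)"
      by (simp only:)
    then show ?thesis
      using True by (simp only: divided_diff.simps if_True nonzero_mult_div_cancel_left fact_nonzero
          not_False_eq_True refl)
  next
    case False
    let ?h1 = "\<lambda>t. 1 / node_poly x (Suc m) (Suc m + d) t" and ?h2 = "\<lambda>t. 1 / node_poly x m (m + d) t"
    have IH1: "divided_diff f x (Suc m) d = L ?h1"
    proof (rule Suc.IH)
      show "x i \<in> U" if "i \<in> {Suc m..Suc m + d}" for i
        using Suc.prems(1)[of i] that by simp
      show "x j = x i" if "Suc m \<le> i" "i \<le> j" "j \<le> l" "l \<le> Suc m + d" "x i = x l" for i j l
        by (rule Suc.prems(2)[of i j l]) (use that in \<open>linarith | assumption\<close>)+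
    qed
    have IH2: "divided_diff f x m d = L ?h2"
    proof (rule Suc.IH)
      show "x i \<in> U" if "i \<in> {m..m + d}" for i
        using Suc.prems(1)[of i] that by simp
      show "x j = x i" if "m \<le> i" "i \<le> j" "j \<le> l" "l \<le> m + d" "x i = x l" for i j l
        by (rule Suc.prems(2)[of i j l]) (use that in \<open>linarith | assumption\<close>)+
    qed
    have ne: "x i \<noteq> t" if "t \<in> X" "m \<le> i" "i \<le> m + Suc d" for t i
      using that Suc.prems(1)[of i] U(2) by auto
    have nz: "node_poly x i j t \<noteq> 0" if "t \<in> X" "m \<le> i" "j \<le> m + Suc d" for t i j
      by (rule node_poly_nonzero) (use ne that in auto)
    have cont: "continuous_on X (\<lambda>t. 1 / node_poly x i j t)" if "m \<le> i" "j \<le> m + Suc d" for i j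
      using nz that by (intro continuous_intros continuous_on_node_poly) auto
    have "L (\<lambda>t. 1 / node_poly x m (m + Suc d) t)
        = L (\<lambda>t. 1 / (x (m + Suc d) - x m) * (?h1 t - ?h2 t))"
    proof (rule cauchy_functional_cong[OF L])
      fix t assume t: "t \<in> X"
      define P where "P = node_poly x (Suc m) (m + d) t"
      have "P \<noteq> 0" unfolding P_def using t by (intro nz) auto
      have nz': "t - x m \<noteq> 0" "t - x (m + Suc d) \<noteq> 0" "t - x m \<noteq> t - x (m + Suc d)"
        using ne[OF t, of m] ne[OF t, of "m + Suc d"] False by auto
      have r: "node_poly x (Suc m) (Suc m + d) t = P * (t - x (m + Suc d))"
        unfolding P_def using node_poly_Suc_right[of "Suc m" "m + d" x t] by simp
      have "node_poly x m (m + Suc d) t = (t - x m) * P * (t - x (m + Suc d))"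
        using node_poly_Suc_left[of m "m + Suc d" x t] r by simp
      moreover have "node_poly x m (m + d) t = (t - x m) * P"
        unfolding P_def by (rule node_poly_Suc_left) simp
      moreover have "x (m + Suc d) - x m = (t - x m) - (t - x (m + Suc d))"
        by simp
      ultimately show "1 / node_poly x m (m + Suc d) t
          = 1 / (x (m + Suc d) - x m) * (?h1 t - ?h2 t)"
        using dd_step_identity[OF nz'(1,2) \<open>P \<noteq> 0\<close> nz'(3)] r by (simp only:)
    qed
    also have "\<dots> = 1 / (x (m + Suc d) - x m) * (L ?h1 - L ?h2)"
      by (intro cauchy_functional_linear[OF L] cont) auto
    also have "\<dots> = (divided_diff f x (Suc m) d - divided_diff f x m d) / (x (m + Suc d) - x m)"
      by (simp only: IH1 IH2 times_divide_eq_left mult_1_left)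
    also have "\<dots> = divided_diff f x m (Suc d)"
      using False by (simp only: divided_diff.simps if_False)
    finally show ?thesis by (rule sym)
  qed
qed

section \<open>Cauchy's formula on a square grid\<close>

text \<open>Both horizontal sides are oriented to the right and both vertical ones upwards, so that
  the common side of two adjacent squares gives literally the same integral, with opposite
  signs.\<close>

lemma contour_integral_rectpath:
  assumes "Re a \<le> Re b" "Im a \<le> Im b" "continuous_on (cbox a b - box a b) h"
  shows "contour_integral (rectpath a b) h =
    contour_integral (linepath a (Complex (Re b) (Im a))) h
    + contour_integral (linepath (Complex (Re b) (Im a)) b) h
    - contour_integral (linepath (Complex (Re a) (Im b)) b) h
    - contour_integral (linepath a (Complex (Re a) (Im b))) h"
proof -
  let ?a2 = "Complex (Re b) (Im a)" and ?a4 = "Complex (Re a) (Im b)"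
  have im: "path_image (rectpath a b)
      = closed_segment a ?a2 \<union> closed_segment ?a2 b \<union> closed_segment b ?a4 \<union> closed_segment ?a4 a"
    by (auto simp: rectpath_def Let_def path_image_join)
  have sub: "closed_segment a ?a2 \<subseteq> cbox a b - box a b" "closed_segment ?a2 b \<subseteq> cbox a b - box a b"
    "closed_segment b ?a4 \<subseteq> cbox a b - box a b" "closed_segment ?a4 a \<subseteq> cbox a b - box a b"
    using path_image_rectpath_cbox_minus_box[OF assms(1,2)] im by auto
  have int: "h contour_integrable_on linepath c d" if "closed_segment c d \<subseteq> cbox a b - box a b" for c d
    using continuous_on_subset[OF assms(3) that] by (rule contour_integrable_continuous_linepath)
  have rev: "contour_integral (linepath b ?a4) h = - contour_integral (linepath ?a4 b) h"
    "contour_integral (linepath ?a4 a) h = - contour_integral (linepath a ?a4) h"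
    using int[OF sub(3)] int[OF sub(4)]
    by (metis closed_segment_commute contour_integral_reverse_linepath continuous_on_subset assms(3) sub(3),
        metis closed_segment_commute contour_integral_reverse_linepath continuous_on_subset assms(3) sub(4))
  show ?thesis
    using int[OF sub(1)] int[OF sub(2)] int[OF sub(3)] int[OF sub(4)]
    by (simp add: rectpath_def Let_def contour_integrable_joinI rev)
qed

lemma cauchy_rectpath:
  assumes "f holomorphic_on cbox a b" "Re a < Re b" "Im a < Im b"
  shows "w \<in> box a b \<Longrightarrow> contour_integral (rectpath a b) (\<lambda>t. f t / (t - w)) = 2 * pi * \<i> * f w"
    and "w \<notin> cbox a b \<Longrightarrow> contour_integral (rectpath a b) (\<lambda>t. f t / (t - w)) = 0"
proof -
  have im: "path_image (rectpath a b) = cbox a b - box a b"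
    using assms by (intro path_image_rectpath_cbox_minus_box) auto
  show "contour_integral (rectpath a b) (\<lambda>t. f t / (t - w)) = 2 * pi * \<i> * f w" if w: "w \<in> box a b"
  proof -
    have "((\<lambda>t. f t / (t - w)) has_contour_integral
        2 * pi * \<i> * winding_number (rectpath a b) w * f w) (rectpath a b)"
      by (rule Cauchy_integral_formula_convex_simple[OF _ assms(1)])
        (use w im in \<open>simp_all add: interior_cbox\<close>, blast)
    then show ?thesis
      using winding_number_rectpath[OF w] by (simp add: contour_integral_unique)
  qed
  show "contour_integral (rectpath a b) (\<lambda>t. f t / (t - w)) = 0" if w: "w \<notin> cbox a b"
  proof (rule contour_integral_unique, rule Cauchy_theorem_convex_simple)
    show "(\<lambda>t. f t / (t - w)) holomorphic_on cbox a b"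
      using w by (intro holomorphic_on_divide assms(1) holomorphic_intros) auto
    show "path_image (rectpath a b) \<subseteq> cbox a b" unfolding im by blast
  qed simp_all
qed

text \<open>Cancellation of common sides. If \<open>h x\<close> belongs to the lower or left side of
  square \<open>x\<close> and \<open>g\<close> passes to the next square, a coefficient is nonzero
  only where exactly one of the two squares adjacent to the side is in \<open>S\<close>.\<close>

lemma sum_diff_shift:
  fixes h :: "'a \<Rightarrow> complex"
  assumes "finite S" "inj g"
  shows "(\<Sum>x\<in>S. h x) - (\<Sum>x\<in>S. h (g x))
    = (\<Sum>x\<in>S \<union> g ` S. (of_bool (x \<in> S) - of_bool (x \<in> g ` S)) * h x)"
proof -
  have "(\<Sum>x\<in>S. h x) = (\<Sum>x\<in>S \<union> g ` S. of_bool (x \<in> S) * h x)"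
    using assms by (intro sum.mono_neutral_cong_left) auto
  moreover have "(\<Sum>x\<in>S. h (g x)) = (\<Sum>x\<in>g ` S. h x)"
    using assms by (simp add: sum.reindex inj_on_subset[OF assms(2)])
  moreover have "\<dots> = (\<Sum>x\<in>S \<union> g ` S. of_bool (x \<in> g ` S) * h x)"
    using assms by (intro sum.mono_neutral_cong_left) auto
  ultimately show ?thesis by (simp add: left_diff_distrib sum_subtractf)
qed

section \<open>Geometry of the square grid\<close>

definition grid_point :: "real \<Rightarrow> int \<Rightarrow> int \<Rightarrow> complex" where
  "grid_point \<delta> i j = Complex (\<delta> * i) (\<delta> * j)"

definition grid_square :: "real \<Rightarrow> int \<Rightarrow> int \<Rightarrow> complex set" where
  "grid_square \<delta> i j = cbox (grid_point \<delta> i j) (grid_point \<delta> (i + 1) (j + 1))"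

lemma mem_grid_square:
  "z \<in> grid_square \<delta> i j \<longleftrightarrow>
     \<delta> * i \<le> Re z \<and> Re z \<le> \<delta> * (i + 1) \<and> \<delta> * j \<le> Im z \<and> Im z \<le> \<delta> * (j + 1)"
  by (auto simp: grid_square_def grid_point_def in_cbox_complex_iff)

text \<open>Each side lies in the two squares it separates. When only one of them meets
  \<open>K\<close>, the side inherits membership in \<open>U\<close> from that one and disjointness
  from \<open>K\<close> from the other.\<close>

lemma grid_edges_subset:
  assumes "\<delta> > 0"
  shows "closed_segment (grid_point \<delta> i j) (grid_point \<delta> (i + 1) j) \<subseteq> grid_square \<delta> i j"
    "closed_segment (grid_point \<delta> i j) (grid_point \<delta> (i + 1) j) \<subseteq> grid_square \<delta> i (j - 1)"
    "closed_segment (grid_point \<delta> i j) (grid_point \<delta> i (j + 1)) \<subseteq> grid_square \<delta> i j"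
    "closed_segment (grid_point \<delta> i j) (grid_point \<delta> i (j + 1)) \<subseteq> grid_square \<delta> (i - 1) j"
proof -
  have "convex (grid_square \<delta> i j)" for i j by (simp add: grid_square_def)
  moreover have "\<delta> * i \<le> \<delta> * (i + 1)" "\<delta> * (i - 1) \<le> \<delta> * i" for i :: real
    using assms by simp_all
  ultimately show
    "closed_segment (grid_point \<delta> i j) (grid_point \<delta> (i + 1) j) \<subseteq> grid_square \<delta> i j"
    "closed_segment (grid_point \<delta> i j) (grid_point \<delta> (i + 1) j) \<subseteq> grid_square \<delta> i (j - 1)"
    "closed_segment (grid_point \<delta> i j) (grid_point \<delta> i (j + 1)) \<subseteq> grid_square \<delta> i j"
    "closed_segment (grid_point \<delta> i j) (grid_point \<delta> i (j + 1)) \<subseteq> grid_square \<delta> (i - 1) j"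
    by (intro closed_segment_subset; simp add: mem_grid_square grid_point_def)+
qed

lemma finite_grid_squares:
  assumes "\<delta> > 0" "bounded K"
  shows "finite {(i, j). grid_square \<delta> i j \<inter> K \<noteq> {}}"
proof -
  obtain R where R: "\<And>z. z \<in> K \<Longrightarrow> cmod z \<le> R" using assms(2) by (auto simp: bounded_iff)
  \<comment> \<open>The added 1 covers squares that begin up to one step to the left of or below the
    point of \<open>K\<close>.\<close>
  define N where "N = \<lceil>R / \<delta>\<rceil> + 1"
  have "{(i, j). grid_square \<delta> i j \<inter> K \<noteq> {}} \<subseteq> {- N..N} \<times> {- N..N}"
  proof clarsimp
    fix i j assume "grid_square \<delta> i j \<inter> K \<noteq> {}"
    then obtain z where z: "z \<in> K" "z \<in> grid_square \<delta> i j" by auto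
    have *: "- N \<le> i \<and> i \<le> N" if "\<delta> * i \<le> x" "x \<le> \<delta> * (i + 1)" "\<bar>x\<bar> \<le> R" for x and i :: int
    proof -
      have "\<delta> * i \<le> R" "- R \<le> \<delta> * (i + 1)" using that by auto
      then have "real_of_int i \<le> R / \<delta>" "- (R / \<delta>) \<le> real_of_int i + 1"
        using assms(1) by (auto simp: field_simps)
      then show ?thesis unfolding N_def by linarith
    qed
    have "\<bar>Re z\<bar> \<le> R" "\<bar>Im z\<bar> \<le> R"
      using R[OF z(1)] abs_Re_le_cmod[of z] abs_Im_le_cmod[of z] by linarith+
    with z(2) show "- N \<le> i \<and> i \<le> N \<and> - N \<le> j \<and> j \<le> N"
      using *[of i "Re z"] *[of j "Im z"] by (auto simp: mem_grid_square)
  qed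
  then show ?thesis by (rule finite_subset) simp
qed

lemma grid_square_cover:
  assumes "\<delta> > 0"
  shows "\<exists>i j. w \<in> grid_square \<delta> i j"
proof (intro exI)
  have *: "\<delta> * \<lfloor>x / \<delta>\<rfloor> \<le> x" "x \<le> \<delta> * (\<lfloor>x / \<delta>\<rfloor> + 1)" for x
    using floor_divide_lower[OF assms, of x] floor_divide_upper[OF assms, of x]
    by (simp_all add: mult.commute)
  show "w \<in> grid_square \<delta> \<lfloor>Re w / \<delta>\<rfloor> \<lfloor>Im w / \<delta>\<rfloor>"
    using *[of "Re w"] *[of "Im w"] by (simp add: mem_grid_square)
qed

lemma grid_square_unique:
  assumes "\<delta> > 0" "w \<in> box (grid_point \<delta> i j) (grid_point \<delta> (i + 1) (j + 1))"
    and "w \<in> grid_square \<delta> i' j'"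
  shows "i' = i \<and> j' = j"
proof -
  have *: "m = n" if "\<delta> * m < x" "x < \<delta> * (m + 1)" "\<delta> * n \<le> x" "x \<le> \<delta> * (n + 1)"
    for m n :: int and x
  proof -
    have "\<delta> * m < \<delta> * (n + 1)" "\<delta> * n < \<delta> * (m + 1)" using that by linarith+
    then have "real_of_int m < n + 1" "real_of_int n < m + 1"
      using assms(1) by (simp_all only: mult_less_cancel_left_pos)
    then show ?thesis by linarith
  qed
  show ?thesis using assms(2,3) *[of i "Re w" i'] *[of j "Im w" j']
    by (auto simp: mem_grid_square in_box_complex_iff grid_point_def)
qed

lemma cauchy_functional_bound_linepath:
  assumes "continuous_on (closed_segment a b) f"
  shows "\<exists>C\<ge>0. \<forall>h B. continuous_on (closed_segment a b) h \<longrightarrow> 0 \<le> B \<longrightarrow>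
      (\<forall>t\<in>closed_segment a b. norm (h t) \<le> B) \<longrightarrow>
      norm (contour_integral (linepath a b) (\<lambda>t. f t * h t)) \<le> C * B"
proof -
  have "compact (f ` closed_segment a b)"
    by (intro compact_continuous_image assms compact_segment)
  then obtain A where A: "A > 0" "\<And>t. t \<in> closed_segment a b \<Longrightarrow> norm (f t) \<le> A"
    by (metis bounded_pos compact_imp_bounded imageI)
  show ?thesis
  proof (intro exI[of _ "A * norm (b - a)"] conjI allI impI)
    fix h :: "complex \<Rightarrow> complex" and B assume h: "continuous_on (closed_segment a b) h" "0 \<le> B" "\<forall>t\<in>closed_segment a b. norm (h t) \<le> B"
    have "norm (contour_integral (linepath a b) (\<lambda>t. f t * h t)) \<le> A * B * norm (b - a)"
      by (rule contour_integral_bound_linepath)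
        (use h A assms in \<open>auto simp: norm_mult intro!: contour_integrable_continuous_linepath
           continuous_intros mult_mono\<close>)
    then show "norm (contour_integral (linepath a b) (\<lambda>t. f t * h t)) \<le> A * norm (b - a) * B"
      by (simp add: mult_ac)
  qed (use A in auto)
qed

text \<open>The sum of Cauchy's formulas over the grid squares that meet \<open>K\<close>, after cancelling the common
  edges. It avoids winding numbers of level curves, which may be singular.\<close>

lemma grid_cauchy_formula:
  assumes "compact K" "open U" "K \<subseteq> U" and f: "f holomorphic_on U"
  obtains I :: "(int \<times> int + int \<times> int) set" and a b c where "finite I"
    and "\<And>e. e \<in> I \<Longrightarrow> closed_segment (a e) (b e) \<subseteq> U - K"
    and "\<And>w. w \<in> K \<Longrightarrow>
      f w = (\<Sum>e\<in>I. c e * contour_integral (linepath (a e) (b e)) (\<lambda>t. f t * (1 / (t - w))))"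
proof -
  obtain \<epsilon> where \<epsilon>: "\<epsilon> > 0" "(\<Union>x\<in>K. ball x \<epsilon>) \<subseteq> U"
    using compact_subset_open_imp_ball_epsilon_subset[OF assms(1-3)] by blast
  \<comment> \<open>Points of one square differ by at most \<open>\<delta>\<close> in each
    coordinate, so their distance is at most \<open>2 * \<delta> < \<epsilon>\<close>, and a square
    that meets \<open>K\<close> stays inside \<open>U\<close>.\<close>
  define \<delta> where "\<delta> = \<epsilon> / 3"
  have \<delta>: "\<delta> > 0" using \<epsilon> by (simp add: \<delta>_def)
  let ?p = "grid_point \<delta>"
  define S where "S = {(i, j). grid_square \<delta> i j \<inter> K \<noteq> {}}"
  have "finite S" unfolding S_def using \<delta> assms(1) by (intro finite_grid_squares compact_imp_bounded)
  have SU: "grid_square \<delta> i j \<subseteq> U" if ij: "(i, j) \<in> S" for i j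
  proof
    fix z assume z: "z \<in> grid_square \<delta> i j"
    obtain x where x: "x \<in> K" "x \<in> grid_square \<delta> i j" using ij by (auto simp: S_def)
    have "\<bar>Re (x - z)\<bar> \<le> \<delta>" "\<bar>Im (x - z)\<bar> \<le> \<delta>"
      using x(2) z by (auto simp: mem_grid_square algebra_simps)
    then have "dist x z < \<epsilon>" using cmod_le[of "x - z"] \<epsilon>(1) by (simp add: dist_norm \<delta>_def)
    then have "z \<in> ball x \<epsilon>" by simp
    then show "z \<in> U" using \<epsilon>(2) x(1) by blast
  qed
  have SK: "grid_square \<delta> i j \<inter> K = {}" if "(i, j) \<notin> S" for i j
    using that by (auto simp: S_def)
  define gH gV :: "int \<times> int \<Rightarrow> int \<times> int"
    where "gH = (\<lambda>(i, j). (i, j + 1))" and "gV = (\<lambda>(i, j). (i + 1, j))"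
  have inj: "inj gH" "inj gV" by (auto simp: gH_def gV_def inj_def)
  have mem: "(i, j) \<in> gH ` S \<longleftrightarrow> (i, j - 1) \<in> S" "(i, j) \<in> gV ` S \<longleftrightarrow> (i - 1, j) \<in> S" for i j
    by (force simp: gH_def gV_def image_iff)+
  define a where "a = (\<lambda>e. case e of Inl (i, j) \<Rightarrow> ?p i j | Inr (i, j) \<Rightarrow> ?p i j)"
  define b where "b = (\<lambda>e. case e of Inl (i, j) \<Rightarrow> ?p (i + 1) j | Inr (i, j) \<Rightarrow> ?p i (j + 1))"
  \<comment> \<open>\<open>Inl\<close> stands for the horizontal side starting at a grid point and
    \<open>Inr\<close> for the vertical one. In the positively oriented boundary the bottom side
    counts positively and the left side negatively, whence the minus sign for
    \<open>Inr\<close>.\<close>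
  define c :: "int \<times> int + int \<times> int \<Rightarrow> complex" where
    "c = (\<lambda>e. case e of Inl x \<Rightarrow> of_bool (x \<in> S) - of_bool (x \<in> gH ` S)
        | Inr x \<Rightarrow> - (of_bool (x \<in> S) - of_bool (x \<in> gV ` S)))"
  define J where "J = (S \<union> gH ` S) <+> (S \<union> gV ` S)"
  \<comment> \<open>What is left after cancellation: the sides between a square that meets
    \<open>K\<close> and one that does not.\<close>
  define I where "I = {e \<in> J. c e \<noteq> 0}"
  have "finite J" using \<open>finite S\<close> by (simp add: J_def)
  then have "finite I" by (simp add: I_def)
  have seg: "closed_segment (a e) (b e) \<subseteq> U - K" if e: "e \<in> I" for e
  proof (cases e)
    case (Inl x)
    obtain i j where x: "x = (i, j)" by force
    have "((i, j) \<in> S) \<noteq> ((i, j - 1) \<in> S)"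
      using e by (auto simp: I_def c_def Inl x mem)
    then show ?thesis
      using grid_edges_subset(1,2)[OF \<delta>, of i j] SU[of i j] SU[of i "j - 1"] SK[of i j] SK[of i "j - 1"]
      by (simp add: a_def b_def Inl x) blast
  next
    case (Inr x)
    obtain i j where x: "x = (i, j)" by force
    have "((i, j) \<in> S) \<noteq> ((i - 1, j) \<in> S)"
      using e by (auto simp: I_def c_def Inr x mem)
    then show ?thesis
      using grid_edges_subset(3,4)[OF \<delta>, of i j] SU[of i j] SU[of "i - 1" j] SK[of i j] SK[of "i - 1" j]
      by (simp add: a_def b_def Inr x) blast
  qed
  define G where "G = (\<lambda>h. \<Sum>e\<in>I. c e * contour_integral (linepath (a e) (b e)) (\<lambda>t. f t * h t))"
  let ?R = "\<lambda>i j. rectpath (?p i j) (?p (i + 1) (j + 1))"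
  \<comment> \<open>Holds for all interior points of a square of \<open>S\<close>, also for those
    outside \<open>K\<close>; this makes limits from inside the square available at points of
    \<open>K\<close> on grid lines.\<close>
  have box_formula: "G (\<lambda>t. 1 / (t - w)) = 2 * pi * \<i> * f w"
    if ij: "(i0, j0) \<in> S" and w: "w \<in> box (?p i0 j0) (?p (i0 + 1) (j0 + 1))" for i0 j0 w
  proof -
    let ?h = "\<lambda>t. f t * (1 / (t - w))"
    define H where "H = (\<lambda>(i, j). contour_integral (linepath (?p i j) (?p (i + 1) j)) ?h)"
    define V where "V = (\<lambda>(i, j). contour_integral (linepath (?p i j) (?p i (j + 1))) ?h)"
    have hol: "f holomorphic_on cbox (?p i j) (?p (i + 1) (j + 1))" if "(i, j) \<in> S" for i j
      using f SU[OF that] unfolding grid_square_def by (rule holomorphic_on_subset)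
    have wnot: "w \<notin> cbox (?p i j) (?p (i + 1) (j + 1)) - box (?p i j) (?p (i + 1) (j + 1))" for i j
      using grid_square_unique[OF \<delta> w, of i j] w by (auto simp: grid_square_def)
    have lt: "Re (?p i j) < Re (?p (i + 1) (j + 1))" "Im (?p i j) < Im (?p (i + 1) (j + 1))" for i j
      using \<delta> by (auto simp: grid_point_def)
    have rect: "contour_integral (?R i j) ?h = H (i, j) + V (gV (i, j)) - H (gH (i, j)) - V (i, j)"
      if "(i, j) \<in> S" for i j
    proof -
      have "continuous_on (cbox (?p i j) (?p (i + 1) (j + 1)) - box (?p i j) (?p (i + 1) (j + 1))) ?h"
        using wnot[of i j] holomorphic_on_imp_continuous_on[OF hol[OF that]]
        by (intro continuous_intros) (auto intro: continuous_on_subset)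
      from contour_integral_rectpath[OF _ _ this] lt[of i j] show ?thesis
        by (simp add: H_def V_def gH_def gV_def grid_point_def)
    qed
    have val: "contour_integral (?R i j) ?h = (if (i, j) = (i0, j0) then 2 * pi * \<i> * f w else 0)"
      if "(i, j) \<in> S" for i j
    proof -
      have heq: "?h = (\<lambda>t. f t / (t - w))" by simp
      show ?thesis
      proof (cases "(i, j) = (i0, j0)")
        case True
        then have "w \<in> box (?p i j) (?p (i + 1) (j + 1))" using w by blast
        from cauchy_rectpath(1)[OF hol[OF that] lt this] show ?thesis
          unfolding heq if_P[OF True] .
      next
        case False
        then have "w \<notin> cbox (?p i j) (?p (i + 1) (j + 1))"
          using grid_square_unique[OF \<delta> w, of i j] unfolding grid_square_def by blast
        from cauchy_rectpath(2)[OF hol[OF that] lt this] show ?thesis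
          unfolding heq if_not_P[OF False] .
      qed
    qed
    have "2 * pi * \<i> * f w = (\<Sum>x\<in>S. if x = (i0, j0) then 2 * pi * \<i> * f w else 0)"
      using ij \<open>finite S\<close> by simp
    also have "\<dots> = (\<Sum>x\<in>S. H x + V (gV x) - H (gH x) - V x)"
    proof (rule sum.cong)
      fix x assume "x \<in> S"
      then show "(if x = (i0, j0) then 2 * pi * \<i> * f w else 0) = H x + V (gV x) - H (gH x) - V x"
        using rect[of "fst x" "snd x"] val[of "fst x" "snd x"] by (simp only: prod.collapse)
    qed simp
    also have "\<dots> = ((\<Sum>x\<in>S. H x) - (\<Sum>x\<in>S. H (gH x))) - ((\<Sum>x\<in>S. V x) - (\<Sum>x\<in>S. V (gV x)))"
      by (simp add: sum.distrib sum_subtractf)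
    also have "\<dots> = (\<Sum>e\<in>J. c e * contour_integral (linepath (a e) (b e)) ?h)"
      unfolding sum_diff_shift[OF \<open>finite S\<close> inj(1)] sum_diff_shift[OF \<open>finite S\<close> inj(2)] J_def
      using \<open>finite S\<close>
      by (subst sum.Plus)
        (auto simp: c_def a_def b_def H_def V_def sum_negf[symmetric] case_prod_unfold
          simp del: minus_diff_eq intro!: sum.cong arg_cong2[where f = "(+)"])
    also have "\<dots> = G (\<lambda>t. 1 / (t - w))"
      unfolding G_def I_def using \<open>finite J\<close> by (intro sum.mono_neutral_right) auto
    finally show ?thesis by simp
  qed
  define X where "X = (\<Union>e\<in>I. closed_segment (a e) (b e))"
  have XU: "X \<subseteq> U - K" unfolding X_def using seg by blast
  have cf: "cauchy_functional X G"
    unfolding G_def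
  proof (intro cauchy_functional_sum cauchy_functional_cmult)
    fix e assume "e \<in> I"
    have "continuous_on (closed_segment (a e) (b e)) f"
      using holomorphic_on_imp_continuous_on[OF f] seg[OF \<open>e \<in> I\<close>] by (auto intro: continuous_on_subset)
    then show "cauchy_functional X (\<lambda>h. contour_integral (linepath (a e) (b e)) (\<lambda>t. f t * h t))"
      by (rule cauchy_functional_mono[OF cauchy_functional_linepath]) (use \<open>e \<in> I\<close> in \<open>auto simp: X_def\<close>)
  qed
  have formula: "G (\<lambda>t. 1 / (t - w)) = 2 * pi * \<i> * f w" if w: "w \<in> K" for w
  proof -
    obtain i j where ij: "w \<in> grid_square \<delta> i j" using grid_square_cover[OF \<delta>] by blast
    then have S: "(i, j) \<in> S" using w by (auto simp: S_def)
    let ?B = "box (?p i j) (?p (i + 1) (j + 1))"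
    show ?thesis
    proof (cases "w \<in> ?B")
      case True
      then show ?thesis by (rule box_formula[OF S])
    next
      case False
      \<comment> \<open>Now \<open>w\<close> lies on a grid line. Both sides of the claim are
        continuous at \<open>w\<close>, since \<open>w\<close> is not on the remaining segments, and
        \<open>w\<close> is a limit of points of the open square.\<close>
      have "box (?p i j) (?p (i + 1) (j + 1)) \<noteq> {}"
        using \<delta> by (auto simp: box_ne_empty Basis_complex_def grid_point_def)
      then have "w \<in> closure ?B" using ij by (simp add: closure_box grid_square_def)
      with False have "w islimpt ?B" by (simp add: closure_def)
      then have nt: "at w within ?B \<noteq> bot" by (simp add: trivial_limit_within)
      have "w \<notin> X" using XU w by auto
      from cauchy_functional_derivative[OF cf this, of 0]
      have "isCont (\<lambda>w. G (\<lambda>t. 1 / (t - w))) w" by (intro DERIV_isCont) simp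
      then have 1: "((\<lambda>w. G (\<lambda>t. 1 / (t - w))) \<longlongrightarrow> G (\<lambda>t. 1 / (t - w))) (at w within ?B)"
        by (auto simp: isCont_def intro: filterlim_mono at_le)
      have "isCont f w"
        using holomorphic_on_imp_continuous_on[OF f] w assms(2,3)
        by (auto simp: continuous_on_eq_continuous_at)
      then have 2: "((\<lambda>w. 2 * pi * \<i> * f w) \<longlongrightarrow> 2 * pi * \<i> * f w) (at w within ?B)"
        by (intro tendsto_intros) (auto simp: isCont_def intro: filterlim_mono at_le)
      have "((\<lambda>w. 2 * pi * \<i> * f w) \<longlongrightarrow> G (\<lambda>t. 1 / (t - w))) (at w within ?B)"
        by (rule Lim_transform_within[OF 1, of 1]) (auto simp: box_formula[OF S])
      from tendsto_unique[OF nt this 2] show ?thesis .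
    qed
  qed
  show ?thesis
  proof (rule that[of I a b "\<lambda>e. c e / (2 * pi * \<i>)"])
    fix w assume "w \<in> K"
    have "(\<Sum>e\<in>I. c e / (2 * pi * \<i>) * contour_integral (linepath (a e) (b e)) (\<lambda>t. f t * (1 / (t - w))))
        = G (\<lambda>t. 1 / (t - w)) / (2 * pi * \<i>)"
      by (simp add: G_def sum_divide_distrib)
    then show "f w = (\<Sum>e\<in>I. c e / (2 * pi * \<i>) * contour_integral (linepath (a e) (b e)) (\<lambda>t. f t * (1 / (t - w))))"
      using formula[OF \<open>w \<in> K\<close>] by simp
  qed (use \<open>finite I\<close> seg in auto)
qed

text \<open>Cauchy's formula packaged as a functional. The bound by \<open>C * B\<close> converts a
  lower bound for node polynomials on \<open>X\<close> into an estimate of the remainder.\<close>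

lemma cauchy_functional_representation:
  assumes "compact K" "open U" "K \<subseteq> U" and f: "f holomorphic_on U"
  obtains X L C where "compact X" "X \<subseteq> U - K" "cauchy_functional X L"
    and "\<forall>w\<in>K. f w = L (\<lambda>t. 1 / (t - w))"
    and "\<forall>h B. continuous_on X h \<longrightarrow> 0 \<le> B \<longrightarrow> (\<forall>t\<in>X. norm (h t) \<le> B) \<longrightarrow> norm (L h) \<le> C * B"
proof -
  obtain I :: "(int \<times> int + int \<times> int) set" and a b c where I: "finite I"
    and seg: "\<And>e. e \<in> I \<Longrightarrow> closed_segment (a e) (b e) \<subseteq> U - K"
    and fw: "\<And>w. w \<in> K \<Longrightarrow>
      f w = (\<Sum>e\<in>I. c e * contour_integral (linepath (a e) (b e)) (\<lambda>t. f t * (1 / (t - w))))"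
    using grid_cauchy_formula[OF assms] by blast
  define X where "X = (\<Union>e\<in>I. closed_segment (a e) (b e))"
  define L where "L = (\<lambda>h. \<Sum>e\<in>I. c e * contour_integral (linepath (a e) (b e)) (\<lambda>t. f t * h t))"
  have cont: "continuous_on (closed_segment (a e) (b e)) f" if "e \<in> I" for e
    using holomorphic_on_imp_continuous_on[OF f] seg[OF that] by (auto intro: continuous_on_subset)
  have sub: "closed_segment (a e) (b e) \<subseteq> X" if "e \<in> I" for e using that by (auto simp: X_def)
  have "\<forall>e\<in>I. \<exists>C\<ge>0. \<forall>h B. continuous_on (closed_segment (a e) (b e)) h \<longrightarrow> 0 \<le> B \<longrightarrow>
      (\<forall>t\<in>closed_segment (a e) (b e). norm (h t) \<le> B) \<longrightarrow>
      norm (contour_integral (linepath (a e) (b e)) (\<lambda>t. f t * h t)) \<le> C * B"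
    using cauchy_functional_bound_linepath cont by blast
  then obtain C where C: "\<And>e h B. e \<in> I \<Longrightarrow> continuous_on (closed_segment (a e) (b e)) h \<Longrightarrow> 0 \<le> B \<Longrightarrow>
      (\<forall>t\<in>closed_segment (a e) (b e). norm (h t) \<le> B) \<Longrightarrow>
      norm (contour_integral (linepath (a e) (b e)) (\<lambda>t. f t * h t)) \<le> C e * B"
    by metis
  show ?thesis
  proof (rule that[of X L "\<Sum>e\<in>I. norm (c e) * C e"])
    show "compact X" unfolding X_def using I by (intro compact_UN) auto
    show "X \<subseteq> U - K" unfolding X_def using seg by blast
    show "cauchy_functional X L" unfolding L_def
      by (intro cauchy_functional_sum cauchy_functional_cmult
          cauchy_functional_mono[OF cauchy_functional_linepath] cont sub)
    show "\<forall>w\<in>K. f w = L (\<lambda>t. 1 / (t - w))" using fw by (simp add: L_def)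
    show "\<forall>h B. continuous_on X h \<longrightarrow> 0 \<le> B \<longrightarrow> (\<forall>t\<in>X. norm (h t) \<le> B) \<longrightarrow>
        norm (L h) \<le> (\<Sum>e\<in>I. norm (c e) * C e) * B"
    proof (intro allI impI)
      fix h :: "complex \<Rightarrow> complex" and B assume h: "continuous_on X h" "0 \<le> B" "\<forall>t\<in>X. norm (h t) \<le> B"
      have "norm (L h) \<le> (\<Sum>e\<in>I. norm (c e) * (C e * B))"
        unfolding L_def
      proof (rule sum_norm_le)
        fix e assume e: "e \<in> I"
        have "norm (contour_integral (linepath (a e) (b e)) (\<lambda>t. f t * h t)) \<le> C e * B"
          using h sub[OF e] by (intro C e) (auto intro: continuous_on_subset)
        then show "norm (c e * contour_integral (linepath (a e) (b e)) (\<lambda>t. f t * h t))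
            \<le> norm (c e) * (C e * B)"
          by (simp add: norm_mult mult_left_mono)
      qed
      then show "norm (L h) \<le> (\<Sum>e\<in>I. norm (c e) * C e) * B"
        by (simp add: sum_distrib_right mult.assoc)
    qed
  qed
qed

section \<open>Sublevel sets of the Green's function and growth of the node polynomials\<close>

lemma green_function_continuous:
  assumes "green_function_infinity E g"
  shows "continuous_on (- E) g"
  using assms continuous_on_subset[OF _ closure_subset] by (auto simp: green_function_infinity_def)

text \<open>Inside \<open>E\<close> the values of \<open>g\<close> are arbitrary, hence the separate
  disjunct. Because \<open>g\<close> vanishes on the frontier and \<open>c > 0\<close>, the
  complement is the part of the closure of \<open>- E\<close> where \<open>g \<ge> c\<close>, and on
  that closure \<open>g\<close> is continuous.\<close>

lemma open_green_sublevel: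
  assumes "closed E" "green_function_infinity E g" "c > 0"
  shows "open {z. z \<in> E \<or> g z < c}"
proof -
  have g: "continuous_on (closure (- E)) g" and z: "\<And>z. z \<in> frontier E \<Longrightarrow> g z = 0"
    using assms(2) by (auto simp: green_function_infinity_def)
  have "g w = 0" if "w \<in> closure (- E)" "w \<in> E" for w
    using that assms(1) by (intro z) (simp add: frontier_closures)
  then have "- {z. z \<in> E \<or> g z < c} = {z \<in> closure (- E). c \<le> g z}"
    using assms(3) closure_subset[of "- E"] by fastforce
  moreover have "closed {z \<in> closure (- E). c \<le> g z}"
    by (intro continuous_on_closed_Collect_le g continuous_intros) simp
  ultimately show ?thesis by (simp add: open_closed)
qed

lemma bounded_green_sublevel:
  assumes "bounded E" "green_function_infinity E g"
  shows "bounded {z. z \<in> E \<or> g z \<le> c}"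
proof -
  obtain \<gamma> where "((\<lambda>z. g z - ln (cmod z)) \<longlongrightarrow> \<gamma>) at_infinity"
    using assms(2) by (auto simp: green_function_infinity_def)
  from order_tendstoD(1)[OF this, of "\<gamma> - 1"]
  obtain b where b: "\<And>z. b \<le> cmod z \<Longrightarrow> \<gamma> - 1 < g z - ln (cmod z)"
    by (auto simp: eventually_at_infinity)
  obtain R where R: "\<And>z. z \<in> E \<Longrightarrow> cmod z \<le> R" using assms(1) by (auto simp: bounded_iff)
  \<comment> \<open>Beyond \<open>b\<close> the Green's function exceeds
    \<open>ln (cmod z) + \<gamma> - 1\<close>, which is larger than \<open>c\<close> as soon as
    \<open>cmod z > exp (c - \<gamma> + 1)\<close>.\<close>
  have "cmod z \<le> max R (max b (exp (c - \<gamma> + 1)))" if "z \<in> E \<or> g z \<le> c" for z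
  proof (rule ccontr)
    assume "\<not> ?thesis"
    then have *: "R < cmod z" "b < cmod z" "exp (c - \<gamma> + 1) < cmod z" by auto
    then have "0 < cmod z" using exp_gt_zero[of "c - \<gamma> + 1"] by linarith
    then have "c - \<gamma> + 1 < ln (cmod z)" using * ln_less_cancel_iff[of "exp (c - \<gamma> + 1)" "cmod z"] by simp
    then have "c < g z" using b[of z] * by simp
    then show False using that R[of z] * by auto
  qed
  then show ?thesis by (auto simp: bounded_iff)
qed

lemma compact_green_sublevel:
  assumes "closed E" "bounded E" "green_function_infinity E g"
  shows "compact {z. z \<in> E \<or> g z \<le> c}"
proof -
  have "open (- E \<inter> g -` {c<..})"
    using green_function_continuous[OF assms(3)] assms(1)
    by (intro continuous_open_preimage) auto
  moreover have "- {z. z \<in> E \<or> g z \<le> c} = - E \<inter> g -` {c<..}" by auto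
  ultimately have "closed {z. z \<in> E \<or> g z \<le> c}" by (simp add: closed_def)
  then show ?thesis
    using bounded_green_sublevel[OF assms(2,3)] by (simp add: compact_eq_bounded_closed)
qed

lemma green_Phi_gt_1: "green_function_infinity E g \<Longrightarrow> z \<notin> E \<Longrightarrow> green_Phi g z > 1"
  by (simp add: green_function_infinity_def green_Phi_def)

text \<open>Off the locus, the set where \<open>g < ln \<rho>\<close> (together with
  \<open>E\<close>) and the set where \<open>g > ln \<rho>\<close> are disjoint and open, so the
  component of a point of the former never reaches the latter. It is therefore bounded, which is
  what lying inside the locus means.\<close>

lemma green_sublevel_subset_level_interior:
  assumes "closed E" "bounded E" "green_function_infinity E g" "\<rho> > 1"
  shows "{z. z \<in> E \<or> g z < ln \<rho>} \<subseteq> level_interior E g \<rho>"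
proof
  let ?U = "{z. z \<in> E \<or> g z < ln \<rho>}" and ?\<Gamma> = "level_locus E g \<rho>"
  let ?W = "- E \<inter> g -` {ln \<rho><..}"
  have \<Gamma>: "?\<Gamma> = {z \<in> - E. g z = ln \<rho>}"
  proof -
    have "exp y = \<rho> \<longleftrightarrow> y = ln \<rho>" for y using assms(4) by auto
    then show ?thesis by (simp add: level_locus_def green_Phi_def)
  qed
  have oU: "open ?U" using assms by (intro open_green_sublevel) auto
  have oW: "open ?W"
    using green_function_continuous[OF assms(3)] assms(1) by (intro continuous_open_preimage) auto
  fix z assume z: "z \<in> ?U"
  then have z\<Gamma>: "z \<notin> ?\<Gamma>" by (auto simp: \<Gamma>)
  define C where "C = connected_component_set (- ?\<Gamma>) z"
  have C: "connected C" "C \<subseteq> - ?\<Gamma>" "z \<in> C"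
    using z\<Gamma> by (auto simp: C_def connected_component_subset)
  have "C \<subseteq> ?U \<union> ?W" using C(2) by (auto simp: \<Gamma>)
  moreover have "?U \<inter> ?W = {}" by auto
  ultimately have "C \<inter> ?W = {}"
    using connectedD[OF C(1) oU oW] C(3) z by blast
  then have "C \<subseteq> {z. z \<in> E \<or> g z \<le> ln \<rho>}" using \<open>C \<subseteq> ?U \<union> ?W\<close> by auto
  then have "bounded C"
    using bounded_green_sublevel[OF assms(2,3)] bounded_subset by blast
  then show "z \<in> level_interior E g \<rho>"
    using z\<Gamma> by (simp add: level_interior_def inside_def C_def)
qed

lemma green_Phi_less_in_level_interior:
  assumes "z \<in> level_interior E g \<rho>" "z \<notin> E" "green_Phi g z \<le> \<rho>"
  shows "green_Phi g z < \<rho>"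
proof -
  have "z \<notin> level_locus E g \<rho>" using assms(1) by (simp add: level_interior_def inside_def)
  then show ?thesis using assms by (auto simp: level_locus_def)
qed

text \<open>The part of a large disc outside \<open>U\<close> is compact, hence covered by finitely
  many balls that the nodes eventually avoid; finitely many thresholds for \<open>p\<close> combine
  into one.\<close>

lemma no_limit_points_eventually_in:
  assumes "no_limit_points_outside E k \<xi>" "open U" "E \<subseteq> U"
  shows "\<forall>\<^sub>F p in sequentially. \<forall>i\<in>{1..p + k}. \<xi> p i \<in> U"
proof -
  obtain R where R: "\<forall>\<^sub>F p in sequentially. \<forall>i\<in>{1..p + k}. \<xi> p i \<in> cball 0 R"
    using assms(1) by (auto simp: no_limit_points_outside_def)
  have "\<forall>w\<in>- E. \<exists>\<epsilon>>0. \<forall>\<^sub>F p in sequentially. \<forall>i\<in>{1..p + k}. \<xi> p i \<notin> ball w \<epsilon>"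
    using assms(1) unfolding no_limit_points_outside_def by (rule conjunct1)
  then obtain \<epsilon> where \<epsilon>: "\<forall>w\<in>- E. \<epsilon> w > 0 \<and>
      (\<forall>\<^sub>F p in sequentially. \<forall>i\<in>{1..p + k}. \<xi> p i \<notin> ball w (\<epsilon> w))"
    by (rule bchoice[THEN exE])
  have "compact (cball 0 R - U)" using assms(2) by (intro compact_diff) auto
  moreover have "cball 0 R - U \<subseteq> (\<Union>w\<in>cball 0 R - U. ball w (\<epsilon> w))"
    using \<epsilon> assms(3) by (intro subsetI UN_I) auto
  ultimately obtain W where W: "W \<subseteq> cball 0 R - U" "finite W" "cball 0 R - U \<subseteq> (\<Union>w\<in>W. ball w (\<epsilon> w))"
    using compactE_image[of "cball 0 R - U" "cball 0 R - U" "\<lambda>w. ball w (\<epsilon> w)"] open_ball by metis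
  have "\<forall>\<^sub>F p in sequentially. \<forall>w\<in>W. \<forall>i\<in>{1..p + k}. \<xi> p i \<notin> ball w (\<epsilon> w)"
    using W(1,2) assms(3) \<epsilon> by (intro eventually_ball_finite ballI) blast+
  then show ?thesis using R
  proof eventually_elim
    case (elim p)
    show ?case
    proof (intro ballI, rule ccontr)
      fix i assume i: "i \<in> {1..p + k}" and "\<xi> p i \<notin> U"
      then have "\<xi> p i \<in> cball 0 R - U" using elim by blast
      then obtain w where "w \<in> W" "\<xi> p i \<in> ball w (\<epsilon> w)" using W(3) by blast
      then show False using elim(1) i by blast
    qed
  qed
qed

section \<open>Growth of the node polynomials outside \<open>E\<close>\<close>

definition node_asymptotics :: "complex set \<Rightarrow> (complex \<Rightarrow> real) \<Rightarrow> nat \<Rightarrow> (nat \<Rightarrow> nat \<Rightarrow> complex) \<Rightarrow> real \<Rightarrow> bool" where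
  "node_asymptotics E g k \<xi> \<kappa> \<longleftrightarrow>
     (\<forall>C. compact C \<longrightarrow> C \<subseteq> - E \<longrightarrow>
       uniform_limit C (\<lambda>p z. root p (cmod (Psi k \<xi> p z))) (\<lambda>z. \<kappa> * green_Phi g z) sequentially)"

lemma node_asymptotics_tendsto:
  assumes "node_asymptotics E g k \<xi> \<kappa>" "z \<notin> E"
  shows "(\<lambda>p. root p (cmod (Psi k \<xi> p z))) \<longlonglongrightarrow> \<kappa> * green_Phi g z"
proof -
  have "uniform_limit {z} (\<lambda>p z. root p (cmod (Psi k \<xi> p z))) (\<lambda>z. \<kappa> * green_Phi g z) sequentially"
    using assms(1)[unfolded node_asymptotics_def, rule_format, of "{z}"] assms(2)
    by (simp del: uniform_limit_singleton)
  from tendsto_uniform_limitI[OF this singletonI] show ?thesis .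
qed

text \<open>Far away from the bounded set of nodes the products have modulus at least 1.\<close>

lemma node_asymptotics_pos:
  assumes "node_asymptotics E g k \<xi> \<kappa>" "bounded E" "no_limit_points_outside E k \<xi>"
  shows "\<kappa> > 0"
proof -
  obtain R where R: "\<forall>\<^sub>F p in sequentially. \<forall>i\<in>{1..p + k}. \<xi> p i \<in> cball 0 R"
    using assms(3) by (auto simp: no_limit_points_outside_def)
  obtain R' where R': "\<And>z. z \<in> E \<Longrightarrow> cmod z \<le> R'" using assms(2) by (auto simp: bounded_iff)
  define z where "z = complex_of_real (\<bar>R\<bar> + \<bar>R'\<bar> + 1)"
  have cz: "cmod z = \<bar>R\<bar> + \<bar>R'\<bar> + 1" unfolding z_def norm_of_real by simp
  have "z \<notin> E" using R'[of z] cz by auto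
  then have lim: "(\<lambda>p. root p (cmod (Psi k \<xi> p z))) \<longlonglongrightarrow> \<kappa> * green_Phi g z"
    by (rule node_asymptotics_tendsto[OF assms(1)])
  have "\<forall>\<^sub>F p in sequentially. 1 \<le> root p (cmod (Psi k \<xi> p z))"
    using R eventually_gt_at_top[of 0]
  proof eventually_elim
    case (elim p)
    have "1 \<le> cmod (z - \<xi> p i)" if "i \<in> {1..p + k}" for i
    proof -
      have "cmod (\<xi> p i) \<le> R" using elim(1) that by auto
      then show ?thesis using norm_triangle_ineq2[of z "\<xi> p i"] cz by linarith
    qed
    then have "1 \<le> cmod (Psi k \<xi> p z)"
      unfolding Psi_def node_poly_def prod_norm[symmetric] by (intro prod_ge_1) auto
    then show ?case using elim by simp
  qed
  then have "1 \<le> \<kappa> * green_Phi g z" by (rule tendsto_lowerbound[OF lim]) simp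
  moreover have "green_Phi g z > 0" by (simp add: green_Phi_def)
  ultimately show ?thesis by (smt (verit) mult_nonpos_nonneg)
qed

text \<open>On the compact set \<open>C\<close> the continuous function \<Phi> attains a minimum
  above \<open>a\<close>. The gap between the two is a tolerance valid for all points at once,
  within which uniform convergence keeps the roots.\<close>

lemma Psi_ge_eventually:
  assumes "node_asymptotics E g k \<xi> \<kappa>" "\<kappa> > 0" "green_function_infinity E g"
    and C: "compact C" "C \<subseteq> - E" and a: "0 \<le> a" "\<And>z. z \<in> C \<Longrightarrow> a < green_Phi g z"
  shows "\<forall>\<^sub>F p in sequentially. \<forall>z\<in>C. (\<kappa> * a) ^ p \<le> cmod (Psi k \<xi> p z)"
proof (cases "C = {}")
  case False
  have "continuous_on C (green_Phi g)"
    unfolding green_Phi_def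
    using green_function_continuous[OF assms(3)] C(2) by (intro continuous_intros) (auto intro: continuous_on_subset)
  then obtain z0 where z0: "z0 \<in> C" "\<And>z. z \<in> C \<Longrightarrow> green_Phi g z0 \<le> green_Phi g z"
    using continuous_attains_inf[OF C(1) False] by blast
  have "uniform_limit C (\<lambda>p z. root p (cmod (Psi k \<xi> p z))) (\<lambda>z. \<kappa> * green_Phi g z) sequentially"
    using assms(1) C by (simp add: node_asymptotics_def)
  from uniform_limitD[OF this, of "\<kappa> * (green_Phi g z0 - a)"]
  have "\<forall>\<^sub>F p in sequentially. \<forall>z\<in>C.
      dist (root p (cmod (Psi k \<xi> p z))) (\<kappa> * green_Phi g z) < \<kappa> * (green_Phi g z0 - a)"
    using assms(2) a(2)[OF z0(1)] by simp
  then show ?thesis using eventually_gt_at_top[of 0]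
  proof eventually_elim
    case (elim p)
    show ?case
    proof
      fix z assume z: "z \<in> C"
      have "\<kappa> * green_Phi g z0 \<le> \<kappa> * green_Phi g z" using z0(2)[OF z] assms(2) by simp
      then have "\<kappa> * a \<le> root p (cmod (Psi k \<xi> p z))"
        using elim(1) z by (fastforce simp: dist_real_def right_diff_distrib abs_less_iff)
      then have "(\<kappa> * a) ^ p \<le> root p (cmod (Psi k \<xi> p z)) ^ p"
        using assms(2) a(1) by (intro power_mono) auto
      then show "(\<kappa> * a) ^ p \<le> cmod (Psi k \<xi> p z)" using elim(2) by simp
    qed
  qed
qed simp

lemma Psi_le_eventually:
  assumes "node_asymptotics E g k \<xi> \<kappa>" "\<kappa> > 0" "z \<notin> E" "green_Phi g z < b"
  shows "\<forall>\<^sub>F p in sequentially. cmod (Psi k \<xi> p z) \<le> (\<kappa> * b) ^ p"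
proof -
  have lim: "(\<lambda>p. root p (cmod (Psi k \<xi> p z))) \<longlonglongrightarrow> \<kappa> * green_Phi g z"
    by (rule node_asymptotics_tendsto[OF assms(1,3)])
  have "\<forall>\<^sub>F p in sequentially. root p (cmod (Psi k \<xi> p z)) < \<kappa> * b"
    by (rule order_tendstoD(2)[OF lim]) (use assms in simp)
  then show ?thesis using eventually_gt_at_top[of 0]
  proof eventually_elim
    case (elim p)
    then have "root p (cmod (Psi k \<xi> p z)) ^ p \<le> (\<kappa> * b) ^ p"
      by (intro power_mono) auto
    then show ?case using elim by simp
  qed
qed

section \<open>Factorization of the ITEA determinants\<close>

lemma node_poly_eq_prod_lessThan:
  "node_poly x 1 j z = (\<Prod>r<j. z - x (Suc r))"
  unfolding node_poly_def
  by (rule prod.reindex_bij_witness[where i = Suc and j = "\<lambda>r. r - 1"]) auto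

text \<open>Counted from the last node backwards, so that the products with fixed upper and varying
  lower index form one Newton basis.\<close>

lemma node_poly_eq_prod_rev:
  "node_poly x (Suc m) n z = (\<Prod>r<n - m. z - x (n - r))"
  unfolding node_poly_def
  by (rule prod.reindex_bij_witness[where i = "\<lambda>r. n - r" and j = "\<lambda>r. n - r"]) auto

lemma norm_node_poly_le:
  assumes "\<And>i. i \<in> {m..n} \<Longrightarrow> cmod (z - x i) \<le> B" "1 \<le> B" "n < m + l"
  shows "cmod (node_poly x m n z) \<le> B ^ l"
proof -
  have "cmod (node_poly x m n z) \<le> (\<Prod>r\<in>{m..n}. B)"
    unfolding node_poly_def prod_norm[symmetric] using assms(1) by (intro prod_mono) auto
  also have "\<dots> \<le> B ^ l"
    using assms(2,3) by (auto intro!: power_increasing)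
  finally show ?thesis .
qed

text \<open>The nodes \<open>y\<close> are arbitrary, which is why the main terms do not depend on
  the interpolation points.\<close>

lemma vandermonde_eq_fdet:
  "vandermonde n x = fdet (Suc n) (\<lambda>i j. \<Prod>r<j. x i - y r)"
  unfolding fdet_newton vandermonde_def lessThan_Suc_atMost ..

text \<open>The factors containing \<open>z\<close> give the limit polynomial \<open>S\<close>, the
  others a constant. If \<open>x 1\<close>, ..., \<open>x n\<close> are distinct, the determinant
  vanishes only when \<open>z\<close> is one of them.\<close>

lemma vandermonde_insert:
  "vandermonde n (x(0 := z))
     = (- 1) ^ n * (\<Prod>j<n. \<Prod>i<j. x (Suc j) - x (Suc i)) * (\<Prod>i=1..n. z - x i)"
proof (induction n)
  case 0
  then show ?case by (simp add: vandermonde_def)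
next
  case (Suc n)
  have "vandermonde (Suc n) (x(0 := z))
      = vandermonde n (x(0 := z)) * (\<Prod>i<Suc n. x (Suc n) - (x(0 := z)) i)"
    by (simp add: vandermonde_def)
  also have "(\<Prod>i<Suc n. x (Suc n) - (x(0 := z)) i)
      = (x (Suc n) - z) * (\<Prod>i<n. x (Suc n) - x (Suc i))"
    unfolding prod.lessThan_Suc_shift by simp
  finally show ?case unfolding Suc.IH by (simp add: algebra_simps)
qed

text \<open>Both determinants acquire the same left factor \<open>- A D\<close>, in the second one
  bordered by 1 so that the row \<open>v\<close> is left alone. The common factor cancels in their
  quotient.\<close>

lemma fdet_factor:
  fixes A :: "nat \<Rightarrow> nat \<Rightarrow> complex"
  assumes U: "\<And>i j. i < k \<Longrightarrow> j \<le> k \<Longrightarrow> U i j = - (\<Sum>s<k. A i s * d s * N s j)"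
  shows "fdet k U = (- 1) ^ k * fdet k A * (\<Prod>s<k. d s) * fdet k N"
    and "fdet (Suc k) (\<lambda>i j. case i of 0 \<Rightarrow> v j | Suc i' \<Rightarrow> U i' j)
      = (- 1) ^ k * fdet k A * (\<Prod>s<k. d s) * fdet (Suc k) (\<lambda>i j. case i of 0 \<Rightarrow> v j | Suc i' \<Rightarrow> N i' j)"
proof -
  let ?L = "\<lambda>i s. A i s * (- d s)"
  have L: "fdet k ?L = (- 1) ^ k * fdet k A * (\<Prod>s<k. d s)"
    unfolding fdet_scale_cols by (simp add: prod_uminus)
  have "fdet k U = fdet k (\<lambda>i j. \<Sum>s<k. ?L i s * N s j)"
    by (rule fdet_cong) (simp add: U sum_negf)
  also have "\<dots> = fdet k ?L * fdet k N" by (rule fdet_mult)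
  finally show "fdet k U = (- 1) ^ k * fdet k A * (\<Prod>s<k. d s) * fdet k N" by (simp only: L)
  let ?b = "\<lambda>i j. case i of 0 \<Rightarrow> (if j = 0 then 1 else 0)
       | Suc i' \<Rightarrow> (case j of 0 \<Rightarrow> 0 | Suc j' \<Rightarrow> ?L i' j')"
  let ?n = "\<lambda>i j. case i of 0 \<Rightarrow> v j | Suc i' \<Rightarrow> N i' j"
  have "fdet (Suc k) (\<lambda>i j. case i of 0 \<Rightarrow> v j | Suc i' \<Rightarrow> U i' j)
      = fdet (Suc k) (\<lambda>i j. \<Sum>l<Suc k. ?b i l * ?n l j)"
  proof (rule fdet_cong)
    fix i j assume "i < Suc k" "j < Suc k"
    then show "(case i of 0 \<Rightarrow> v j | Suc i' \<Rightarrow> U i' j) = (\<Sum>l<Suc k. ?b i l * ?n l j)"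
      unfolding sum.lessThan_Suc_shift by (cases i) (simp_all add: U sum_negf)
  qed
  also have "\<dots> = fdet (Suc k) ?b * fdet (Suc k) ?n" by (rule fdet_mult)
  also have "fdet (Suc k) ?b = fdet k ?L" by (rule fdet_border)
  finally show "fdet (Suc k) (\<lambda>i j. case i of 0 \<Rightarrow> v j | Suc i' \<Rightarrow> U i' j)
      = (- 1) ^ k * fdet k A * (\<Prod>s<k. d s) * fdet (Suc k) ?n"
    by (simp only: L)
qed

text \<open>\<open>Y\<close> equals \<open>A\<close> times its right inverse times \<open>Y\<close>,
  so it can enter through the same left factor as the main term. In the application
  \<open>inverse (d s)\<close> is \<open>\<Psi>\<^sub>p(z\<^sub>s)\<close>, and \<open>H * y\<close>
  is a bound for these times the size of the discarded terms.\<close>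

lemma factor_perturbation:
  fixes A :: "nat \<Rightarrow> nat \<Rightarrow> complex"
  assumes M: "\<And>i j. i < k \<Longrightarrow> j < k \<Longrightarrow> cmod (A i j) \<le> M" and "fdet k A \<noteq> 0"
    and U: "\<And>i j. i < k \<Longrightarrow> j \<le> k \<Longrightarrow> U i j = - (\<Sum>s<k. A i s * d s * P s j) - Y i j"
    and Y: "\<And>i j. i < k \<Longrightarrow> j \<le> k \<Longrightarrow> cmod (Y i j) \<le> y"
    and d: "\<And>s. s < k \<Longrightarrow> d s \<noteq> 0 \<and> cmod (inverse (d s)) \<le> H"
  obtains R where
    "\<And>s j. s < k \<Longrightarrow> j \<le> k \<Longrightarrow>
       cmod (R s j) \<le> real k * (fact (k - 1) * M ^ (k - 1) / cmod (fdet k A)) * (H * y)"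
    "\<And>i j. i < k \<Longrightarrow> j \<le> k \<Longrightarrow> U i j = - (\<Sum>s<k. A i s * d s * (P s j + R s j))"
proof -
  obtain b where b: "\<And>i j. i < k \<Longrightarrow> j < k \<Longrightarrow> cmod (b i j) \<le> fact (k - 1) * M ^ (k - 1) / cmod (fdet k A)"
    and inv: "\<And>i j. i < k \<Longrightarrow> j < k \<Longrightarrow> (\<Sum>l<k. A i l * b l j) = (if i = j then 1 else 0)"
    using bounded_right_inverse[of k A M] assms(1,2) by blast
  define c where "c = fact (k - 1) * M ^ (k - 1) / cmod (fdet k A)"
  define R where "R = (\<lambda>s j. inverse (d s) * (\<Sum>l<k. b s l * Y l j))"
  show ?thesis
  proof (rule that[of R, folded c_def])
    fix s j assume s: "s < k" and j: "j \<le> k"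
    have c: "0 \<le> c" using b[OF s s] norm_ge_zero[of "b s s"] unfolding c_def by linarith
    have y: "0 \<le> y" using Y[OF s j] norm_ge_zero[of "Y s j"] by linarith
    have "cmod (\<Sum>l<k. b s l * Y l j) \<le> (\<Sum>l<k. c * y)"
      using b[OF s] Y j c unfolding c_def[symmetric]
      by (intro sum_norm_le) (auto simp: norm_mult intro!: mult_mono)
    then have "cmod (R s j) \<le> H * (real k * (c * y))"
      unfolding R_def norm_mult using d[OF s] c y
      by (intro mult_mono) (auto intro: order_trans[OF norm_ge_zero])
    then show "cmod (R s j) \<le> real k * c * (H * y)" by (simp add: mult_ac)
  next
    fix i j assume i: "i < k" and j: "j \<le> k"
    have "(\<Sum>s<k. A i s * d s * R s j) = (\<Sum>s<k. \<Sum>l<k. A i s * b s l * Y l j)"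
    proof (rule sum.cong)
      fix s assume "s \<in> {..<k}"
      then have "A i s * d s * R s j = A i s * (\<Sum>l<k. b s l * Y l j)"
        using d[of s] by (simp add: R_def)
      then show "A i s * d s * R s j = (\<Sum>l<k. A i s * b s l * Y l j)"
        by (simp add: sum_distrib_left mult.assoc)
    qed simp
    also have "\<dots> = (\<Sum>l<k. (\<Sum>s<k. A i s * b s l) * Y l j)"
      by (subst sum.swap) (simp add: sum_distrib_right)
    also have "\<dots> = (\<Sum>l<k. if l = i then Y l j else 0)"
      using i by (intro sum.cong) (auto simp: inv)
    also have "\<dots> = Y i j" using i by simp
    finally show "U i j = - (\<Sum>s<k. A i s * d s * (P s j + R s j))"
      using U[OF i j] by (simp add: distrib_left sum.distrib)
  qed
qed

text \<open>Each column carries the inner product of \<open>q\<close> with its residue as a factor.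
  What remains becomes a Newton matrix at the poles after reversing rows and transposing, and its
  determinant forgets the nodes. So \<open>T\<close> is the same for every \<open>p\<close>, and
  nonzero when the poles are distinct and the inner products do not vanish.\<close>

lemma itea_T_eq:
  "itea_T ip q k \<xi> zs vs p (\<lambda>j. j) =
     of_int (sign (\<lambda>i. if i < k then k - 1 - i else i))
       * (\<Prod>j<k. \<Prod>i<j. zs (Suc j) - zs (Suc i)) * (\<Prod>j<k. ip q (vs (Suc j)))"
proof -
  have "itea_T ip q k \<xi> zs vs p (\<lambda>j. j)
      = fdet k (\<lambda>i j. node_poly (\<xi> p) (p + Suc i + 1) (p + k) (zs (Suc j)) * ip q (vs (Suc j)))"
    by (simp add: itea_T_def itea_alpha_def mult.commute)
  also have "\<dots> = fdet k (\<lambda>i j. node_poly (\<xi> p) (p + Suc i + 1) (p + k) (zs (Suc j)))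
      * (\<Prod>j<k. ip q (vs (Suc j)))"
    by (rule fdet_scale_cols)
  also have "fdet k (\<lambda>i j. node_poly (\<xi> p) (p + Suc i + 1) (p + k) (zs (Suc j)))
      = fdet k (\<lambda>i j. \<Prod>r<k - 1 - i. zs (Suc j) - \<xi> p (p + k - r))"
    by (rule fdet_cong) (simp add: node_poly_eq_prod_rev)
  also have "\<dots> = of_int (sign (\<lambda>i. if i < k then k - 1 - i else i))
      * fdet k (\<lambda>i j. \<Prod>r<i. zs (Suc j) - \<xi> p (p + k - r))"
    by (rule fdet_reverse_rows)
  also have "fdet k (\<lambda>i j. \<Prod>r<i. zs (Suc j) - \<xi> p (p + k - r))
      = fdet k (\<lambda>i j. \<Prod>r<j. zs (Suc i) - \<xi> p (p + k - r))"
    by (rule fdet_transpose)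
  also have "\<dots> = (\<Prod>j<k. \<Prod>i<j. zs (Suc j) - zs (Suc i))"
    by (rule fdet_newton)
  finally show ?thesis .
qed

lemma itea_Q_eq_fdet:
  "itea_Q ip q F k \<xi> p z = fdet (Suc k)
     (\<lambda>i j. case i of 0 \<Rightarrow> node_poly (\<xi> p) 1 j z | Suc i' \<Rightarrow> itea_u ip q F \<xi> p (Suc i') j)"
  unfolding itea_Q_def Suc_eq_plus1[symmetric]
  by (rule fdet_cong) (simp split: nat.split)

text \<open>With the normalization \<open>c k = 1\<close>, the linear system says that the rows of
  the \<open>u\<close> annihilate the coefficient vector, which is the situation of
  \<open>fdet_cramer\<close>; unique solvability gives access to the coefficients.\<close>

lemma itea_V_cramer:
  assumes "itea_det ip q F k \<xi> p \<noteq> 0"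
  shows "itea_Q ip q F k \<xi> p z = (- 1) ^ k * itea_det ip q F k \<xi> p * itea_V ip q F k \<xi> p z"
proof -
  let ?u = "\<lambda>i j. itea_u ip q F \<xi> p (Suc i) j"
  let ?P = "\<lambda>c. c k = 1 \<and> (\<forall>j>k. c j = 0) \<and>
      (\<forall>i\<in>{1..k}. (\<Sum>j<k. itea_u ip q F \<xi> p i j * c j) = - itea_u ip q F \<xi> p i k)"
  have det: "itea_det ip q F k \<xi> p = fdet k ?u"
    by (simp add: itea_det_def)
  have ball: "(\<forall>i\<in>{1..k}. Q i) \<longleftrightarrow> (\<forall>i<k. Q (Suc i))" for Q
    by (metis One_nat_def Suc_le_eq Suc_pred atLeastAtMost_iff less_eq_Suc_le zero_less_Suc)
  have "\<exists>!c. ?P c"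
    using fdet_unique_solution[of k ?u "\<lambda>i. - itea_u ip q F \<xi> p (Suc i) k"] assms
    unfolding ball det by simp
  then have "?P (itea_coeffs ip q F k \<xi> p)"
    unfolding itea_coeffs_def by (rule theI')
  then have c: "itea_coeffs ip q F k \<xi> p k = 1"
    "\<And>i. i < k \<Longrightarrow> (\<Sum>j\<le>k. ?u i j * itea_coeffs ip q F k \<xi> p j) = 0"
    unfolding ball by (simp_all add: lessThan_Suc_atMost[symmetric])
  show ?thesis
    unfolding itea_Q_eq_fdet det itea_V_def by (rule fdet_cramer) (use c in auto)
qed

section \<open>Error estimates for the determinants and the denominator polynomial\<close>

text \<open>The common frame of both cases. \<open>hat\<close> dominates \<Psi> at the poles that
  are kept. \<open>til\<close> bounds \<Psi> at the discarded poles from below and is at the same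
  time the scale of the remainder \<open>\<theta>\<close>, so that one ratio governs the whole
  error.\<close>

locale itea_asymptotics =
  fixes ip :: "complex ^ 'n \<Rightarrow> complex ^ 'n \<Rightarrow> complex" and q :: "complex ^ 'n"
    and F :: "complex \<Rightarrow> complex ^ 'n" and k \<mu> :: nat and \<xi> :: "nat \<Rightarrow> nat \<Rightarrow> complex"
    and zs :: "nat \<Rightarrow> complex" and vs :: "nat \<Rightarrow> complex ^ 'n"
    and \<theta> :: "nat \<Rightarrow> nat \<Rightarrow> nat \<Rightarrow> complex" and hat til :: "nat \<Rightarrow> real" and R M\<theta> :: real
  assumes k_le: "k \<le> \<mu>" and inj: "inj_on zs {1..\<mu>}"
    and ip_nz: "\<And>i. i \<in> {1..k} \<Longrightarrow> ip q (vs i) \<noteq> 0"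
    and nodes: "\<forall>\<^sub>F p in sequentially. \<forall>i\<in>{1..p + k}. cmod (\<xi> p i) \<le> R"
    and expansion: "\<forall>\<^sub>F p in sequentially. \<forall>i\<in>{1..k}. \<forall>j\<le>k. itea_u ip q F \<xi> p i j =
      - (\<Sum>s=1..\<mu>. itea_alpha ip q k \<xi> zs vs p i s * node_poly (\<xi> p) 1 j (zs s) / Psi k \<xi> p (zs s))
      + \<theta> p i j"
    and remainder: "\<forall>\<^sub>F p in sequentially. \<forall>i\<in>{1..k}. \<forall>j\<le>k. cmod (\<theta> p i j) \<le> M\<theta> / til p"
    and hat: "\<forall>\<^sub>F p in sequentially. \<forall>s\<in>{1..k}. Psi k \<xi> p (zs s) \<noteq> 0 \<and> cmod (Psi k \<xi> p (zs s)) \<le> hat p"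
    and til: "\<forall>\<^sub>F p in sequentially. 0 < til p \<and> (\<forall>s\<in>{k<..\<mu>}. til p \<le> cmod (Psi k \<xi> p (zs s)))"
    and hat_til: "(\<lambda>p. hat p / til p) \<longlonglongrightarrow> 0"
begin

abbreviation T :: complex where "T \<equiv> itea_T ip q k \<xi> zs vs 0 (\<lambda>j. j)"

abbreviation W :: complex where "W \<equiv> \<Prod>j<k. \<Prod>i<j. zs (Suc j) - zs (Suc i)"

lemma itea_T_const: "itea_T ip q k \<xi> zs vs p (\<lambda>j. j) = T"
  by (simp only: itea_T_eq)

lemma W_nonzero: "W \<noteq> 0"
proof -
  have "zs (Suc j) \<noteq> zs (Suc i)" if "j < k" "i < j" for i j
    using inj_onD[OF inj, of "Suc j" "Suc i"] that k_le by auto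
  then show ?thesis by simp
qed

lemma T_nonzero: "T \<noteq> 0"
  using W_nonzero ip_nz unfolding itea_T_eq by (auto simp: sign_def)

text \<open>Uniform in \<open>p\<close>: the products have at most \<open>k\<close> factors, and
  nodes and poles stay in a fixed disc.\<close>

lemma bounds:
  obtains B A where "1 \<le> B" "0 \<le> A"
    "\<forall>\<^sub>F p in sequentially. \<forall>s\<in>{1..\<mu>}. \<forall>j\<le>k. cmod (node_poly (\<xi> p) 1 j (zs s)) \<le> B"
    "\<forall>\<^sub>F p in sequentially. \<forall>s\<in>{1..\<mu>}. \<forall>i\<in>{1..k}. cmod (itea_alpha ip q k \<xi> zs vs p i s) \<le> A"
proof -
  define Z where "Z = (\<Sum>s=1..\<mu>. cmod (zs s))"
  have Z: "cmod (zs s) \<le> Z" if "s \<in> {1..\<mu>}" for s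
    unfolding Z_def using that by (intro member_le_sum) auto
  define w where "w = (\<Sum>s=1..\<mu>. cmod (ip q (vs s)))"
  have w: "cmod (ip q (vs s)) \<le> w" if "s \<in> {1..\<mu>}" for s
    unfolding w_def using that by (intro member_le_sum) auto
  have "0 \<le> Z" "0 \<le> w" by (auto simp: Z_def w_def intro: sum_nonneg)
  define B where "B = 1 + Z + \<bar>R\<bar>"
  have B: "1 \<le> B" using \<open>0 \<le> Z\<close> by (simp add: B_def)
  have B': "\<forall>\<^sub>F p in sequentially. \<forall>s\<in>{1..\<mu>}. \<forall>i\<in>{1..p + k}. cmod (zs s - \<xi> p i) \<le> B"
    using nodes
  proof eventually_elim
    case (elim p)
    show ?case
    proof (intro ballI)
      fix s i assume "s \<in> {1..\<mu>}" "i \<in> {1..p + k}"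
      then show "cmod (zs s - \<xi> p i) \<le> B"
        using norm_triangle_ineq4[of "zs s" "\<xi> p i"] Z[of s] elim unfolding B_def by fastforce
    qed
  qed
  show ?thesis
  proof (rule that[of "B ^ k" "w * B ^ k"])
    show "1 \<le> B ^ k" using B by simp
    show "0 \<le> w * B ^ k" using B \<open>0 \<le> w\<close> by simp
    show "\<forall>\<^sub>F p in sequentially. \<forall>s\<in>{1..\<mu>}. \<forall>j\<le>k. cmod (node_poly (\<xi> p) 1 j (zs s)) \<le> B ^ k"
      using B' by eventually_elim (auto intro!: norm_node_poly_le B)
    show "\<forall>\<^sub>F p in sequentially. \<forall>s\<in>{1..\<mu>}. \<forall>i\<in>{1..k}.
        cmod (itea_alpha ip q k \<xi> zs vs p i s) \<le> w * B ^ k"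
      using B'
      by eventually_elim
        (auto simp: itea_alpha_def norm_mult intro!: norm_node_poly_le B mult_mono w \<open>0 \<le> w\<close>)
  qed
qed

lemma perturbation:
  obtains c where "0 \<le> c" "\<forall>\<^sub>F p in sequentially. \<exists>E.
      (\<forall>s<k. \<forall>j\<le>k. cmod (E s j) \<le> c * (hat p / til p)) \<and>
      (\<forall>i<k. \<forall>j\<le>k. itea_u ip q F \<xi> p (Suc i) j =
        - (\<Sum>s<k. itea_alpha ip q k \<xi> zs vs p (Suc i) (Suc s) * inverse (Psi k \<xi> p (zs (Suc s)))
             * (node_poly (\<xi> p) 1 j (zs (Suc s)) + E s j)))"
proof -
  obtain B A where BA: "1 \<le> B" "0 \<le> A"
    and ev: "\<forall>\<^sub>F p in sequentially. \<forall>s\<in>{1..\<mu>}. \<forall>j\<le>k. cmod (node_poly (\<xi> p) 1 j (zs s)) \<le> B"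
    "\<forall>\<^sub>F p in sequentially. \<forall>s\<in>{1..\<mu>}. \<forall>i\<in>{1..k}. cmod (itea_alpha ip q k \<xi> zs vs p i s) \<le> A"
    by (rule bounds)
  \<comment> \<open>\<open>c0\<close> is the constant of \<open>factor_perturbation\<close> for the
    bounded matrix of determinant \<open>T\<close>. In \<open>c1\<close>, measured in units of
    \<open>1 / til p\<close>, each discarded pole contributes at most \<open>A * B\<close> and the
    remainder at most \<open>\<bar>M\<theta>\<bar>\<close>.\<close>
  define c0 where "c0 = real k * (fact (k - 1) * A ^ (k - 1) / cmod T)"
  define c1 where "c1 = real \<mu> * (A * B) + \<bar>M\<theta>\<bar>"
  have c0: "0 \<le> c0" using BA by (simp add: c0_def)
  have c1: "0 \<le> c1" using BA by (simp add: c1_def)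
  show ?thesis
  proof (rule that[of "c0 * c1"])
    show "0 \<le> c0 * c1" using c0 c1 by simp
    show "\<forall>\<^sub>F p in sequentially. \<exists>E.
      (\<forall>s<k. \<forall>j\<le>k. cmod (E s j) \<le> (c0 * c1) * (hat p / til p)) \<and>
      (\<forall>i<k. \<forall>j\<le>k. itea_u ip q F \<xi> p (Suc i) j =
        - (\<Sum>s<k. itea_alpha ip q k \<xi> zs vs p (Suc i) (Suc s) * inverse (Psi k \<xi> p (zs (Suc s)))
             * (node_poly (\<xi> p) 1 j (zs (Suc s)) + E s j)))"
      using ev expansion remainder hat til
    proof eventually_elim
      case (elim p)
      let ?a = "\<lambda>i s. itea_alpha ip q k \<xi> zs vs p (Suc i) (Suc s)"
      let ?d = "\<lambda>s. inverse (Psi k \<xi> p (zs (Suc s)))"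
      let ?P = "\<lambda>s j. node_poly (\<xi> p) 1 j (zs (Suc s))"
      define Y where "Y = (\<lambda>i j. (\<Sum>s\<in>{k<..\<mu>}. itea_alpha ip q k \<xi> zs vs p (Suc i) s
          * node_poly (\<xi> p) 1 j (zs s) / Psi k \<xi> p (zs s)) - \<theta> p (Suc i) j)"
      have til: "0 < til p" using elim by blast
      have fT: "fdet k ?a = T" using itea_T_const[of p] by (simp add: itea_T_def)
      have U: "itea_u ip q F \<xi> p (Suc i) j = - (\<Sum>s<k. ?a i s * ?d s * ?P s j) - Y i j"
        if "i < k" "j \<le> k" for i j
      proof -
        have split: "{1..\<mu>} = {1..k} \<union> {k<..\<mu>}" and disj: "{1..k} \<inter> {k<..\<mu>} = {}"
          using k_le by auto
        have "(\<Sum>s=1..\<mu>. itea_alpha ip q k \<xi> zs vs p (Suc i) s * node_poly (\<xi> p) 1 j (zs s) / Psi k \<xi> p (zs s))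
            = (\<Sum>s=1..k. itea_alpha ip q k \<xi> zs vs p (Suc i) s * node_poly (\<xi> p) 1 j (zs s) / Psi k \<xi> p (zs s))
            + (Y i j + \<theta> p (Suc i) j)"
          unfolding Y_def split sum.union_disjoint[OF finite_atLeastAtMost finite_greaterThanAtMost disj]
          by simp
        moreover have "(\<Sum>s=1..k. itea_alpha ip q k \<xi> zs vs p (Suc i) s * node_poly (\<xi> p) 1 j (zs s) / Psi k \<xi> p (zs s))
            = (\<Sum>s<k. ?a i s * ?d s * ?P s j)"
          by (rule sum.reindex_bij_witness[where i = Suc and j = "\<lambda>s. s - 1"])
            (auto simp: divide_inverse)
        ultimately show ?thesis using elim(3) that by simp
      qed
      have Y: "cmod (Y i j) \<le> c1 / til p" if "i < k" "j \<le> k" for i j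
      proof -
        have "cmod (\<Sum>s\<in>{k<..\<mu>}. itea_alpha ip q k \<xi> zs vs p (Suc i) s
            * node_poly (\<xi> p) 1 j (zs s) / Psi k \<xi> p (zs s)) \<le> (\<Sum>s\<in>{k<..\<mu>}. A * B / til p)"
        proof (rule sum_norm_le)
          fix s assume s: "s \<in> {k<..\<mu>}"
          then have "s \<in> {1..\<mu>}" by auto
          then have "cmod (itea_alpha ip q k \<xi> zs vs p (Suc i) s) \<le> A"
            "cmod (node_poly (\<xi> p) 1 j (zs s)) \<le> B" using elim(1,2) that by auto
          moreover have "til p \<le> cmod (Psi k \<xi> p (zs s))" using elim s by blast
          ultimately show "cmod (itea_alpha ip q k \<xi> zs vs p (Suc i) s
              * node_poly (\<xi> p) 1 j (zs s) / Psi k \<xi> p (zs s)) \<le> A * B / til p"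
            unfolding norm_mult norm_divide using BA til by (intro frac_le mult_mono) auto
        qed
        also have "\<dots> \<le> real \<mu> * (A * B) / til p"
          using BA til by (auto simp: divide_simps intro!: mult_right_mono)
        finally have "cmod (Y i j) \<le> real \<mu> * (A * B) / til p + M\<theta> / til p"
          unfolding Y_def using elim(4) that by (intro norm_triangle_le_diff add_mono) auto
        also have "\<dots> \<le> c1 / til p"
          using til by (simp add: c1_def divide_simps)
        finally show ?thesis .
      qed
      have A: "cmod (?a i s) \<le> A" if "i < k" "s < k" for i s
        using elim(2) that k_le by auto
      have d: "?d s \<noteq> 0 \<and> cmod (inverse (?d s)) \<le> hat p" if "s < k" for s
        using elim(5) that by auto
      have nz: "fdet k ?a \<noteq> 0" using fT T_nonzero by simp
      have "\<exists>E. (\<forall>s<k. \<forall>j\<le>k. cmod (E s j)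
            \<le> real k * (fact (k - 1) * A ^ (k - 1) / cmod (fdet k ?a)) * (hat p * (c1 / til p))) \<and>
          (\<forall>i<k. \<forall>j\<le>k. itea_u ip q F \<xi> p (Suc i) j = - (\<Sum>s<k. ?a i s * ?d s * (?P s j + E s j)))"
      proof (rule factor_perturbation[where k = k and A = ?a and U = "\<lambda>i j. itea_u ip q F \<xi> p (Suc i) j"
            and d = ?d and P = ?P and Y = Y and M = A and y = "c1 / til p" and H = "hat p"])
      qed (fact A nz U Y d | blast)+
      then obtain E where E: "\<forall>s<k. \<forall>j\<le>k. cmod (E s j)
            \<le> real k * (fact (k - 1) * A ^ (k - 1) / cmod (fdet k ?a)) * (hat p * (c1 / til p))"
          "\<forall>i<k. \<forall>j\<le>k. itea_u ip q F \<xi> p (Suc i) j = - (\<Sum>s<k. ?a i s * ?d s * (?P s j + E s j))"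
        by blast
      have "real k * (fact (k - 1) * A ^ (k - 1) / cmod (fdet k ?a)) * (hat p * (c1 / til p))
          = (c0 * c1) * (hat p / til p)"
        by (simp add: c0_def fT)
      with E show ?case by (intro exI[of _ E] conjI) simp_all
    qed
  qed
qed

lemma ev_small: "0 < e \<Longrightarrow> \<forall>\<^sub>F p in sequentially. hat p / til p < e"
  using order_tendstoD(2)[OF hat_til] by blast

lemma ev_hat_til_nonneg:
  assumes "1 \<le> k"
  shows "\<forall>\<^sub>F p in sequentially. 0 \<le> hat p / til p"
  using hat til
proof eventually_elim
  case (elim p)
  have "0 \<le> cmod (Psi k \<xi> p (zs 1))" by simp
  also have "\<dots> \<le> hat p" using elim assms by auto
  finally show ?case using elim by simp
qed

text \<open>\<open>D\<close> and \<open>D'\<close> are Newton determinants with perturbed rows. The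
  entries are bounded and the perturbation is at most a multiple of \<open>hat p / til p\<close>,
  hence so is the distance from the exact Vandermonde determinants. The exponentially varying factor
  stands apart and is the same in both.\<close>

lemma determinants:
  assumes "bounded C" "1 \<le> k"
  obtains c where "0 \<le> c" "\<forall>\<^sub>F p in sequentially. \<exists>D D'.
      cmod (D - W) \<le> c * (hat p / til p) \<and>
      itea_det ip q F k \<xi> p = (- 1) ^ k * T * inverse (\<Prod>i=1..k. Psi k \<xi> p (zs i)) * D \<and>
      (\<forall>z\<in>C. cmod (D' z - vandermonde k (zs(0 := z))) \<le> c * (hat p / til p) \<and>
        itea_Q ip q F k \<xi> p z = (- 1) ^ k * T * inverse (\<Prod>i=1..k. Psi k \<xi> p (zs i)) * D' z)"
proof -
  obtain B A where BA: "1 \<le> B" "0 \<le> A"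
    and evB: "\<forall>\<^sub>F p in sequentially. \<forall>s\<in>{1..\<mu>}. \<forall>j\<le>k. cmod (node_poly (\<xi> p) 1 j (zs s)) \<le> B"
    and "\<forall>\<^sub>F p in sequentially. \<forall>s\<in>{1..\<mu>}. \<forall>i\<in>{1..k}. cmod (itea_alpha ip q k \<xi> zs vs p i s) \<le> A"
    by (rule bounds)
  obtain e where e: "0 \<le> e" and evE: "\<forall>\<^sub>F p in sequentially. \<exists>E.
      (\<forall>s<k. \<forall>j\<le>k. cmod (E s j) \<le> e * (hat p / til p)) \<and>
      (\<forall>i<k. \<forall>j\<le>k. itea_u ip q F \<xi> p (Suc i) j =
        - (\<Sum>s<k. itea_alpha ip q k \<xi> zs vs p (Suc i) (Suc s) * inverse (Psi k \<xi> p (zs (Suc s)))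
             * (node_poly (\<xi> p) 1 j (zs (Suc s)) + E s j)))"
    by (rule perturbation)
  obtain Z where Z: "\<And>z. z \<in> C \<Longrightarrow> cmod z \<le> Z" using assms(1) by (auto simp: bounded_iff)
  \<comment> \<open>A common bound for all entries: \<open>B + e\<close> for the perturbed rows once
    \<open>hat p / til p < 1\<close>, and the power for the first row, the Newton polynomials at a
    point of \<open>C\<close>.\<close>
  define B' where "B' = max (B + e) ((1 + \<bar>Z\<bar> + \<bar>R\<bar>) ^ k)"
  have B': "B + e \<le> B'" "(1 + \<bar>Z\<bar> + \<bar>R\<bar>) ^ k \<le> B'" "B \<le> B'" "0 \<le> B'"
    using e BA by (auto simp: B'_def)
  define c where "c = (fact k * (real k * B' ^ (k - 1))) * e
      + (fact (Suc k) * (real (Suc k) * B' ^ (Suc k - 1))) * e"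
  have "\<forall>\<^sub>F p in sequentially. \<exists>D D'.
      cmod (D - W) \<le> c * (hat p / til p) \<and>
      itea_det ip q F k \<xi> p = (- 1) ^ k * T * inverse (\<Prod>i=1..k. Psi k \<xi> p (zs i)) * D \<and>
      (\<forall>z\<in>C. cmod (D' z - vandermonde k (zs(0 := z))) \<le> c * (hat p / til p) \<and>
        itea_Q ip q F k \<xi> p z = (- 1) ^ k * T * inverse (\<Prod>i=1..k. Psi k \<xi> p (zs i)) * D' z)"
    using evB evE nodes ev_small[of 1, simplified] ev_hat_til_nonneg[OF assms(2)]
  proof eventually_elim
    case (elim p)
    let ?a = "\<lambda>i s. itea_alpha ip q k \<xi> zs vs p (Suc i) (Suc s)"
    let ?d = "\<lambda>s. inverse (Psi k \<xi> p (zs (Suc s)))"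
    let ?P = "\<lambda>s j. node_poly (\<xi> p) 1 j (zs (Suc s))"
    let ?h = "hat p / til p"
    let ?u = "\<lambda>i j. itea_u ip q F \<xi> p (Suc i) j"
    obtain E where E: "\<And>s j. s < k \<Longrightarrow> j \<le> k \<Longrightarrow> cmod (E s j) \<le> e * ?h"
      and U: "\<And>i j. i < k \<Longrightarrow> j \<le> k \<Longrightarrow> ?u i j = - (\<Sum>s<k. ?a i s * ?d s * (?P s j + E s j))"
      using elim(2) by blast
    let ?N = "\<lambda>s j. ?P s j + E s j"
    have h: "0 \<le> ?h" "?h < 1" using elim by auto
    have eh: "e * ?h \<le> e" using mult_left_mono[of ?h 1 e] h e by simp
    have P: "cmod (?P s j) \<le> B" if "s < k" "j \<le> k" for s j
      using elim(1) that k_le by auto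
    have N: "cmod (?N s j) \<le> B'" if "s < k" "j \<le> k" for s j
      using norm_triangle_mono[OF P[OF that] E[OF that]] eh B'(1) by linarith
    define D where "D = fdet k ?N"
    define D' where "D' = (\<lambda>z. fdet (Suc k) (\<lambda>i j. case i of 0 \<Rightarrow> node_poly (\<xi> p) 1 j z | Suc i' \<Rightarrow> ?N i' j))"
    have fT: "fdet k ?a = T" using itea_T_const[of p] by (simp add: itea_T_def)
    have d: "(\<Prod>s<k. ?d s) = inverse (\<Prod>i=1..k. Psi k \<xi> p (zs i))"
    proof -
      have "(\<Prod>i=1..k. Psi k \<xi> p (zs i)) = (\<Prod>s<k. Psi k \<xi> p (zs (Suc s)))"
        by (rule prod.reindex_bij_witness[where i = Suc and j = "\<lambda>s. s - 1"]) auto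
      then show ?thesis
        using prod_inversef[of "\<lambda>s. Psi k \<xi> p (zs (Suc s))" "{..<k}"] by (simp add: o_def)
    qed
    have det: "itea_det ip q F k \<xi> p = (- 1) ^ k * T * inverse (\<Prod>i=1..k. Psi k \<xi> p (zs i)) * D"
      using fdet_factor(1)[of k ?u ?a ?d ?N, OF U] by (simp add: itea_det_def fT d D_def)
    have Q: "itea_Q ip q F k \<xi> p z = (- 1) ^ k * T * inverse (\<Prod>i=1..k. Psi k \<xi> p (zs i)) * D' z" for z
      unfolding itea_Q_eq_fdet
      using fdet_factor(2)[of k ?u ?a ?d ?N "\<lambda>j. node_poly (\<xi> p) 1 j z", OF U]
      by (simp only: fT d D'_def)
    have W: "W = fdet k ?P"
      unfolding node_poly_eq_prod_lessThan fdet_newton ..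
    have c: "(fact k * (real k * B' ^ (k - 1))) * (e * ?h) \<le> c * ?h"
      "(fact (Suc k) * (real (Suc k) * B' ^ (Suc k - 1))) * (e * ?h) \<le> c * ?h"
    proof -
      have aux: "x * (e * t) \<le> (x * e + y * e) * t" "y * (e * t) \<le> (x * e + y * e) * t"
        if "0 \<le> x" "0 \<le> y" "0 \<le> t" for x y t :: real
        using that e by (simp_all add: distrib_right)
      have "0 \<le> fact k * (real k * B' ^ (k - 1))" "0 \<le> fact (Suc k) * (real (Suc k) * B' ^ (Suc k - 1))"
        using B'(4) by (intro mult_nonneg_nonneg zero_le_power of_nat_0_le_iff fact_ge_zero; simp)+
      from aux[OF this h(1)] show
        "(fact k * (real k * B' ^ (k - 1))) * (e * ?h) \<le> c * ?h"
        "(fact (Suc k) * (real (Suc k) * B' ^ (Suc k - 1))) * (e * ?h) \<le> c * ?h"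
        unfolding c_def .
    qed
    have "cmod (D - W) \<le> (fact k * (real k * B' ^ (k - 1))) * (e * ?h)"
      unfolding D_def W
    proof (rule norm_fdet_diff_le)
      fix i j assume ij: "i < k" "j < k"
      show "cmod (?N i j) \<le> B'" using N[of i j] ij by simp
      show "cmod (?P i j) \<le> B'" using P[of i j] B'(3) ij by simp
      show "cmod (?N i j - ?P i j) \<le> e * ?h" using E[of i j] ij by simp
    qed
    then have DW: "cmod (D - W) \<le> c * ?h" using c(1) by linarith
    have D'W: "cmod (D' z - vandermonde k (zs(0 := z))) \<le> c * ?h" if z: "z \<in> C" for z
    proof -
      have V: "vandermonde k (zs(0 := z))
          = fdet (Suc k) (\<lambda>i j. case i of 0 \<Rightarrow> node_poly (\<xi> p) 1 j z | Suc i' \<Rightarrow> ?P i' j)"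
        unfolding vandermonde_eq_fdet[where y = "\<lambda>r. \<xi> p (Suc r)"] node_poly_eq_prod_lessThan
        by (rule fdet_cong) (simp split: nat.split)
      have z': "cmod (node_poly (\<xi> p) 1 j z) \<le> B'" if j: "j \<le> k" for j
      proof -
        have "cmod (node_poly (\<xi> p) 1 j z) \<le> (1 + \<bar>Z\<bar> + \<bar>R\<bar>) ^ k"
        proof (rule norm_node_poly_le)
          fix i assume "i \<in> {1..j}"
          then have "cmod (\<xi> p i) \<le> R" using elim(3) j by auto
          then show "cmod (z - \<xi> p i) \<le> 1 + \<bar>Z\<bar> + \<bar>R\<bar>"
            using norm_triangle_ineq4[of z "\<xi> p i"] Z[OF z] by linarith
        qed (use j in auto)
        then show ?thesis using B'(2) by linarith
      qed
      have "cmod (D' z - vandermonde k (zs(0 := z)))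
          \<le> (fact (Suc k) * (real (Suc k) * B' ^ (Suc k - 1))) * (e * ?h)"
        unfolding D'_def V
      proof (rule norm_fdet_diff_le)
        fix i j assume ij: "i < Suc k" "j < Suc k"
        show "cmod (case i of 0 \<Rightarrow> node_poly (\<xi> p) 1 j z | Suc i' \<Rightarrow> ?N i' j) \<le> B'"
          using N z' ij by (cases i) auto
        show "cmod (case i of 0 \<Rightarrow> node_poly (\<xi> p) 1 j z | Suc i' \<Rightarrow> ?P i' j) \<le> B'"
          using order_trans[OF P B'(3)] z' ij by (cases i) auto
        show "cmod ((case i of 0 \<Rightarrow> node_poly (\<xi> p) 1 j z | Suc i' \<Rightarrow> ?N i' j)
            - (case i of 0 \<Rightarrow> node_poly (\<xi> p) 1 j z | Suc i' \<Rightarrow> ?P i' j)) \<le> e * ?h"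
          using E ij mult_nonneg_nonneg[OF e h(1)] by (cases i) auto
      qed
      then show ?thesis using c(2) by linarith
    qed
    show ?case using det Q DW D'W by blast
  qed
  moreover have "0 \<le> c" using B'(4) e by (simp add: c_def)
  ultimately show ?thesis by (rule that[rotated])
qed

lemma itea_det_nonzero:
  assumes "1 \<le> k"
  shows "\<forall>\<^sub>F p in sequentially. itea_det ip q F k \<xi> p \<noteq> 0"
proof -
  obtain c where c: "0 \<le> c" "\<forall>\<^sub>F p in sequentially. \<exists>D D'.
      cmod (D - W) \<le> c * (hat p / til p) \<and>
      itea_det ip q F k \<xi> p = (- 1) ^ k * T * inverse (\<Prod>i=1..k. Psi k \<xi> p (zs i)) * D \<and>
      (\<forall>z\<in>{}. cmod (D' z - vandermonde k (zs(0 := z))) \<le> c * (hat p / til p) \<and>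
        itea_Q ip q F k \<xi> p z = (- 1) ^ k * T * inverse (\<Prod>i=1..k. Psi k \<xi> p (zs i)) * D' z)"
    using assms by (rule determinants[OF bounded_empty])
  \<comment> \<open>Below this threshold \<open>c * (hat p / til p) < cmod W\<close>, hence
    \<open>D \<noteq> 0\<close>; the added 1 guards against \<open>c = 0\<close>.\<close>
  have "0 < cmod W / (c + 1)" using W_nonzero c(1) by simp
  from c(2) ev_small[OF this] ev_hat_til_nonneg[OF assms] hat show ?thesis
  proof eventually_elim
    case (elim p)
    obtain D where D: "cmod (D - W) \<le> c * (hat p / til p)"
      "itea_det ip q F k \<xi> p = (- 1) ^ k * T * inverse (\<Prod>i=1..k. Psi k \<xi> p (zs i)) * D"
      using elim(1) by blast
    have "(hat p / til p) * (c + 1) < cmod W"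
      using elim(2) c(1) by (simp only: less_divide_eq)
    moreover have "(hat p / til p) * (c + 1) = c * (hat p / til p) + hat p / til p"
      by (metis distrib_right mult_1_left mult.commute)
    ultimately have "cmod (D - W) < cmod W" using D(1) elim(3) by linarith
    then have "D \<noteq> 0" by (auto simp: norm_minus_commute)
    then show ?case using D(2) T_nonzero elim(4) by auto
  qed
qed

lemma itea_Q_asymptotics:
  assumes "1 \<le> k" "compact C" "C \<subseteq> - zs ` {1..k}"
  shows "\<exists>\<epsilon>. uniform_bigo C \<epsilon> (\<lambda>p. hat p / til p) \<and>
    (\<forall>\<^sub>F p in sequentially. \<forall>z\<in>C. itea_Q ip q F k \<xi> p z =
       (- 1) ^ k * T * vandermonde k (zs(0 := z)) * inverse (\<Prod>i=1..k. Psi k \<xi> p (zs i)) * (1 + \<epsilon> p z))"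
proof -
  obtain c where c: "0 \<le> c" and ev: "\<forall>\<^sub>F p in sequentially. \<exists>D D'.
      cmod (D - W) \<le> c * (hat p / til p) \<and>
      itea_det ip q F k \<xi> p = (- 1) ^ k * T * inverse (\<Prod>i=1..k. Psi k \<xi> p (zs i)) * D \<and>
      (\<forall>z\<in>C. cmod (D' z - vandermonde k (zs(0 := z))) \<le> c * (hat p / til p) \<and>
        itea_Q ip q F k \<xi> p z = (- 1) ^ k * T * inverse (\<Prod>i=1..k. Psi k \<xi> p (zs i)) * D' z)"
    using assms(1) by (rule determinants[OF compact_imp_bounded[OF assms(2)]])
  let ?V = "\<lambda>z. vandermonde k (zs(0 := z))"
  have nz: "?V z \<noteq> 0" if "z \<in> C" for z
    using that assms(3) W_nonzero by (auto simp: vandermonde_insert)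
  \<comment> \<open>Dividing by the Vandermonde determinant makes the error relative. This needs a
    positive lower bound for its modulus, which compactness provides away from the poles.\<close>
  have "\<exists>m>0. \<forall>z\<in>C. m \<le> cmod (?V z)"
  proof (cases "C = {}")
    case False
    have "continuous_on C (\<lambda>z. cmod (?V z))"
      unfolding vandermonde_insert by (intro continuous_intros)
    from continuous_attains_inf[OF assms(2) False this]
    obtain z0 where "z0 \<in> C" "\<And>z. z \<in> C \<Longrightarrow> cmod (?V z0) \<le> cmod (?V z)" by blast
    then show ?thesis using nz[of z0] by (intro exI[of _ "cmod (?V z0)"]) auto
  qed (auto intro: exI[of _ 1])
  then obtain m where m: "m > 0" "\<And>z. z \<in> C \<Longrightarrow> m \<le> cmod (?V z)" by blast
  define L where "L = (\<lambda>p. (- 1) ^ k * T * inverse (\<Prod>i=1..k. Psi k \<xi> p (zs i)))"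
  define \<epsilon> where "\<epsilon> = (\<lambda>p z. itea_Q ip q F k \<xi> p z / (L p * ?V z) - 1)"
  have "\<forall>\<^sub>F p in sequentially. \<forall>z\<in>C. cmod (\<epsilon> p z) \<le> (c / m) * (hat p / til p) \<and>
      itea_Q ip q F k \<xi> p z = L p * ?V z * (1 + \<epsilon> p z)"
    using ev hat ev_hat_til_nonneg[OF assms(1)]
  proof eventually_elim
    case (elim p)
    have L: "L p \<noteq> 0" using elim(2) T_nonzero by (auto simp: L_def)
    obtain D' where D': "\<forall>z\<in>C. cmod (D' z - ?V z) \<le> c * (hat p / til p) \<and>
        itea_Q ip q F k \<xi> p z = L p * D' z"
      using elim(1) unfolding L_def by blast
    show ?case
    proof (intro ballI conjI)
      fix z assume z: "z \<in> C"
      have "\<epsilon> p z = (D' z - ?V z) / ?V z"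
        using L nz[OF z] D' z by (simp add: \<epsilon>_def diff_divide_distrib)
      then have "cmod (\<epsilon> p z) = cmod (D' z - ?V z) / cmod (?V z)" by (simp add: norm_divide)
      also have "\<dots> \<le> (c * (hat p / til p)) / m"
        by (rule frac_le) (use D' z m mult_nonneg_nonneg[OF c elim(3)] in blast)+
      finally show "cmod (\<epsilon> p z) \<le> (c / m) * (hat p / til p)" by (simp add: mult.commute)
      show "itea_Q ip q F k \<xi> p z = L p * ?V z * (1 + \<epsilon> p z)"
        using L nz[OF z] by (simp add: \<epsilon>_def)
    qed
  qed
  then show ?thesis
    unfolding uniform_bigo_def L_def
    by (intro exI[of _ \<epsilon>] conjI exI[of _ "c / m"]; elim eventually_mono)
      (auto simp: L_def mult_ac)
qed

text \<open>Nothing is divided by the Vandermonde determinant: \<open>D\<close> times the difference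
  of the two polynomials is a combination of the errors of \<open>D'\<close> and \<open>D\<close>,
  and only \<open>D\<close> has to stay away from 0. The estimate therefore holds on every compact
  set, also at the poles.\<close>

lemma itea_V_asymptotics:
  assumes "1 \<le> k" "compact C"
  shows "uniform_bigo C (\<lambda>p z. itea_V ip q F k \<xi> p z - (\<Prod>i=1..k. z - zs i)) (\<lambda>p. hat p / til p)"
proof -
  let ?S = "\<lambda>z. \<Prod>i=1..k. z - zs i"
  obtain c where c: "0 \<le> c" and ev: "\<forall>\<^sub>F p in sequentially. \<exists>D D'.
      cmod (D - W) \<le> c * (hat p / til p) \<and>
      itea_det ip q F k \<xi> p = (- 1) ^ k * T * inverse (\<Prod>i=1..k. Psi k \<xi> p (zs i)) * D \<and>
      (\<forall>z\<in>C. cmod (D' z - vandermonde k (zs(0 := z))) \<le> c * (hat p / til p) \<and>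
        itea_Q ip q F k \<xi> p z = (- 1) ^ k * T * inverse (\<Prod>i=1..k. Psi k \<xi> p (zs i)) * D' z)"
    using assms(1) by (rule determinants[OF compact_imp_bounded[OF assms(2)]])
  have "compact (?S ` C)" by (intro compact_continuous_image assms(2) continuous_intros)
  then have "bounded (?S ` C)" by (rule compact_imp_bounded)
  then obtain s where s: "s > 0" "\<forall>x\<in>?S ` C. cmod x \<le> s"
    unfolding bounded_pos by blast
  have sgn: "(- 1) ^ k * (- 1) ^ k = (1 :: complex)" by (simp flip: power_mult_distrib)
  define w where "w = cmod W"
  have w: "w > 0" using W_nonzero by (simp add: w_def)
  \<comment> \<open>With this smallness the error of \<open>D\<close> is below \<open>w / 2\<close>,
    so that \<open>cmod D\<close> stays above \<open>w / 2\<close>.\<close>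
  have small: "0 < w / (2 * (c + 1))" using w c by simp
  have "\<forall>\<^sub>F p in sequentially. \<forall>z\<in>C.
      cmod (itea_V ip q F k \<xi> p z - ?S z) \<le> (c + s * c) / (w / 2) * (hat p / til p)"
    using ev ev_small[OF small] ev_hat_til_nonneg[OF assms(1)] itea_det_nonzero[OF assms(1)] hat
  proof eventually_elim
    case (elim p)
    define h where "h = hat p / til p"
    define L where "L = (- 1) ^ k * T * inverse (\<Prod>i=1..k. Psi k \<xi> p (zs i))"
    have L: "L \<noteq> 0" using elim(5) T_nonzero by (auto simp: L_def)
    obtain D D' where D: "cmod (D - W) \<le> c * h" "itea_det ip q F k \<xi> p = L * D"
      and D': "\<forall>z\<in>C. cmod (D' z - vandermonde k (zs(0 := z))) \<le> c * h \<and>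
        itea_Q ip q F k \<xi> p z = L * D' z"
      using elim(1) unfolding L_def h_def by blast
    have h0: "0 \<le> h" using elim(3) by (simp add: h_def)
    have "2 * (c + 1) * h < w"
      using elim(2) c unfolding h_def[symmetric] by (simp add: less_divide_eq mult.commute)
    then have "c * h < w / 2" using h0 by (simp add: distrib_right distrib_left)
    then have Dw: "w / 2 \<le> cmod D"
      using D(1) norm_triangle_ineq3[of D W] unfolding w_def by linarith
    show ?case
    proof
      fix z assume z: "z \<in> C"
      have "(- 1) ^ k * D * itea_V ip q F k \<xi> p z = D' z"
        using itea_V_cramer[OF elim(4), of z] D(2) D' z L by simp
      from this[symmetric] have "(- 1) ^ k * D' z = ((- 1) ^ k * (- 1) ^ k) * (D * itea_V ip q F k \<xi> p z)"
        by (simp only: mult_ac)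
      then have "(- 1) ^ k * D' z = D * itea_V ip q F k \<xi> p z"
        by (simp only: sgn mult_1_left)
      moreover have "(- 1) ^ k * vandermonde k (zs(0 := z)) = ((- 1) ^ k * (- 1) ^ k) * (W * ?S z)"
        unfolding vandermonde_insert by (simp only: mult_ac)
      then have "(- 1) ^ k * vandermonde k (zs(0 := z)) = W * ?S z"
        by (simp only: sgn mult_1_left)
      ultimately have "D * (itea_V ip q F k \<xi> p z - ?S z)
          = (- 1) ^ k * (D' z - vandermonde k (zs(0 := z))) - (D - W) * ?S z"
        by (simp add: right_diff_distrib left_diff_distrib)
      also have "cmod \<dots> \<le> c * h + (c * h) * s"
        using D' z D(1) s(1) bspec[OF s(2) imageI[OF z]] mult_nonneg_nonneg[OF c h0]
        by (intro norm_triangle_le_diff add_mono)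
          (auto simp: norm_mult norm_power intro!: mult_mono)
      finally have "cmod D * cmod (itea_V ip q F k \<xi> p z - ?S z) \<le> (c + s * c) * h"
        unfolding norm_mult by (simp only: distrib_left mult.assoc mult.commute mult.left_commute)
      moreover have "(w / 2) * cmod (itea_V ip q F k \<xi> p z - ?S z)
          \<le> cmod D * cmod (itea_V ip q F k \<xi> p z - ?S z)"
        using Dw by (intro mult_right_mono) auto
      ultimately have "(w / 2) * cmod (itea_V ip q F k \<xi> p z - ?S z) \<le> (c + s * c) * h"
        by linarith
      then show "cmod (itea_V ip q F k \<xi> p z - ?S z) \<le> (c + s * c) / (w / 2) * (hat p / til p)"
        using w unfolding h_def[symmetric] by (simp add: field_simps)
    qed
  qed
  then show ?thesis unfolding uniform_bigo_def by blast
qed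

text \<open>The slack between \<open>\<tau>\<close> and \<open>\<tau>'\<close> absorbs the constant
  of the O-estimate, as \<open>(\<tau> / \<tau>') ^ p\<close> tends to 0.\<close>

lemma itea_V_limsup:
  assumes "1 \<le> k" "compact C" "0 \<le> \<tau>" "\<tau> < \<tau>'"
    and "\<forall>\<^sub>F p in sequentially. hat p / til p \<le> \<tau> ^ p"
  shows "limsup (\<lambda>p. SUP z\<in>C. ereal (root p (cmod (itea_V ip q F k \<xi> p z - (\<Prod>i=1..k. z - zs i)))))
    \<le> ereal \<tau>'"
proof -
  let ?f = "\<lambda>p z. cmod (itea_V ip q F k \<xi> p z - (\<Prod>i=1..k. z - zs i))"
  obtain M where "\<forall>\<^sub>F p in sequentially. \<forall>z\<in>C. ?f p z \<le> M * (hat p / til p)"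
    using itea_V_asymptotics[OF assms(1,2)] by (auto simp: uniform_bigo_def)
  have "(\<lambda>p. \<bar>M\<bar> * (\<tau> / \<tau>') ^ p) \<longlonglongrightarrow> \<bar>M\<bar> * 0"
    using assms(3,4) by (intro tendsto_mult tendsto_const LIMSEQ_power_zero) auto
  then have "\<forall>\<^sub>F p in sequentially. \<bar>M\<bar> * (\<tau> / \<tau>') ^ p < 1"
    by (rule order_tendstoD) simp
  have "\<forall>\<^sub>F p in sequentially.
      (SUP z\<in>C. ereal (root p (?f p z))) \<le> ereal \<tau>'"
    using \<open>\<forall>\<^sub>F p in sequentially. \<forall>z\<in>C. ?f p z \<le> M * (hat p / til p)\<close>
      \<open>\<forall>\<^sub>F p in sequentially. \<bar>M\<bar> * (\<tau> / \<tau>') ^ p < 1\<close> assms(5)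
      ev_hat_til_nonneg[OF assms(1)] eventually_gt_at_top[of 0]
  proof eventually_elim
    case (elim p)
    have "root p (?f p z) \<le> \<tau>'" if z: "z \<in> C" for z
    proof -
      have "?f p z \<le> M * (hat p / til p)" using elim(1) z by blast
      also have "\<dots> \<le> \<bar>M\<bar> * \<tau> ^ p" using elim(3,4) by (intro mult_mono) auto
      also have "\<dots> = (\<bar>M\<bar> * (\<tau> / \<tau>') ^ p) * \<tau>' ^ p"
        using assms(3,4) by (simp add: power_divide)
      also have "\<dots> \<le> 1 * \<tau>' ^ p"
        using elim(2) assms(3,4) by (intro mult_right_mono) auto
      finally have "?f p z \<le> \<tau>' ^ p" by simp
      then have "root p (?f p z) \<le> root p (\<tau>' ^ p)" using elim(5) by (intro real_root_le_mono) auto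
      also have "\<dots> = \<tau>'" using elim(5) assms(3,4) by (intro real_root_power_cancel) auto
      finally show ?thesis .
    qed
    then show ?case by (intro SUP_least) simp
  qed
  then show ?thesis by (rule Limsup_bounded)
qed

end

section \<open>Divided differences of meromorphic functions\<close>

text \<open>Linearity in the second argument reduces vector-valued divided differences to those of
  the coordinates.\<close>

lemma inner_product_expansion:
  fixes ip :: "complex ^ 'n \<Rightarrow> complex ^ 'n \<Rightarrow> complex"
  assumes "is_inner_product ip"
  shows "ip q x = (\<Sum>l\<in>UNIV. ip q (axis l 1) * x $ l)"
proof -
  have add: "ip q (y + z) = ip q y + ip q z" and scale: "ip q (c *s y) = c * ip q y" for y z c
    using assms unfolding is_inner_product_def by blast+
  have zero: "ip q 0 = 0" using add[of 0 0] by simp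
  have "ip q (\<Sum>l\<in>S. f l) = (\<Sum>l\<in>S. ip q (f l))" for f :: "'n \<Rightarrow> complex ^ 'n" and S
    by (induction S rule: infinite_finite_induct) (auto simp: zero add)
  then have "ip q (\<Sum>l\<in>UNIV. x $ l *s axis l 1) = (\<Sum>l\<in>UNIV. ip q (axis l 1) * x $ l)"
    by (simp add: scale mult.commute)
  then show ?thesis by (simp add: basis_expansion)
qed

text \<open>After multiplication by \<open>z - zs s\<close>, the expansion tends to
  \<open>v s\<close> at the pole, whereas the left-hand side tends to 0 because \<open>f\<close> is
  continuous there.\<close>

lemma simple_pole_not_analytic:
  fixes f \<theta> :: "complex \<Rightarrow> complex" and zs v :: "nat \<Rightarrow> complex"
  assumes "open U" "zs s \<in> U" "finite S" "s \<in> S" "inj_on zs S"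
    and f: "isCont f (zs s)" and \<theta>: "isCont \<theta> (zs s)"
    and eq: "\<And>z. z \<in> U - zs ` S \<Longrightarrow> f z = (\<Sum>j\<in>S. v j / (z - zs j)) + \<theta> z"
  shows "v s = 0"
proof -
  let ?a = "zs s"
  have ne: "zs j \<noteq> ?a" if "j \<in> S - {s}" for j
    using that assms(4,5) by (auto dest: inj_onD)
  let ?r = "\<lambda>z. (\<Sum>j\<in>S - {s}. v j / (z - zs j)) + \<theta> z"
  have "isCont ?r ?a"
  proof (intro continuous_add continuous_sum \<theta>)
    fix j assume "j \<in> S - {s}"
    from ne[OF this] show "isCont (\<lambda>z. v j / (z - zs j)) ?a"
      by (intro continuous_intros) auto
  qed
  then have "(\<lambda>z. v s + (z - ?a) * ?r z) \<midarrow>?a\<rightarrow> v s + (?a - ?a) * ?r ?a"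
    unfolding isCont_def
    by (rule tendsto_add[OF tendsto_const tendsto_mult[OF tendsto_diff[OF tendsto_ident_at tendsto_const]]])
  then have 1: "(\<lambda>z. v s + (z - ?a) * ?r z) \<midarrow>?a\<rightarrow> v s" by simp
  have "(\<lambda>z. (z - ?a) * f z) \<midarrow>?a\<rightarrow> (?a - ?a) * f ?a"
    using f unfolding isCont_def by (intro tendsto_intros)
  then have 2: "(\<lambda>z. (z - ?a) * f z) \<midarrow>?a\<rightarrow> 0" by simp
  let ?V = "U - zs ` (S - {s})"
  have "open ?V" using assms(1,3) by (intro open_Diff finite_imp_closed) auto
  moreover have "?a \<in> ?V" using assms(2) ne by fastforce
  moreover have "(z - ?a) * f z = v s + (z - ?a) * ?r z" if "z \<in> ?V" "z \<noteq> ?a" for z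
  proof -
    have "z \<in> U - zs ` S" using that by blast
    then have "f z = v s / (z - ?a) + ?r z"
      using assms(3,4) by (simp add: eq sum.remove)
    then show ?thesis using that by (simp add: distrib_left)
  qed
  ultimately have "(\<lambda>z. (z - ?a) * f z) \<midarrow>?a\<rightarrow> v s"
    using Lim_transform_within_open[OF 1, of ?V "\<lambda>z. (z - ?a) * f z"] by simp
  then show ?thesis using 2 LIM_unique by blast
qed

text \<open>At most \<open>2 * k\<close> factors separate the shorter product from
  \<open>\<Psi>\<^sub>p\<close>, each of modulus at most \<open>B\<close>. The lower growth rate of
  \<open>\<Psi>\<^sub>p\<close> thus passes to the shorter product at the cost of a
  constant.\<close>

lemma node_poly_lower_bound:
  assumes "1 \<le> B" "\<And>r. r \<in> {1..p + k} \<Longrightarrow> cmod (t - x r) \<le> B"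
    and "i \<in> {1..k}" "j \<le> k" "k \<le> p"
  shows "cmod (node_poly x 1 (p + k) t) \<le> B ^ k * B ^ k * cmod (node_poly x (Suc j) (p + i) t)"
proof -
  have "node_poly x 1 (p + k) t
      = node_poly x 1 j t * (node_poly x (Suc j) (p + i) t * node_poly x (Suc (p + i)) (p + k) t)"
    using assms(3-5) node_poly_split[of 1 j "p + k" x t] node_poly_split[of "Suc j" "p + i" "p + k" x t]
    by simp
  also have "cmod \<dots> = (cmod (node_poly x 1 j t) * cmod (node_poly x (Suc (p + i)) (p + k) t))
      * cmod (node_poly x (Suc j) (p + i) t)"
    by (simp only: norm_mult mult_ac)
  also have "\<dots> \<le> (B ^ k * B ^ k) * cmod (node_poly x (Suc j) (p + i) t)"
    using assms by (intro mult_right_mono mult_mono norm_node_poly_le) auto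
  finally show ?thesis .
qed

text \<open>The nodes missing at the end depend only on \<open>i\<close>, those missing at the
  beginning only on \<open>j\<close>. This separation of the indices is the origin of the product
  form \<open>A D P\<close>.\<close>

lemma reciprocal_node_poly:
  assumes "node_poly x 1 (p + k) z \<noteq> 0" "i \<in> {1..k}" "j \<le> k" "k \<le> p"
  shows "1 / node_poly x (Suc j) (p + i) z
    = node_poly x (p + i + 1) (p + k) z * node_poly x 1 j z / node_poly x 1 (p + k) z"
proof -
  have "node_poly x 1 (p + k) z
      = node_poly x 1 j z * (node_poly x (Suc j) (p + i) z * node_poly x (p + i + 1) (p + k) z)"
    using assms(2-4) node_poly_split[of 1 j "p + k" x z] node_poly_split[of "Suc j" "p + i" "p + k" x z]
    by simp
  then show ?thesis using assms(1) by (simp add: divide_simps)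
qed

lemma divided_diff_meromorphic:
  fixes E :: "complex set" and f \<theta> :: "complex \<Rightarrow> complex" and zs v :: "nat \<Rightarrow> complex"
  assumes E: "closed E" "bounded E" "green_function_infinity E g" "1 < \<sigma>" "\<sigma> < \<rho>"
    and cons: "\<And>p. p \<ge> 1 \<Longrightarrow> equal_points_consecutive (p + k) (\<xi> p)"
    and nlp: "no_limit_points_outside E k \<xi>"
    and asym: "node_asymptotics E g k \<xi> \<kappa>" "\<kappa> > 0"
    and poles: "\<And>s. s \<in> {1..\<mu>} \<Longrightarrow> zs s \<notin> E"
    and \<theta>: "\<theta> analytic_on level_interior E g \<rho>"
    and f: "\<And>z. z \<in> level_interior E g \<rho> - zs ` {1..\<mu>} \<Longrightarrow> f z = (\<Sum>s=1..\<mu>. v s / (z - zs s)) + \<theta> z"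
  obtains rem M where
    "\<forall>\<^sub>F p in sequentially. \<forall>i\<in>{1..k}. \<forall>j\<le>k.
       divided_diff f (\<xi> p) (Suc j) (p + i - Suc j)
         = - (\<Sum>s=1..\<mu>. v s * (1 / node_poly (\<xi> p) (Suc j) (p + i) (zs s))) + rem p i j"
    "\<forall>\<^sub>F p in sequentially. \<forall>i\<in>{1..k}. \<forall>j\<le>k. cmod (rem p i j) \<le> M / (\<kappa> * \<sigma>) ^ p"
proof -
  \<comment> \<open>The set \<open>X\<close> of the Cauchy representation lies between these two
    levels: inside \<open>?U\<close>, where \<open>\<theta>\<close> is holomorphic, and outside
    \<open>?K\<close>, so that \<Phi> exceeds \<sigma> on it.\<close>
  let ?U = "{z. z \<in> E \<or> g z < ln \<rho>}" and ?K = "{z. z \<in> E \<or> g z \<le> ln \<sigma>}"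
  have \<rho>: "\<rho> > 1" using E by simp
  have gpos: "g z > 0" if "z \<notin> E" for z
    using E(3) that by (auto simp: green_function_infinity_def)
  have ln: "0 < ln \<sigma>" "ln \<sigma> < ln \<rho>" "0 < ln \<rho>" using E by auto
  have Usub: "?U \<subseteq> level_interior E g \<rho>"
    by (rule green_sublevel_subset_level_interior[OF E(1-3) \<rho>])
  have \<theta>U: "\<theta> holomorphic_on ?U"
    using analytic_imp_holomorphic[OF \<theta>] Usub by (rule holomorphic_on_subset)
  have KU: "?K \<subseteq> ?U" using ln by auto
  obtain X L C where X: "compact X" "X \<subseteq> ?U - ?K" and L: "cauchy_functional X L"
    and Lw: "\<forall>w\<in>?K. \<theta> w = L (\<lambda>t. 1 / (t - w))"
    and LC: "\<forall>h B. continuous_on X h \<longrightarrow> 0 \<le> B \<longrightarrow> (\<forall>t\<in>X. norm (h t) \<le> B) \<longrightarrow> norm (L h) \<le> C * B"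
    by (rule cauchy_functional_representation[OF compact_green_sublevel[OF E(1-3)]
          open_green_sublevel[OF E(1,3) ln(3)] KU \<theta>U])
  have XE: "X \<subseteq> - E" using X(2) by auto
  \<comment> \<open>A positive level not above \<open>ln \<sigma>\<close> nor above \<open>g\<close>
    at any pole. Its sublevel set \<open>?O\<close> avoids the poles and \<open>X\<close> and
    eventually contains all nodes, so that \<open>f\<close> is a Cauchy transform near the
    nodes.\<close>
  define c where "c = Min (insert (ln \<sigma>) ((\<lambda>s. g (zs s)) ` {1..\<mu>}))"
  have c: "0 < c" "c \<le> ln \<sigma>" "\<And>s. s \<in> {1..\<mu>} \<Longrightarrow> c \<le> g (zs s)"
  proof -
    have fin: "finite (insert (ln \<sigma>) ((\<lambda>s. g (zs s)) ` {1..\<mu>}))" by simp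
    show "0 < c" unfolding c_def using Min_in[OF fin] ln(1) gpos poles by auto
    show "c \<le> ln \<sigma>" unfolding c_def by (rule Min_le[OF fin]) simp
    show "c \<le> g (zs s)" if "s \<in> {1..\<mu>}" for s
      unfolding c_def by (rule Min_le[OF fin]) (use that in simp)
  qed
  let ?O = "{z. z \<in> E \<or> g z < c}"
  have O: "open ?O" by (rule open_green_sublevel[OF E(1,3) c(1)])
  have OK: "?O \<subseteq> ?K" using c(2) by auto
  have Opoles: "?O \<inter> zs ` {1..\<mu>} = {}" using c(3) poles by fastforce
  let ?Y = "X \<union> zs ` {1..\<mu>}"
  \<comment> \<open>The kernel is \<open>1 / (t - w)\<close>, whereas a pole enters as
    \<open>1 / (w - zs s)\<close>; hence the minus sign.\<close>
  let ?L = "\<lambda>h. L h + (\<Sum>s=1..\<mu>. - v s * h (zs s))"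
  have L': "cauchy_functional ?Y ?L"
    by (intro cauchy_functional_add cauchy_functional_sum cauchy_functional_cmult
        cauchy_functional_mono[OF L] cauchy_functional_mono[OF cauchy_functional_eval]) auto
  have OY: "?O \<inter> ?Y = {}" using Opoles OK X(2) by blast
  have fO: "f w = ?L (\<lambda>t. 1 / (t - w))" if "w \<in> ?O" for w
  proof -
    have "w \<in> ?K" using that OK by blast
    have "w \<in> level_interior E g \<rho> - zs ` {1..\<mu>}"
      using \<open>w \<in> ?K\<close> KU Usub Opoles that by blast
    moreover have "- v s * (1 / (zs s - w)) = v s / (w - zs s)" for s
      by (metis minus_diff_eq minus_divide_right mult_minus_left times_divide_eq_right mult.right_neutral)
    ultimately show ?thesis using f[of w] bspec[OF Lw \<open>w \<in> ?K\<close>] by simp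
  qed
  have nodesO: "\<forall>\<^sub>F p in sequentially. \<forall>i\<in>{1..p + k}. \<xi> p i \<in> ?O"
    by (rule no_limit_points_eventually_in[OF nlp O]) auto
  define rem where "rem = (\<lambda>p i j. L (\<lambda>t. 1 / node_poly (\<xi> p) (Suc j) (p + i) t))"
  have dd: "\<forall>\<^sub>F p in sequentially. \<forall>i\<in>{1..k}. \<forall>j\<le>k.
       divided_diff f (\<xi> p) (Suc j) (p + i - Suc j)
         = - (\<Sum>s=1..\<mu>. v s * (1 / node_poly (\<xi> p) (Suc j) (p + i) (zs s))) + rem p i j"
    using nodesO eventually_gt_at_top[of k]
  proof eventually_elim
    case (elim p)
    show ?case
    proof (intro ballI allI impI)
      fix i j assume ij: "i \<in> {1..k}" "j \<le> k"
      have n: "Suc j + (p + i - Suc j) = p + i" using elim(2) ij by simp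
      have cp: "equal_points_consecutive (p + k) (\<xi> p)" using cons[of p] elim(2) by simp
      have "divided_diff f (\<xi> p) (Suc j) (p + i - Suc j)
          = ?L (\<lambda>t. 1 / node_poly (\<xi> p) (Suc j) (Suc j + (p + i - Suc j)) t)"
      proof (rule divided_diff_cauchy_functional[OF L' O OY fO])
        show "\<xi> p r \<in> ?O" if "r \<in> {Suc j..Suc j + (p + i - Suc j)}" for r
          using elim(1) that n ij by (intro bspec[OF elim(1)]) auto
        show "\<xi> p b = \<xi> p a"
          if "Suc j \<le> a" "a \<le> b" "b \<le> d" "d \<le> Suc j + (p + i - Suc j)" "\<xi> p a = \<xi> p d" for a b d
        proof -
          have "1 \<le> a" "d \<le> p + k" using that(1,4) n ij by auto
          with that(2,3,5) cp show ?thesis unfolding equal_points_consecutive_def by blast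
        qed
      qed
      then show "divided_diff f (\<xi> p) (Suc j) (p + i - Suc j)
         = - (\<Sum>s=1..\<mu>. v s * (1 / node_poly (\<xi> p) (Suc j) (p + i) (zs s))) + rem p i j"
        unfolding n by (simp add: rem_def sum_negf)
    qed
  qed
  obtain R where R: "\<forall>\<^sub>F p in sequentially. \<forall>i\<in>{1..p + k}. \<xi> p i \<in> cball 0 R"
    using nlp by (auto simp: no_limit_points_outside_def)
  obtain R' where R': "\<And>t. t \<in> X \<Longrightarrow> cmod t \<le> R'"
    using compact_imp_bounded[OF X(1)] by (auto simp: bounded_iff)
  define B where "B = 1 + \<bar>R\<bar> + \<bar>R'\<bar>"
  have B: "1 \<le> B" by (simp add: B_def)
  have \<sigma>X: "\<sigma> < green_Phi g t" if "t \<in> X" for t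
  proof -
    have "ln \<sigma> < g t" using that X(2) by auto
    then have "exp (ln \<sigma>) < exp (g t)" by simp
    then show ?thesis using E(4) by (simp add: green_Phi_def)
  qed
  have low: "\<forall>\<^sub>F p in sequentially. \<forall>t\<in>X. (\<kappa> * \<sigma>) ^ p \<le> cmod (Psi k \<xi> p t)"
    by (rule Psi_ge_eventually[OF asym E(3) X(1) XE]) (use E(4) \<sigma>X in auto)
  have remb: "\<forall>\<^sub>F p in sequentially. \<forall>i\<in>{1..k}. \<forall>j\<le>k.
      cmod (rem p i j) \<le> (C * (B ^ k * B ^ k)) / (\<kappa> * \<sigma>) ^ p"
    using low nodesO R eventually_ge_at_top[of k]
  proof eventually_elim
    case (elim p)
    show ?case
    proof (intro ballI allI impI)
      fix i j assume ij: "i \<in> {1..k}" "j \<le> k"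
      have pos: "0 < (\<kappa> * \<sigma>) ^ p" using asym(2) E(4) by simp
      have lb: "(\<kappa> * \<sigma>) ^ p \<le> B ^ k * B ^ k * cmod (node_poly (\<xi> p) (Suc j) (p + i) t)" if t: "t \<in> X" for t
      proof -
        have "cmod (t - \<xi> p r) \<le> B" if "r \<in> {1..p + k}" for r
        proof -
          have "cmod (\<xi> p r) \<le> R" using elim(3) that by auto
          then show ?thesis using norm_triangle_ineq4[of t "\<xi> p r"] R'[OF t] unfolding B_def by linarith
        qed
        from node_poly_lower_bound[OF B this ij elim(4)]
        show ?thesis using elim(1) t unfolding Psi_def by fastforce
      qed
      have nz: "node_poly (\<xi> p) (Suc j) (p + i) t \<noteq> 0" if "t \<in> X" for t
        using lb[OF that] pos by auto
      have "cmod (L (\<lambda>t. 1 / node_poly (\<xi> p) (Suc j) (p + i) t)) \<le> C * ((B ^ k * B ^ k) / (\<kappa> * \<sigma>) ^ p)"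
      proof (intro LC[rule_format])
        show "continuous_on X (\<lambda>t. 1 / node_poly (\<xi> p) (Suc j) (p + i) t)"
          by (intro continuous_intros continuous_on_node_poly) (use nz in auto)
        show "0 \<le> (B ^ k * B ^ k) / (\<kappa> * \<sigma>) ^ p" using B pos by simp
        show "cmod (1 / node_poly (\<xi> p) (Suc j) (p + i) t) \<le> (B ^ k * B ^ k) / (\<kappa> * \<sigma>) ^ p"
          if "t \<in> X" for t
          using lb[OF that] pos nz[OF that] by (simp add: norm_divide divide_simps mult_ac)
      qed
      then show "cmod (rem p i j) \<le> (C * (B ^ k * B ^ k)) / (\<kappa> * \<sigma>) ^ p"
        by (simp add: rem_def)
    qed
  qed
  show ?thesis using that[OF dd remb] .
qed

section \<open>The interpolation problem\<close>

locale itea_setting =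
  fixes E :: "complex set" and g :: "complex \<Rightarrow> real"
    and \<xi> :: "nat \<Rightarrow> nat \<Rightarrow> complex"
    and ip :: "complex ^ 'n \<Rightarrow> complex ^ 'n \<Rightarrow> complex" and q :: "complex ^ 'n"
    and F \<Theta> :: "complex \<Rightarrow> complex ^ 'n"
    and zs :: "nat \<Rightarrow> complex" and vs :: "nat \<Rightarrow> complex ^ 'n"
    and \<rho> :: real and k \<mu> :: nat
  assumes closed_E: "closed E" and bounded_E: "bounded E"
    and green: "green_function_infinity E g"
    and k_ge_1: "k \<ge> 1"
    and consecutive: "\<And>p. p \<ge> 1 \<Longrightarrow> equal_points_consecutive (p + k) (\<xi> p)"
    and no_limit: "no_limit_points_outside E k \<xi>"
    and roots: "\<And>C. compact C \<Longrightarrow> C \<subseteq> - E \<Longrightarrow>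
           uniform_limit C (\<lambda>p z. root p (cmod (\<Prod>i=1..p + k. z - \<xi> p i)))
             (\<lambda>z. log_capacity E * green_Phi g z) sequentially"
    and ip: "is_inner_product ip"
    and \<rho>: "\<rho> > 1"
    and F_analytic: "\<And>l. (\<lambda>z. F z $ l) analytic_on E"
    and zs_inj: "inj_on zs {1..\<mu>}" and zs_in: "zs ` {1..\<mu>} \<subseteq> level_interior E g \<rho>"
    and vs_nz: "\<And>s. s \<in> {1..\<mu>} \<Longrightarrow> vs s \<noteq> 0"
    and \<Theta>_analytic: "\<And>l. (\<lambda>z. \<Theta> z $ l) analytic_on level_interior E g \<rho>"
    and F_eq: "\<And>z. z \<in> level_interior E g \<rho> - zs ` {1..\<mu>} \<Longrightarrow>
           F z = (\<Sum>s=1..\<mu>. (1 / (z - zs s)) *s vs s) + \<Theta> z"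
    and ordered: "mono_on {1..\<mu>} (\<lambda>s. green_Phi g (zs s))"
    and Phi_le: "\<And>s. s \<in> {1..\<mu>} \<Longrightarrow> green_Phi g (zs s) \<le> \<rho>"
    and residues: "(\<Prod>i=1..k. ip q (vs i)) \<noteq> 0"
begin

abbreviation \<kappa> :: real where "\<kappa> \<equiv> log_capacity E"
abbreviation \<Phi> :: "nat \<Rightarrow> real" where "\<Phi> s \<equiv> green_Phi g (zs s)"
abbreviation \<Psi> :: "nat \<Rightarrow> nat \<Rightarrow> complex" where "\<Psi> p s \<equiv> Psi k \<xi> p (zs s)"

lemma asymptotics: "node_asymptotics E g k \<xi> \<kappa>"
  unfolding node_asymptotics_def Psi_def node_poly_def using roots by blast

lemma \<kappa>_pos: "\<kappa> > 0"
  by (rule node_asymptotics_pos[OF asymptotics bounded_E no_limit])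

lemma F_component:
  assumes "z \<in> level_interior E g \<rho> - zs ` {1..\<mu>}"
  shows "F z $ l = (\<Sum>s=1..\<mu>. vs s $ l / (z - zs s)) + \<Theta> z $ l"
  unfolding F_eq[OF assms] by simp

text \<open>A nonzero residue in some coordinate would contradict the analyticity of
  \<open>F\<close> on \<open>E\<close>. The root asymptotics, given outside \<open>E\<close>, can
  thus be used at every pole.\<close>

lemma pole_not_in_E:
  assumes s: "s \<in> {1..\<mu>}"
  shows "zs s \<notin> E"
proof
  assume "zs s \<in> E"
  obtain l where l: "vs s $ l \<noteq> 0" using vs_nz[OF s] by (auto simp: Finite_Cartesian_Product.vec_eq_iff)
  let ?U = "{z. z \<in> E \<or> g z < ln \<rho>}"
  have sub: "?U \<subseteq> level_interior E g \<rho>"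
    by (rule green_sublevel_subset_level_interior[OF closed_E bounded_E green \<rho>])
  have "vs s $ l = 0"
  proof (rule simple_pole_not_analytic[where U = ?U and S = "{1..\<mu>}" and zs = zs and v = "\<lambda>s. vs s $ l"])
    show "open ?U" using \<rho> by (intro open_green_sublevel closed_E green) simp
    show "zs s \<in> ?U" using \<open>zs s \<in> E\<close> by simp
    show "isCont (\<lambda>z. F z $ l) (zs s)"
      using analytic_on_subset[OF F_analytic, of "{zs s}" l] \<open>zs s \<in> E\<close>
      by (intro analytic_at_imp_isCont) simp
    show "isCont (\<lambda>z. \<Theta> z $ l) (zs s)"
      using analytic_on_subset[OF \<Theta>_analytic, of "{zs s}" l] subsetD[OF zs_in imageI[OF s]]
      by (intro analytic_at_imp_isCont) simp
    show "F z $ l = (\<Sum>j=1..\<mu>. vs j $ l / (z - zs j)) + \<Theta> z $ l" if "z \<in> ?U - zs ` {1..\<mu>}" for z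
      by (rule F_component) (use that sub in blast)
  qed (use s zs_inj in auto)
  then show False using l by simp
qed

lemma \<Phi>_gt_1: "s \<in> {1..\<mu>} \<Longrightarrow> 1 < \<Phi> s"
  by (intro green_Phi_gt_1[OF green] pole_not_in_E)

lemma \<Phi>_less_\<rho>: "s \<in> {1..\<mu>} \<Longrightarrow> \<Phi> s < \<rho>"
  using green_Phi_less_in_level_interior[of "zs s" E g \<rho>] zs_in pole_not_in_E Phi_le by blast

lemma \<Phi>_mono: "s \<in> {1..\<mu>} \<Longrightarrow> t \<in> {1..\<mu>} \<Longrightarrow> s \<le> t \<Longrightarrow> \<Phi> s \<le> \<Phi> t"
  using ordered by (auto simp: mono_on_def)

lemma \<Psi>_ge:
  assumes "s \<in> {1..\<mu>}" "0 \<le> a" "a < \<Phi> s"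
  shows "\<forall>\<^sub>F p in sequentially. (\<kappa> * a) ^ p \<le> cmod (\<Psi> p s)"
  using Psi_ge_eventually[OF asymptotics \<kappa>_pos green, of "{zs s}" a] pole_not_in_E[OF assms(1)] assms(2,3)
  by simp

lemma \<Psi>_le:
  assumes "s \<in> {1..\<mu>}" "\<Phi> s < b"
  shows "\<forall>\<^sub>F p in sequentially. cmod (\<Psi> p s) \<le> (\<kappa> * b) ^ p"
  by (rule Psi_le_eventually[OF asymptotics \<kappa>_pos pole_not_in_E[OF assms(1)] assms(2)])

lemma \<Psi>_nonzero:
  assumes "s \<in> {1..\<mu>}"
  shows "\<forall>\<^sub>F p in sequentially. \<Psi> p s \<noteq> 0"
  using \<Psi>_ge[OF assms zero_le_one \<Phi>_gt_1[OF assms]]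
proof eventually_elim
  case (elim p)
  have "0 < (\<kappa> * 1) ^ p" using \<kappa>_pos by simp
  then show ?case using elim by auto
qed

text \<open>A level strictly between the two absorbs the subexponential factors of both sides. The
  root asymptotics give no such comparison on equal levels, which is why a maximum and a minimum
  over level lines occur in the error.\<close>

lemma \<Psi>_less:
  assumes "s \<in> {1..\<mu>}" "t \<in> {1..\<mu>}" "\<Phi> s < \<Phi> t"
  shows "\<forall>\<^sub>F p in sequentially. cmod (\<Psi> p s) \<le> cmod (\<Psi> p t)"
proof -
  obtain m where m: "\<Phi> s < m" "m < \<Phi> t" using dense[OF assms(3)] by blast
  then have "0 \<le> m" using \<Phi>_gt_1[OF assms(1)] by simp
  from \<Psi>_le[OF assms(1) m(1)] \<Psi>_ge[OF assms(2) this m(2)] show ?thesis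
    by eventually_elim linarith
qed

lemma itea_u_expansion:
  assumes \<sigma>: "1 < \<sigma>" "\<sigma> < \<rho>"
  obtains \<theta> M where
    "\<forall>\<^sub>F p in sequentially. \<forall>i\<in>{1..k}. \<forall>j\<le>k. itea_u ip q F \<xi> p i j =
      - (\<Sum>s=1..\<mu>. itea_alpha ip q k \<xi> zs vs p i s * node_poly (\<xi> p) 1 j (zs s) / \<Psi> p s) + \<theta> p i j"
    "\<forall>\<^sub>F p in sequentially. \<forall>i\<in>{1..k}. \<forall>j\<le>k. cmod (\<theta> p i j) \<le> M / (\<kappa> * \<sigma>) ^ p"
proof -
  define expands where "expands = (\<lambda>l r. \<forall>\<^sub>F p in sequentially. \<forall>i\<in>{1..k}. \<forall>j\<le>k.
       divided_diff (\<lambda>z. F z $ l) (\<xi> p) (Suc j) (p + i - Suc j)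
         = - (\<Sum>s=1..\<mu>. vs s $ l * (1 / node_poly (\<xi> p) (Suc j) (p + i) (zs s))) + r p i j)"
  define small where "small = (\<lambda>r M. \<forall>\<^sub>F p in sequentially. \<forall>i\<in>{1..k}. \<forall>j\<le>k.
       cmod (r p i j) \<le> M / (\<kappa> * \<sigma>) ^ p)"
  have "\<exists>r M. expands l r \<and> small r M" for l
    unfolding expands_def small_def
  proof (rule divided_diff_meromorphic[where E = E and g = g and \<sigma> = \<sigma> and \<rho> = \<rho> and k = k and \<xi> = \<xi>
        and \<kappa> = \<kappa> and \<mu> = \<mu> and zs = zs and \<theta> = "\<lambda>z. \<Theta> z $ l" and f = "\<lambda>z. F z $ l" and v = "\<lambda>s. vs s $ l"])
  qed (fact closed_E bounded_E green \<sigma> consecutive no_limit asymptotics \<kappa>_pos pole_not_in_E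
      \<Theta>_analytic F_component | (intro exI conjI; assumption))+
  then obtain rem M where rM: "\<And>l. expands l (rem l)" "\<And>l. small (rem l) (M l)"
    by metis
  \<comment> \<open>There are finitely many coordinates, so one threshold for \<open>p\<close>
    serves all of them.\<close>
  have rem: "\<forall>\<^sub>F p in sequentially. \<forall>l. \<forall>i\<in>{1..k}. \<forall>j\<le>k.
       divided_diff (\<lambda>z. F z $ l) (\<xi> p) (Suc j) (p + i - Suc j)
         = - (\<Sum>s=1..\<mu>. vs s $ l * (1 / node_poly (\<xi> p) (Suc j) (p + i) (zs s))) + rem l p i j"
    using rM(1) unfolding expands_def by (rule eventually_all_finite)
  have M: "\<forall>\<^sub>F p in sequentially. \<forall>l. \<forall>i\<in>{1..k}. \<forall>j\<le>k. cmod (rem l p i j) \<le> M l / (\<kappa> * \<sigma>) ^ p"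
    using rM(2) unfolding small_def by (rule eventually_all_finite)
  let ?e = "\<lambda>l. ip q (axis l 1)"
  define \<theta> where "\<theta> = (\<lambda>p i j. \<Sum>l\<in>UNIV. ?e l * rem l p i j)"
  have ip_eq: "ip q x = (\<Sum>l\<in>UNIV. ?e l * x $ l)" for x
    by (rule inner_product_expansion[OF ip])
  have nz: "\<forall>\<^sub>F p in sequentially. \<forall>s\<in>{1..\<mu>}. \<Psi> p s \<noteq> 0"
    by (intro eventually_ball_finite ballI \<Psi>_nonzero) auto
  have 1: "\<forall>\<^sub>F p in sequentially. \<forall>i\<in>{1..k}. \<forall>j\<le>k. itea_u ip q F \<xi> p i j =
      - (\<Sum>s=1..\<mu>. itea_alpha ip q k \<xi> zs vs p i s * node_poly (\<xi> p) 1 j (zs s) / \<Psi> p s) + \<theta> p i j"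
    using rem nz eventually_ge_at_top[of k]
  proof eventually_elim
    case (elim p)
    show ?case
    proof (intro ballI allI impI)
      fix i j assume ij: "i \<in> {1..k}" "j \<le> k"
      let ?r = "\<lambda>s. 1 / node_poly (\<xi> p) (Suc j) (p + i) (zs s)"
      have "itea_u ip q F \<xi> p i j
          = (\<Sum>l\<in>UNIV. ?e l * divided_diff (\<lambda>z. F z $ l) (\<xi> p) (Suc j) (p + i - Suc j))"
        unfolding itea_u_def by (subst ip_eq) (simp add: vec_divided_diff_def)
      also have "\<dots> = (\<Sum>l\<in>UNIV. ?e l * (- (\<Sum>s=1..\<mu>. vs s $ l * ?r s) + rem l p i j))"
        using elim(1) ij by (intro sum.cong refl) (simp only: HOL.simp_thms)
      also have "\<dots> = - (\<Sum>l\<in>UNIV. \<Sum>s=1..\<mu>. ?e l * vs s $ l * ?r s) + \<theta> p i j"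
        by (simp only: distrib_left sum.distrib \<theta>_def mult_minus_right sum_negf sum_distrib_left mult.assoc)
      also have "(\<Sum>l\<in>UNIV. \<Sum>s=1..\<mu>. ?e l * vs s $ l * ?r s) = (\<Sum>s=1..\<mu>. ip q (vs s) * ?r s)"
        by (subst sum.swap) (simp only: ip_eq[of "vs _"] sum_distrib_right)
      also have "\<dots> = (\<Sum>s=1..\<mu>. itea_alpha ip q k \<xi> zs vs p i s * node_poly (\<xi> p) 1 j (zs s) / \<Psi> p s)"
      proof (rule sum.cong)
        fix s assume "s \<in> {1..\<mu>}"
        then have "node_poly (\<xi> p) 1 (p + k) (zs s) \<noteq> 0" using elim(2) by (simp add: Psi_def)
        from reciprocal_node_poly[OF this ij elim(3)]
        show "ip q (vs s) * ?r s
            = itea_alpha ip q k \<xi> zs vs p i s * node_poly (\<xi> p) 1 j (zs s) / \<Psi> p s"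
          by (simp add: itea_alpha_def Psi_def)
      qed simp
      finally show "itea_u ip q F \<xi> p i j =
        - (\<Sum>s=1..\<mu>. itea_alpha ip q k \<xi> zs vs p i s * node_poly (\<xi> p) 1 j (zs s) / \<Psi> p s) + \<theta> p i j" .
    qed
  qed
  have 2: "\<forall>\<^sub>F p in sequentially. \<forall>i\<in>{1..k}. \<forall>j\<le>k.
      cmod (\<theta> p i j) \<le> (\<Sum>l\<in>UNIV. cmod (?e l) * M l) / (\<kappa> * \<sigma>) ^ p"
    using M
  proof eventually_elim
    case (elim p)
    show ?case
    proof (intro ballI allI impI)
      fix i j assume ij: "i \<in> {1..k}" "j \<le> k"
      have "cmod (\<theta> p i j) \<le> (\<Sum>l\<in>UNIV. cmod (?e l) * (M l / (\<kappa> * \<sigma>) ^ p))"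
        unfolding \<theta>_def
      proof (rule sum_norm_le)
        fix l
        have "cmod (rem l p i j) \<le> M l / (\<kappa> * \<sigma>) ^ p" using elim ij by blast
        then show "cmod (?e l * rem l p i j) \<le> cmod (?e l) * (M l / (\<kappa> * \<sigma>) ^ p)"
          unfolding norm_mult by (rule mult_left_mono) simp
      qed
      then show "cmod (\<theta> p i j) \<le> (\<Sum>l\<in>UNIV. cmod (?e l) * M l) / (\<kappa> * \<sigma>) ^ p"
        by (simp add: sum_divide_distrib)
    qed
  qed
  show ?thesis using that[OF 1 2] .
qed

section \<open>The error scale in the two cases\<close>

abbreviation hat :: "nat \<Rightarrow> real" where "hat \<equiv> Psi_hat g k \<xi> zs"

text \<open>The maximum is taken over the poles on the level line of \<open>zs k\<close> alone; at
  poles on lower lines \<Psi> is eventually no larger in modulus than at \<open>zs k\<close>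
  itself.\<close>

lemma hat_ge:
  assumes "k \<le> \<mu>"
  shows "\<forall>\<^sub>F p in sequentially. \<forall>s\<in>{1..k}. \<Psi> p s \<noteq> 0 \<and> cmod (\<Psi> p s) \<le> hat p"
proof (intro eventually_ball_finite ballI eventually_conj)
  have kk: "k \<in> {1..\<mu>}" using assms k_ge_1 by auto
  have le: "cmod (\<Psi> p s) \<le> hat p" if "s \<in> {1..k}" "\<Phi> s = \<Phi> k" for p s
    unfolding Psi_hat_def by (rule Max_ge) (use that in auto)
  fix s assume s: "s \<in> {1..k}"
  then have s': "s \<in> {1..\<mu>}" using assms by auto
  show "\<forall>\<^sub>F p in sequentially. \<Psi> p s \<noteq> 0" by (rule \<Psi>_nonzero[OF s'])
  show "\<forall>\<^sub>F p in sequentially. cmod (\<Psi> p s) \<le> hat p"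
  proof (cases "\<Phi> s = \<Phi> k")
    case True
    then show ?thesis using le[OF s] by simp
  next
    case False
    then have "\<Phi> s < \<Phi> k" using \<Phi>_mono[OF s' kk] s by auto
    from \<Psi>_less[OF s' kk this] show ?thesis
    proof eventually_elim
      case (elim p)
      have "cmod (\<Psi> p k) \<le> hat p" using k_ge_1 by (intro le) auto
      then show ?case using elim by linarith
    qed
  qed
qed simp

lemma hat_le:
  assumes "k \<le> \<mu>" "\<Phi> k < b"
  shows "\<forall>\<^sub>F p in sequentially. hat p \<le> (\<kappa> * b) ^ p"
proof -
  let ?S = "{i \<in> {1..k}. \<Phi> i = \<Phi> k}"
  have "\<forall>\<^sub>F p in sequentially. \<forall>s\<in>?S. cmod (\<Psi> p s) \<le> (\<kappa> * b) ^ p"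
    using assms by (intro eventually_ball_finite ballI \<Psi>_le) auto
  then show ?thesis
  proof eventually_elim
    case (elim p)
    show ?case unfolding Psi_hat_def
    proof (rule Max.boundedI)
      show "(\<lambda>i. cmod (\<Psi> p i)) ` ?S \<noteq> {}" using k_ge_1 by auto
    qed (use elim in auto)
  qed
qed

text \<open>Since \<open>\<Phi> k < \<tau> * b\<close>, the upper bound for \<open>hat\<close> at
  level \<open>\<tau> * b\<close> applies, and it splits into \<open>\<tau> ^ p\<close> and the
  lower bound \<open>(\<kappa> * b) ^ p\<close> for \<open>til\<close>.\<close>

lemma ratio_le:
  assumes "k \<le> \<mu>" "0 < b" "\<Phi> k / b < \<tau>" "\<forall>\<^sub>F p in sequentially. (\<kappa> * b) ^ p \<le> til p"
  shows "\<forall>\<^sub>F p in sequentially. hat p / til p \<le> \<tau> ^ p"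
proof -
  have "\<Phi> k < \<tau> * b" using assms(2,3) by (simp add: divide_less_eq)
  moreover have "0 < \<Phi> k" by (simp add: green_Phi_def)
  ultimately have "0 < \<tau> * b" by linarith
  then have \<tau>: "0 < \<tau>" using assms(2) zero_less_mult_pos2 by blast
  from hat_le[OF assms(1) \<open>\<Phi> k < \<tau> * b\<close>] assms(4) show ?thesis
  proof eventually_elim
    case (elim p)
    have pos: "0 < (\<kappa> * b) ^ p" using \<kappa>_pos assms(2) by simp
    have "hat p \<le> \<tau> ^ p * (\<kappa> * b) ^ p"
      using elim(1) by (simp add: power_mult_distrib mult_ac)
    also have "\<dots> \<le> \<tau> ^ p * til p" using elim(2) \<tau> by (intro mult_left_mono) auto
    finally show ?case using elim(2) pos by (simp add: divide_le_eq)
  qed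
qed

text \<open>\<open>til\<close> is held between two geometric rates: the lower one, with
  \<open>b > \<Phi> k\<close>, makes \<open>hat p / til p\<close> tend to 0, and the upper one, with
  \<open>\<sigma> < \<rho>\<close>, lets the contribution of \<open>\<Theta>\<close> be measured by
  \<open>1 / til p\<close>.\<close>

lemma core:
  assumes k: "k \<le> \<mu>" and \<sigma>: "1 < \<sigma>" "\<sigma> < \<rho>" and b: "\<Phi> k < b"
    and til_ge: "\<forall>\<^sub>F p in sequentially. (\<kappa> * b) ^ p \<le> til p"
    and til_le: "\<forall>\<^sub>F p in sequentially. til p \<le> (\<kappa> * \<sigma>) ^ p"
    and til: "\<forall>\<^sub>F p in sequentially. \<forall>s\<in>{k<..\<mu>}. til p \<le> cmod (\<Psi> p s)"
  obtains \<theta> R M where "itea_asymptotics ip q F k \<mu> \<xi> zs vs \<theta> hat til R M"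
proof -
  have b0: "0 < b" using b exp_gt_zero[of "g (zs k)"] unfolding green_Phi_def by linarith
  have til_pos: "\<forall>\<^sub>F p in sequentially. 0 < til p"
    using til_ge
  proof eventually_elim
    case (elim p)
    have "0 < (\<kappa> * b) ^ p" using \<kappa>_pos b0 by simp
    then show ?case using elim by linarith
  qed
  obtain \<theta> M where exp: "\<forall>\<^sub>F p in sequentially. \<forall>i\<in>{1..k}. \<forall>j\<le>k. itea_u ip q F \<xi> p i j =
      - (\<Sum>s=1..\<mu>. itea_alpha ip q k \<xi> zs vs p i s * node_poly (\<xi> p) 1 j (zs s) / \<Psi> p s) + \<theta> p i j"
    and M: "\<forall>\<^sub>F p in sequentially. \<forall>i\<in>{1..k}. \<forall>j\<le>k. cmod (\<theta> p i j) \<le> M / (\<kappa> * \<sigma>) ^ p"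
    by (rule itea_u_expansion[OF \<sigma>])
  obtain R where R: "\<forall>\<^sub>F p in sequentially. \<forall>i\<in>{1..p + k}. cmod (\<xi> p i) \<le> R"
    using no_limit by (auto simp: no_limit_points_outside_def)
  have "itea_asymptotics ip q F k \<mu> \<xi> zs vs \<theta> hat til R \<bar>M\<bar>"
  proof (rule itea_asymptotics.intro)
    show "ip q (vs i) \<noteq> 0" if "i \<in> {1..k}" for i
      using residues that by (auto simp: prod_zero_iff)
    show "\<forall>\<^sub>F p in sequentially. \<forall>i\<in>{1..k}. \<forall>j\<le>k. cmod (\<theta> p i j) \<le> \<bar>M\<bar> / til p"
      using M til_pos til_le
    proof eventually_elim
      case (elim p)
      have "M / (\<kappa> * \<sigma>) ^ p \<le> \<bar>M\<bar> / til p"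
        using elim(2,3) by (intro frac_le) auto
      then show ?case using elim(1) by (meson order_trans)
    qed
    show "\<forall>\<^sub>F p in sequentially. 0 < til p \<and> (\<forall>s\<in>{k<..\<mu>}. til p \<le> cmod (\<Psi> p s))"
      using til_pos til by eventually_elim simp
    show "(\<lambda>p. hat p / til p) \<longlonglongrightarrow> 0"
    proof -
      have "\<Phi> k / b < 1" using b b0 by simp
      then obtain \<tau> where \<tau>: "\<Phi> k / b < \<tau>" "\<tau> < 1" using dense by blast
      have "0 < \<Phi> k / b" using b0 by (simp add: green_Phi_def)
      then have "0 \<le> \<tau>" using \<tau> by linarith
      have "\<forall>\<^sub>F p in sequentially. 0 \<le> hat p / til p"
        using hat_ge[OF k] til_pos
      proof eventually_elim
        case (elim p)
        have "0 \<le> cmod (\<Psi> p k)" by simp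
        also have "\<dots> \<le> hat p" using elim(1) k_ge_1 by auto
        finally show ?case using elim(2) by simp
      qed
      then show ?thesis
        using ratio_le[OF k b0 \<tau>(1) til_ge]
        by (rule tendsto_sandwich) (use \<open>0 \<le> \<tau>\<close> \<tau>(2) in \<open>auto intro!: LIMSEQ_power_zero\<close>)
    qed
  qed (fact k zs_inj R exp hat_ge[OF k])+
  then show ?thesis by (rule that)
qed

abbreviation V_limsup :: "complex set \<Rightarrow> ereal" where
  "V_limsup C \<equiv> limsup (\<lambda>p. SUP z\<in>C.
     ereal (root p (cmod (itea_V ip q F k \<xi> p z - (\<Prod>i=1..k. z - zs i)))))"

lemma V_limsup_le:
  assumes "k \<le> \<mu>" "compact C" "0 < b" "\<Phi> k / b < \<tau>"
    and "\<forall>\<^sub>F p in sequentially. (\<kappa> * b) ^ p \<le> til p"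
    and "itea_asymptotics ip q F k \<mu> \<xi> zs vs \<theta> hat til R M"
  shows "V_limsup C \<le> ereal \<tau>"
proof -
  obtain \<tau>' where \<tau>': "\<Phi> k / b < \<tau>'" "\<tau>' < \<tau>" using dense[OF assms(4)] by blast
  have "0 < \<Phi> k / b" using assms(3) by (simp add: green_Phi_def)
  then have "0 \<le> \<tau>'" using \<tau>' by linarith
  show ?thesis
    by (rule itea_asymptotics.itea_V_limsup[OF assms(6) k_ge_1 assms(2) \<open>0 \<le> \<tau>'\<close> \<tau>'(2)
          ratio_le[OF assms(1,3) \<tau>'(1) assms(5)]])
qed

text \<open>Each level \<open>b'\<close> below \<open>b\<close> yields every bound above
  \<open>\<Phi> k / b'\<close>; letting \<open>b'\<close> increase to \<open>b\<close> removes the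
  loss.\<close>

lemma V_limsup_le_limit:
  assumes "\<Phi> k < b"
    and "\<And>b' \<tau>. \<Phi> k < b' \<Longrightarrow> b' < b \<Longrightarrow> \<Phi> k / b' < \<tau> \<Longrightarrow> V_limsup C \<le> ereal \<tau>"
  shows "V_limsup C \<le> ereal (\<Phi> k / b)"
proof (rule ereal_le_epsilon2)
  fix e :: real assume e: "0 < e"
  have a: "0 < \<Phi> k" by (simp add: green_Phi_def)
  then have b: "0 < b" using assms(1) by linarith
  have \<tau>: "0 < \<Phi> k / b + e" using a b e by (simp add: add_pos_pos)
  have "\<Phi> k < (\<Phi> k / b + e) * b" using b e by (simp add: distrib_right)
  then have "\<Phi> k / (\<Phi> k / b + e) < b" using \<tau> by (simp add: divide_less_eq mult.commute)
  then obtain b' where b': "max (\<Phi> k) (\<Phi> k / (\<Phi> k / b + e)) < b'" "b' < b"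
    using dense[of "max (\<Phi> k) (\<Phi> k / (\<Phi> k / b + e))" b] assms(1) by auto
  then have "\<Phi> k / b' < \<Phi> k / b + e"
    using a \<tau> by (simp add: divide_less_eq mult.commute)
  then show "V_limsup C \<le> ereal (\<Phi> k / b) + ereal e"
    using assms(2)[of b' "\<Phi> k / b + e"] b' by simp
qed

text \<open>No pole is discarded, so \<open>(\<kappa> * \<sigma>) ^ p\<close> can serve as
  \<open>til\<close> for every \<open>\<sigma>\<close> between \<open>\<Phi> k\<close> and
  \<open>\<rho>\<close>. Letting \<open>\<sigma>\<close> tend to \<open>\<rho>\<close> then gives
  the rate.\<close>

lemma case_equal:
  assumes "k = \<mu>"
  shows "\<forall>\<^sub>F p in sequentially. itea_det ip q F k \<xi> p \<noteq> 0"
    and "compact C \<Longrightarrow> V_limsup C \<le> ereal (\<Phi> k / \<rho>)"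
proof -
  have k: "k \<le> \<mu>" "k \<in> {1..\<mu>}" using assms k_ge_1 by auto
  have ex: "\<exists>\<theta> R M. itea_asymptotics ip q F k \<mu> \<xi> zs vs \<theta> hat (\<lambda>p. (\<kappa> * \<sigma>) ^ p) R M"
    if \<sigma>: "\<Phi> k < \<sigma>" "\<sigma> < \<rho>" for \<sigma>
  proof -
    have "1 < \<sigma>" using \<Phi>_gt_1[OF k(2)] \<sigma>(1) by linarith
    show ?thesis
    proof (rule core[where til = "\<lambda>p. (\<kappa> * \<sigma>) ^ p", OF k(1) \<open>1 < \<sigma>\<close> \<sigma>(2,1)])
      show "\<forall>\<^sub>F p in sequentially. \<forall>s\<in>{k<..\<mu>}. (\<kappa> * \<sigma>) ^ p \<le> cmod (\<Psi> p s)"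
        using assms by simp
    qed (simp, simp, intro exI, assumption)
  qed
  obtain \<sigma> where "\<Phi> k < \<sigma>" "\<sigma> < \<rho>" using dense[OF \<Phi>_less_\<rho>[OF k(2)]] by blast
  from ex[OF this] show "\<forall>\<^sub>F p in sequentially. itea_det ip q F k \<xi> p \<noteq> 0"
    using itea_asymptotics.itea_det_nonzero k_ge_1 by blast
  assume C: "compact C"
  show "V_limsup C \<le> ereal (\<Phi> k / \<rho>)"
  proof (rule V_limsup_le_limit[OF \<Phi>_less_\<rho>[OF k(2)]])
    fix \<sigma> \<tau> assume \<sigma>: "\<Phi> k < \<sigma>" "\<sigma> < \<rho>" "\<Phi> k / \<sigma> < \<tau>"
    have "0 < \<sigma>" using \<Phi>_gt_1[OF k(2)] \<sigma>(1) by linarith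
    then show "V_limsup C \<le> ereal \<tau>"
      using ex[OF \<sigma>(1,2)] V_limsup_le[OF k(1) C _ \<sigma>(3), of "\<lambda>p. (\<kappa> * \<sigma>) ^ p"] by auto
  qed
qed

text \<open>Poles on the level line of \<open>zs (k + 1)\<close> dominate \<open>Psi_tilde\<close>
  because it is a minimum over them, and poles beyond that line do so eventually because the gap
  after \<open>zs (k + r)\<close> is strict. The lower growth rates of \<open>Psi_tilde\<close> are
  exported as well, since the limsup requires all \<open>b < \<Phi> (k + 1)\<close>.\<close>

lemma case_less:
  assumes r: "k < \<mu>" "1 \<le> r" "k + r \<le> \<mu>" and gap: "\<Phi> k < \<Phi> (k + 1)"
    and level: "\<forall>j\<in>{1..r}. \<Phi> (k + j) = \<Phi> (k + 1)"
    and next_gap: "\<Phi> (k + r) < (if k + r < \<mu> then \<Phi> (k + r + 1) else \<rho>)"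
  obtains \<theta> R M where "itea_asymptotics ip q F k \<mu> \<xi> zs vs \<theta> hat (Psi_tilde r k \<xi> zs) R M"
    and "\<And>b. 0 \<le> b \<Longrightarrow> b < \<Phi> (k + 1) \<Longrightarrow>
      \<forall>\<^sub>F p in sequentially. (\<kappa> * b) ^ p \<le> Psi_tilde r k \<xi> zs p"
proof -
  let ?til = "Psi_tilde r k \<xi> zs"
  have k1: "k + 1 \<in> {1..\<mu>}" using r by auto
  have lev: "\<Phi> (k + j) = \<Phi> (k + 1)" if "j \<in> {1..r}" for j using level that by blast
  have til_ge: "\<forall>\<^sub>F p in sequentially. (\<kappa> * b) ^ p \<le> ?til p" if b: "0 \<le> b" "b < \<Phi> (k + 1)" for b
  proof -
    have "\<forall>\<^sub>F p in sequentially. \<forall>j\<in>{1..r}. (\<kappa> * b) ^ p \<le> cmod (\<Psi> p (k + j))"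
      using b r lev by (intro eventually_ball_finite ballI \<Psi>_ge) auto
    then show ?thesis
    proof eventually_elim
      case (elim p)
      show ?case unfolding Psi_tilde_def
        by (rule Min.boundedI) (use elim r in auto)
    qed
  qed
  have til_min: "?til p \<le> cmod (\<Psi> p (k + j))" if "j \<in> {1..r}" for p j
    unfolding Psi_tilde_def by (rule Min_le) (use that in auto)
  have til: "\<forall>\<^sub>F p in sequentially. \<forall>s\<in>{k<..\<mu>}. ?til p \<le> cmod (\<Psi> p s)"
  proof (intro eventually_ball_finite ballI)
    fix s assume s: "s \<in> {k<..\<mu>}"
    show "\<forall>\<^sub>F p in sequentially. ?til p \<le> cmod (\<Psi> p s)"
    proof (cases "s \<le> k + r")
      case True
      then have "s - k \<in> {1..r}" "k + (s - k) = s" using s by auto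
      then show ?thesis using til_min[of "s - k"] by simp
    next
      case False
      then have *: "k + r < \<mu>" "k + r + 1 \<le> s" "s \<in> {1..\<mu>}" "k + r + 1 \<in> {1..\<mu>}" using s by auto
      have "\<Phi> (k + 1) < \<Phi> s"
        using next_gap lev[of r] r *(1) \<Phi>_mono[OF *(4,3,2)] by auto
      from \<Psi>_less[OF k1 *(3) this] show ?thesis
      proof eventually_elim
        case (elim p)
        then show ?case using til_min[of 1 p] r by simp
      qed
    qed
  qed simp
  have "\<Phi> (k + 1) < \<rho>" by (rule \<Phi>_less_\<rho>[OF k1])
  \<comment> \<open>A rate above the level of \<open>zs (k + 1)\<close> dominates
    \<open>Psi_tilde\<close>, and below \<open>\<rho>\<close> it is still admissible for the
    remainder, which is therefore of order at most \<open>1 / Psi_tilde\<close>.\<close>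
  then obtain \<sigma> where \<sigma>: "\<Phi> (k + 1) < \<sigma>" "\<sigma> < \<rho>" using dense by blast
  have "1 < \<sigma>" using \<Phi>_gt_1[OF k1] \<sigma>(1) by linarith
  have til_le: "\<forall>\<^sub>F p in sequentially. ?til p \<le> (\<kappa> * \<sigma>) ^ p"
    using \<Psi>_le[OF k1 \<sigma>(1)]
  proof eventually_elim
    case (elim p)
    then show ?case using til_min[of 1 p] r by simp
  qed
  obtain b where b: "\<Phi> k < b" "b < \<Phi> (k + 1)" using dense[OF gap] by blast
  have "0 \<le> b" using b(1) exp_gt_zero[of "g (zs k)"] unfolding green_Phi_def by linarith
  obtain \<theta> R M where "itea_asymptotics ip q F k \<mu> \<xi> zs vs \<theta> hat ?til R M"
    using core[OF _ \<open>1 < \<sigma>\<close> \<sigma>(2) b(1) til_ge[OF \<open>0 \<le> b\<close> b(2)] til_le til] r(1) by (metis less_imp_le)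
  then show ?thesis using til_ge by (rule that)
qed

end

theorem theorem6p2:
  fixes E :: "complex set" and g :: "complex \<Rightarrow> real"
    and \<xi> :: "nat \<Rightarrow> nat \<Rightarrow> complex"
    and ip :: "complex ^ 'n \<Rightarrow> complex ^ 'n \<Rightarrow> complex" and q :: "complex ^ 'n"
    and F \<Theta> :: "complex \<Rightarrow> complex ^ 'n"
    and zs :: "nat \<Rightarrow> complex" and vs :: "nat \<Rightarrow> complex ^ 'n"
    and \<rho> :: real and k \<mu> :: nat
  assumes "closed E" and "bounded E"
    and "green_function_infinity E g"
    and "k \<ge> 1"
    and "\<And>p. p \<ge> 1 \<Longrightarrow> equal_points_consecutive (p + k) (\<xi> p)"
    and "no_limit_points_outside E k \<xi>"
    and "\<And>C. compact C \<Longrightarrow> C \<subseteq> - E \<Longrightarrow>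
           uniform_limit C (\<lambda>p z. root p (cmod (\<Prod>i=1..p + k. z - \<xi> p i)))
             (\<lambda>z. log_capacity E * green_Phi g z) sequentially"
    and "is_inner_product ip" and "q \<noteq> 0"
    and "\<rho> > 1"
    and "\<And>l. (\<lambda>z. F z $ l) analytic_on E"
    and "inj_on zs {1..\<mu>}" and "zs ` {1..\<mu>} \<subseteq> level_interior E g \<rho>"
    and "\<And>s. s \<in> {1..\<mu>} \<Longrightarrow> vs s \<noteq> 0"
    and "\<And>l. (\<lambda>z. \<Theta> z $ l) analytic_on level_interior E g \<rho>"
    and "\<And>z. z \<in> level_interior E g \<rho> - zs ` {1..\<mu>} \<Longrightarrow>
           F z = (\<Sum>s=1..\<mu>. (1 / (z - zs s)) *s vs s) + \<Theta> z"
    and "mono_on {1..\<mu>} (\<lambda>s. green_Phi g (zs s))"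
    and "\<And>s. s \<in> {1..\<mu>} \<Longrightarrow> green_Phi g (zs s) \<le> \<rho>"
    and "(\<Prod>i=1..k. ip q (vs i)) \<noteq> 0"
  shows
    "(\<forall>r. k < \<mu> \<and> 1 \<le> r \<and> k + r \<le> \<mu> \<and>
          green_Phi g (zs k) < green_Phi g (zs (k + 1)) \<and>
          (\<forall>j\<in>{1..r}. green_Phi g (zs (k + j)) = green_Phi g (zs (k + 1))) \<and>
          green_Phi g (zs (k + r)) <
            (if k + r < \<mu> then green_Phi g (zs (k + r + 1)) else \<rho>) \<longrightarrow>
        (\<forall>p\<ge>1. itea_T ip q k \<xi> zs vs p (\<lambda>j. j) = itea_T ip q k \<xi> zs vs 1 (\<lambda>j. j) \<and>
                itea_T ip q k \<xi> zs vs p (\<lambda>j. j) \<noteq> 0) \<and>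
        (\<forall>C. compact C \<and> C \<subseteq> - zs ` {1..k} \<longrightarrow>
          (\<exists>\<epsilon>. uniform_bigo C \<epsilon> (\<lambda>p. Psi_hat g k \<xi> zs p / Psi_tilde r k \<xi> zs p) \<and>
            (\<forall>\<^sub>F p in sequentially. \<forall>z\<in>C.
               itea_Q ip q F k \<xi> p z =
                 (- 1) ^ k * itea_T ip q k \<xi> zs vs p (\<lambda>j. j) * vandermonde k (zs(0 := z))
                 * inverse (\<Prod>i=1..k. Psi k \<xi> p (zs i)) * (1 + \<epsilon> p z)))) \<and>
        (\<forall>\<^sub>F p in sequentially. itea_det ip q F k \<xi> p \<noteq> 0) \<and>
        (\<forall>C. compact C \<longrightarrow>
          uniform_bigo C (\<lambda>p z. itea_V ip q F k \<xi> p z - (\<Prod>i=1..k. z - zs i))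
            (\<lambda>p. Psi_hat g k \<xi> zs p / Psi_tilde r k \<xi> zs p)) \<and>
        (\<forall>C. compact C \<longrightarrow>
          limsup (\<lambda>p. SUP z\<in>C.
              ereal (root p (cmod (itea_V ip q F k \<xi> p z - (\<Prod>i=1..k. z - zs i)))))
            \<le> ereal (green_Phi g (zs k) / green_Phi g (zs (k + 1))))) \<and>
     (k = \<mu> \<longrightarrow>
        (\<forall>\<^sub>F p in sequentially. itea_det ip q F k \<xi> p \<noteq> 0) \<and>
        (\<forall>C. compact C \<and> C \<subseteq> - zs ` {1..\<mu>} \<longrightarrow>
          limsup (\<lambda>p. SUP z\<in>C.
              ereal (root p (cmod (itea_V ip q F k \<xi> p z - (\<Prod>i=1..k. z - zs i)))))
            \<le> ereal (green_Phi g (zs k) / \<rho>)))"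
proof -
  interpret itea_setting E g \<xi> ip q F \<Theta> zs vs \<rho> k \<mu>
    by (rule itea_setting.intro) (fact assms)+
  show ?thesis
  proof (rule conjI; intro allI impI)
    fix r
    assume "k < \<mu> \<and> 1 \<le> r \<and> k + r \<le> \<mu> \<and> \<Phi> k < \<Phi> (k + 1) \<and>
      (\<forall>j\<in>{1..r}. \<Phi> (k + j) = \<Phi> (k + 1)) \<and>
      \<Phi> (k + r) < (if k + r < \<mu> then \<Phi> (k + r + 1) else \<rho>)"
    then have r: "k < \<mu>" "1 \<le> r" "k + r \<le> \<mu>" "\<Phi> k < \<Phi> (k + 1)"
      "\<forall>j\<in>{1..r}. \<Phi> (k + j) = \<Phi> (k + 1)"
      "\<Phi> (k + r) < (if k + r < \<mu> then \<Phi> (k + r + 1) else \<rho>)" by blast+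
    let ?til = "Psi_tilde r k \<xi> zs"
    obtain \<theta> R M where asym: "itea_asymptotics ip q F k \<mu> \<xi> zs vs \<theta> hat ?til R M"
      and til: "\<And>b. 0 \<le> b \<Longrightarrow> b < \<Phi> (k + 1) \<Longrightarrow> \<forall>\<^sub>F p in sequentially. (\<kappa> * b) ^ p \<le> ?til p"
      using case_less[OF r] by blast
    interpret A: itea_asymptotics ip q F k \<mu> \<xi> zs vs \<theta> hat ?til R M by (rule asym)
    define t where "t = A.T"
    have T_eq: "itea_T ip q k \<xi> zs vs p (\<lambda>j. j) = t" for p
      unfolding t_def by (rule A.itea_T_const)
    show "(\<forall>p\<ge>1. itea_T ip q k \<xi> zs vs p (\<lambda>j. j) = itea_T ip q k \<xi> zs vs 1 (\<lambda>j. j) \<and>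
                itea_T ip q k \<xi> zs vs p (\<lambda>j. j) \<noteq> 0) \<and>
        (\<forall>C. compact C \<and> C \<subseteq> - zs ` {1..k} \<longrightarrow>
          (\<exists>\<epsilon>. uniform_bigo C \<epsilon> (\<lambda>p. hat p / ?til p) \<and>
            (\<forall>\<^sub>F p in sequentially. \<forall>z\<in>C.
               itea_Q ip q F k \<xi> p z =
                 (- 1) ^ k * itea_T ip q k \<xi> zs vs p (\<lambda>j. j) * vandermonde k (zs(0 := z))
                 * inverse (\<Prod>i=1..k. Psi k \<xi> p (zs i)) * (1 + \<epsilon> p z)))) \<and>
        (\<forall>\<^sub>F p in sequentially. itea_det ip q F k \<xi> p \<noteq> 0) \<and>
        (\<forall>C. compact C \<longrightarrow>
          uniform_bigo C (\<lambda>p z. itea_V ip q F k \<xi> p z - (\<Prod>i=1..k. z - zs i)) (\<lambda>p. hat p / ?til p)) \<and>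
        (\<forall>C. compact C \<longrightarrow> V_limsup C \<le> ereal (\<Phi> k / \<Phi> (k + 1)))"
    proof (intro conjI allI impI)
      fix p
      show "itea_T ip q k \<xi> zs vs p (\<lambda>j. j) = itea_T ip q k \<xi> zs vs 1 (\<lambda>j. j)"
        by (simp only: T_eq)
      show "itea_T ip q k \<xi> zs vs p (\<lambda>j. j) \<noteq> 0"
        using A.T_nonzero unfolding T_eq .
    next
      fix C assume "compact C \<and> C \<subseteq> - zs ` {1..k}"
      then show "\<exists>\<epsilon>. uniform_bigo C \<epsilon> (\<lambda>p. hat p / ?til p) \<and>
            (\<forall>\<^sub>F p in sequentially. \<forall>z\<in>C.
               itea_Q ip q F k \<xi> p z =
                 (- 1) ^ k * itea_T ip q k \<xi> zs vs p (\<lambda>j. j) * vandermonde k (zs(0 := z))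
                 * inverse (\<Prod>i=1..k. Psi k \<xi> p (zs i)) * (1 + \<epsilon> p z))"
        using A.itea_Q_asymptotics[OF k_ge_1, of C] unfolding T_eq by blast
    next
      show "\<forall>\<^sub>F p in sequentially. itea_det ip q F k \<xi> p \<noteq> 0"
        by (rule A.itea_det_nonzero[OF k_ge_1])
    next
      fix C :: "complex set" assume "compact C"
      then show "uniform_bigo C (\<lambda>p z. itea_V ip q F k \<xi> p z - (\<Prod>i=1..k. z - zs i)) (\<lambda>p. hat p / ?til p)"
        by (rule A.itea_V_asymptotics[OF k_ge_1])
    next
      fix C :: "complex set" assume C: "compact C"
      show "V_limsup C \<le> ereal (\<Phi> k / \<Phi> (k + 1))"
      proof (rule V_limsup_le_limit[OF r(4)])
        fix b \<tau> assume b: "\<Phi> k < b" "b < \<Phi> (k + 1)" "\<Phi> k / b < \<tau>"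
        then have "0 < b" using exp_gt_zero[of "g (zs k)"] unfolding green_Phi_def by linarith
        then show "V_limsup C \<le> ereal \<tau>"
          using r(1) by (intro V_limsup_le[OF _ C _ b(3) til[OF _ b(2)] asym]) auto
      qed
    qed
  next
    assume "k = \<mu>"
    from case_equal[OF this] show "(\<forall>\<^sub>F p in sequentially. itea_det ip q F k \<xi> p \<noteq> 0) \<and>
        (\<forall>C. compact C \<and> C \<subseteq> - zs ` {1..\<mu>} \<longrightarrow> V_limsup C \<le> ereal (\<Phi> k / \<rho>))"
      by blast
  qed
qed

end
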